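(* Let $\mathcal{A}$ be a category and let $\Sigma$ be a class of arrows of $\mathcal{A}$ containing the identities (called weak equivalences). Suppose that $\Sigma$ satisfies the "2 for 1" property and that every arrow of $\Sigma$ is a composition of split arrows belonging to $\Sigma$. Then the inclusion $i:\mathcal{A}\to\mathcal{H}o(\mathcal{A})$ into the homotopy 2-category of $(\mathcal{A},\Sigma)$ is the 2-localization of $\mathcal{A}$ at $\Sigma$. Furthermore, for every 2-category $\mathcal{D}$, the precomposition 2-functors $$i^*: Hom_{s}(\mathcal{H}o(\mathcal{A}),\mathcal{D})\longrightarrow Hom_{s}(\mathcal{A},\mathcal{D})_+ ,\qquad i^*: Hom_{p}(\mathcal{H}o(\mathcal{A}),\mathcal{D})\longrightarrow Hom_{p}(\mathcal{A},\mathcal{D})_+$$ are both isomorphisms of 2-categories.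
   Context: Conventions. A category is regarded as a 2-category with only identity 2-cells; an arrow is identified with its identity 2-cell; horizontal composition is juxtaposition, vertical composition is $\circ$. An arrow $f:X\to Y$ of a 2-category is an equivalence if there are $g:Y\to X$ and invertible 2-cells $id_X\Rightarrow gf$, $fg\Rightarrow id_Y$. "2 for 1": given $X\xrightarrow{f}Y\xrightarrow{g}X$ with $gf=id_X$, one has $f\in\Sigma\iff g\in\Sigma$. An arrow is a section if it has a left inverse, a retraction if it has a right inverse, and split if it is a section or a retraction. $Hom_p(\mathcal{B},\mathcal{D})$ is the 2-category of (strict) 2-functors $\mathcal{B}\to\mathcal{D}$, pseudonatural transformations (with invertible structure 2-cells) and modifications; $Hom_s(\mathcal{B},\mathcal{D})$ is the same with only 2-natural transformations as arrows. The subscript $+$ denotes the full sub-2-category on the 2-functors sending all arrows of $\Sigma$ to equivalences. A 2-functor $F:\mathcal{B}\to\mathcal{B}'$ is a pseudoequivalence if there are a 2-functor $G:\mathcal{B}'\to\mathcal{B}$ and pseudonatural transformations $Id\Rightarrow GF$, $FG\Rightarrow Id$ that are equivalences in $Hom_p(\mathcal{B},\mathcal{B})$, $Hom_p(\mathcal{B}',\mathcal{B}')$. The 2-localization of $\mathcal{A}$ at $\Sigma$ is a 2-functor $q:\mathcal{A}\to\mathcal{A}[\Sigma^{-1}]$ sending arrows of $\Sigma$ to equivalences and such that $q^*:Hom_p(\mathcal{A}[\Sigma^{-1}],\mathcal{D})\to Hom_p(\mathcal{A},\mathcal{D})_+$ is a pseudoequivalence for every 2-category $\mathcal{D}$. Homotopies.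 A cylinder $C=(W,Z,d_0,d_1,s,x)$ for an object $X$ consists of arrows $d_0,d_1:X\to W$, $s:W\to Z$, $x:X\to Z$ of $\mathcal{A}$ with $s\in\Sigma$ and $sd_0=sd_1=x$. A homotopy $H=(C,h)$ from $f$ to $g$ ($f,g:X\to Y$) is a cylinder $C$ for $X$ with an arrow $h:W\to Y$ such that $hd_0=f$, $hd_1=g$. If $F:\mathcal{A}\to\mathcal{D}$ is a 2-functor into a 2-category sending $\Sigma$ to equivalences, there is a unique 2-cell $\widehat{FC}:Fd_0\Rightarrow Fd_1$ with $Fs\,\widehat{FC}=Fx$ (the identity 2-cell); put $\widehat{FH}=Fh\,\widehat{FC}:Ff\Rightarrow Fg$. The 2-category $\mathcal{H}o(\mathcal{A})$. It has the objects and arrows of $\mathcal{A}$. A 2-cell $f\Rightarrow g$ is a class $[H_n,\dots,H_1]$ of a finite sequence of composable homotopies from $f$ to $g$, where two sequences $(H_n,\dots,H_1)$, $(K_m,\dots,K_1)$ are equivalent iff $\widehat{FH_n}\circ\cdots\circ\widehat{FH_1}=\widehat{FK_m}\circ\cdots\circ\widehat{FK_1}$ for every 2-category $\mathcal{D}$ and every 2-functor $F:\mathcal{A}\to\mathcal{D}$ sending $\Sigma$ to equivalences. Vertical composition is juxtaposition of sequences; the identity of $f$ is the class of the homotopy with cylinder $(X,X,id,id,id,id)$ and $h=f$. Whiskering is $r[H]=[(C,rh)]$ and $[H]l=[(Cl,h)]$ with $Cl=(W,Z,d_0l,d_1l,s,xl)$, extended termwise to sequences; this determines horizontal composition. $i$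 is the identity on objects and arrows. *)

theory Defs
  imports "HOL-Library.FuncSet"
begin

section \<open>Categories and 2-categories\<close>

text \<open>
  Objects, arrows and 2-cells are the elements of carrier sets inside arbitrary types. The binary
  operations are meaningful on composable pairs only, and are written in the order of the
  composition of functions.
\<close>

record ('o, 'a) cat =
  Obj :: "'o set"
  Arr :: "'a set"
  Src :: "'a \<Rightarrow> 'o"
  Trg :: "'a \<Rightarrow> 'o"
  Ident :: "'o \<Rightarrow> 'a"
  Comp :: "'a \<Rightarrow> 'a \<Rightarrow> 'a" (infixl "\<cdot>\<index>" 70)

record ('o, 'a, 'c) twocat = "('o, 'a) cat" +
  Cell :: "'c set"
  Dom :: "'c \<Rightarrow> 'a"
  Cod :: "'c \<Rightarrow> 'a"
  CId :: "'a \<Rightarrow> 'c"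
  VComp :: "'c \<Rightarrow> 'c \<Rightarrow> 'c" (infixl "\<bullet>\<index>" 65)
  HComp :: "'c \<Rightarrow> 'c \<Rightarrow> 'c" (infixl "\<star>\<index>" 70)

definition hom :: "('o, 'a, 'm) cat_scheme \<Rightarrow> 'o \<Rightarrow> 'o \<Rightarrow> 'a set" where
  "hom C X Y = {f \<in> Arr C. Src C f = X \<and> Trg C f = Y}"

definition hom2 :: "('o, 'a, 'c, 'm) twocat_scheme \<Rightarrow> 'a \<Rightarrow> 'a \<Rightarrow> 'c set" where
  "hom2 C f g = {\<alpha> \<in> Cell C. Dom C \<alpha> = f \<and> Cod C \<alpha> = g}"

locale category =
  fixes C :: "('o, 'a, 'm) cat_scheme" (structure)
  assumes Src_in: "f \<in> Arr C \<Longrightarrow> Src C f \<in> Obj C"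
    and Trg_in: "f \<in> Arr C \<Longrightarrow> Trg C f \<in> Obj C"
    and Ident_in: "X \<in> Obj C \<Longrightarrow> Ident C X \<in> hom C X X"
    and Comp_in: "\<lbrakk>f \<in> hom C X Y; g \<in> hom C Y Z\<rbrakk> \<Longrightarrow> g \<cdot> f \<in> hom C X Z"
    and Comp_Ident_left: "f \<in> hom C X Y \<Longrightarrow> Ident C Y \<cdot> f = f"
    and Comp_Ident_right: "f \<in> hom C X Y \<Longrightarrow> f \<cdot> Ident C X = f"
    and Comp_assoc: "\<lbrakk>f \<in> hom C X Y; g \<in> hom C Y Z; h \<in> hom C Z V\<rbrakk>
      \<Longrightarrow> (h \<cdot> g) \<cdot> f = h \<cdot> (g \<cdot> f)"

locale two_category = category C
  for C :: "('o, 'a, 'c, 'm) twocat_scheme" (structure) +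
  assumes Dom_in: "\<alpha> \<in> Cell C \<Longrightarrow> Dom C \<alpha> \<in> Arr C"
    and Cod_in: "\<alpha> \<in> Cell C \<Longrightarrow> Cod C \<alpha> \<in> Arr C"
    and Src_Cod: "\<alpha> \<in> Cell C \<Longrightarrow> Src C (Cod C \<alpha>) = Src C (Dom C \<alpha>)"
    and Trg_Cod: "\<alpha> \<in> Cell C \<Longrightarrow> Trg C (Cod C \<alpha>) = Trg C (Dom C \<alpha>)"
    and CId_in: "f \<in> Arr C \<Longrightarrow> CId C f \<in> hom2 C f f"
    and VComp_in: "\<lbrakk>\<alpha> \<in> hom2 C f g; \<beta> \<in> hom2 C g h\<rbrakk> \<Longrightarrow> \<beta> \<bullet> \<alpha> \<in> hom2 C f h"
    and VComp_CId_left: "\<alpha> \<in> hom2 C f g \<Longrightarrow> CId C g \<bullet> \<alpha> = \<alpha>"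
    and VComp_CId_right: "\<alpha> \<in> hom2 C f g \<Longrightarrow> \<alpha> \<bullet> CId C f = \<alpha>"
    and VComp_assoc: "\<lbrakk>\<alpha> \<in> hom2 C f g; \<beta> \<in> hom2 C g h; \<gamma> \<in> hom2 C h k\<rbrakk>
      \<Longrightarrow> (\<gamma> \<bullet> \<beta>) \<bullet> \<alpha> = \<gamma> \<bullet> (\<beta> \<bullet> \<alpha>)"
    and HComp_in: "\<lbrakk>\<alpha> \<in> hom2 C f f'; \<beta> \<in> hom2 C g g'; Trg C f = Src C g\<rbrakk>
      \<Longrightarrow> \<beta> \<star> \<alpha> \<in> hom2 C (g \<cdot> f) (g' \<cdot> f')"
    and HComp_Ident_left: "\<alpha> \<in> hom2 C f f' \<Longrightarrow> CId C (Ident C (Trg C f)) \<star> \<alpha> = \<alpha>"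
    and HComp_Ident_right: "\<alpha> \<in> hom2 C f f' \<Longrightarrow> \<alpha> \<star> CId C (Ident C (Src C f)) = \<alpha>"
    and HComp_assoc: "\<lbrakk>\<alpha> \<in> hom2 C f f'; \<beta> \<in> hom2 C g g'; \<gamma> \<in> hom2 C h h';
        Trg C f = Src C g; Trg C g = Src C h\<rbrakk> \<Longrightarrow> (\<gamma> \<star> \<beta>) \<star> \<alpha> = \<gamma> \<star> (\<beta> \<star> \<alpha>)"
    and HComp_CId: "\<lbrakk>f \<in> hom C X Y; g \<in> hom C Y Z\<rbrakk> \<Longrightarrow> CId C g \<star> CId C f = CId C (g \<cdot> f)"
    and interchange: "\<lbrakk>\<alpha> \<in> hom2 C f f'; \<alpha>' \<in> hom2 C f' f''; \<beta> \<in> hom2 C g g'; \<beta>' \<in> hom2 C g' g'';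
        Trg C f = Src C g\<rbrakk> \<Longrightarrow> (\<beta>' \<bullet> \<beta>) \<star> (\<alpha>' \<bullet> \<alpha>) = (\<beta>' \<star> \<alpha>') \<bullet> (\<beta> \<star> \<alpha>)"

text \<open>A category as a 2-category: every arrow is its own, and only, 2-cell.\<close>

definition disc :: "('o, 'a) cat \<Rightarrow> ('o, 'a, 'a) twocat" where
  "disc A = \<lparr>Obj = Obj A, Arr = Arr A, Src = Src A, Trg = Trg A, Ident = Ident A, Comp = Comp A,
     Cell = Arr A, Dom = (\<lambda>f. f), Cod = (\<lambda>f. f), CId = (\<lambda>f. f),
     VComp = (\<lambda>g f. f), HComp = Comp A\<rparr>"

lemma disc_simps [simp]:
  "Obj (disc A) = Obj A" "Arr (disc A) = Arr A" "Src (disc A) = Src A" "Trg (disc A) = Trg A"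
  "Ident (disc A) = Ident A" "Comp (disc A) = Comp A" "Cell (disc A) = Arr A"
  "Dom (disc A) = (\<lambda>f. f)" "Cod (disc A) = (\<lambda>f. f)" "CId (disc A) = (\<lambda>f. f)"
  "VComp (disc A) = (\<lambda>g f. f)" "HComp (disc A) = Comp A" "hom (disc A) X Y = hom A X Y"
  by (simp_all add: disc_def hom_def)

text \<open>Whiskering is horizontal composition with an identity 2-cell.\<close>

abbreviation lwhisk :: "('o, 'a, 'c, 'm) twocat_scheme \<Rightarrow> 'a \<Rightarrow> 'c \<Rightarrow> 'c" where
  "lwhisk C r \<alpha> \<equiv> CId C r \<star>\<^bsub>C\<^esub> \<alpha>"

abbreviation rwhisk :: "('o, 'a, 'c, 'm) twocat_scheme \<Rightarrow> 'c \<Rightarrow> 'a \<Rightarrow> 'c" where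
  "rwhisk C \<alpha> l \<equiv> \<alpha> \<star>\<^bsub>C\<^esub> CId C l"

definition inverse_cells :: "('o, 'a, 'c, 'm) twocat_scheme \<Rightarrow> 'a \<Rightarrow> 'a \<Rightarrow> 'c \<Rightarrow> 'c \<Rightarrow> bool" where
  "inverse_cells C f g \<alpha> \<beta> \<longleftrightarrow> \<alpha> \<in> hom2 C f g \<and> \<beta> \<in> hom2 C g f \<and>
     \<beta> \<bullet>\<^bsub>C\<^esub> \<alpha> = CId C f \<and> \<alpha> \<bullet>\<^bsub>C\<^esub> \<beta> = CId C g"

definition iso_hom2 :: "('o, 'a, 'c, 'm) twocat_scheme \<Rightarrow> 'a \<Rightarrow> 'a \<Rightarrow> 'c set" where
  "iso_hom2 C f g = {\<alpha>. \<exists>\<beta>. inverse_cells C f g \<alpha> \<beta>}"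

definition is_equivalence :: "('o, 'a, 'c, 'm) twocat_scheme \<Rightarrow> 'a \<Rightarrow> bool" where
  "is_equivalence C f \<longleftrightarrow> f \<in> Arr C \<and> (\<exists>g \<in> hom C (Trg C f) (Src C f).
     iso_hom2 C (Ident C (Src C f)) (g \<cdot>\<^bsub>C\<^esub> f) \<noteq> {} \<and>
     iso_hom2 C (f \<cdot>\<^bsub>C\<^esub> g) (Ident C (Trg C f)) \<noteq> {})"

definition full_sub2 :: "('o, 'a, 'c) twocat \<Rightarrow> ('o \<Rightarrow> bool) \<Rightarrow> ('o, 'a, 'c) twocat" where
  "full_sub2 C P = C\<lparr>Obj := {X \<in> Obj C. P X},
     Arr := {f \<in> Arr C. P (Src C f) \<and> P (Trg C f)},
     Cell := {\<alpha> \<in> Cell C. P (Src C (Dom C \<alpha>)) \<and> P (Trg C (Dom C \<alpha>))}\<rparr>"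

definition locally_full_sub2 :: "('o, 'a, 'c) twocat \<Rightarrow> ('a \<Rightarrow> bool) \<Rightarrow> ('o, 'a, 'c) twocat" where
  "locally_full_sub2 C P = C\<lparr>Arr := {f \<in> Arr C. P f},
     Cell := {\<alpha> \<in> Cell C. P (Dom C \<alpha>) \<and> P (Cod C \<alpha>)}\<rparr>"


section \<open>2-functors\<close>

text \<open>
  The three components are extensional, i.e. undefined outside the carriers of the source. Hence
  two 2-functors with the same source are equal as records if and only if they agree on objects,
  arrows and 2-cells. The same convention is used for transformations and modifications.
\<close>

record ('o, 'a, 'c, 'p, 'b, 'd) tfun =
  FObj :: "'o \<Rightarrow> 'p"
  FArr :: "'a \<Rightarrow> 'b"
  FCell :: "'c \<Rightarrow> 'd"

locale two_functor = B: two_category B + D: two_category D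
  for B :: "('o, 'a, 'c) twocat"
    and D :: "('p, 'b, 'd) twocat"
    and F :: "('o, 'a, 'c, 'p, 'b, 'd) tfun" +
  assumes FObj_in: "FObj F \<in> Obj B \<rightarrow>\<^sub>E Obj D"
    and FArr_in: "FArr F \<in> Arr B \<rightarrow>\<^sub>E Arr D"
    and FCell_in: "FCell F \<in> Cell B \<rightarrow>\<^sub>E Cell D"
    and F_Src: "f \<in> Arr B \<Longrightarrow> Src D (FArr F f) = FObj F (Src B f)"
    and F_Trg: "f \<in> Arr B \<Longrightarrow> Trg D (FArr F f) = FObj F (Trg B f)"
    and F_Ident: "X \<in> Obj B \<Longrightarrow> FArr F (Ident B X) = Ident D (FObj F X)"
    and F_Comp: "\<lbrakk>f \<in> hom B X Y; g \<in> hom B Y Z\<rbrakk>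
      \<Longrightarrow> FArr F (g \<cdot>\<^bsub>B\<^esub> f) = FArr F g \<cdot>\<^bsub>D\<^esub> FArr F f"
    and F_Dom: "\<alpha> \<in> Cell B \<Longrightarrow> Dom D (FCell F \<alpha>) = FArr F (Dom B \<alpha>)"
    and F_Cod: "\<alpha> \<in> Cell B \<Longrightarrow> Cod D (FCell F \<alpha>) = FArr F (Cod B \<alpha>)"
    and F_CId: "f \<in> Arr B \<Longrightarrow> FCell F (CId B f) = CId D (FArr F f)"
    and F_VComp: "\<lbrakk>\<alpha> \<in> hom2 B f g; \<beta> \<in> hom2 B g h\<rbrakk>
      \<Longrightarrow> FCell F (\<beta> \<bullet>\<^bsub>B\<^esub> \<alpha>) = FCell F \<beta> \<bullet>\<^bsub>D\<^esub> FCell F \<alpha>"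
    and F_HComp: "\<lbrakk>\<alpha> \<in> hom2 B f f'; \<beta> \<in> hom2 B g g'; Trg B f = Src B g\<rbrakk>
      \<Longrightarrow> FCell F (\<beta> \<star>\<^bsub>B\<^esub> \<alpha>) = FCell F \<beta> \<star>\<^bsub>D\<^esub> FCell F \<alpha>"

definition id_tfun :: "('o, 'a, 'c) twocat \<Rightarrow> ('o, 'a, 'c, 'o, 'a, 'c) tfun" where
  "id_tfun B = \<lparr>FObj = restrict (\<lambda>X. X) (Obj B), FArr = restrict (\<lambda>f. f) (Arr B),
     FCell = restrict (\<lambda>\<alpha>. \<alpha>) (Cell B)\<rparr>"

definition comp_tfun :: "('o, 'a, 'c) twocat \<Rightarrow> ('p, 'b, 'd, 'q, 'e, 'f) tfun
    \<Rightarrow> ('o, 'a, 'c, 'p, 'b, 'd) tfun \<Rightarrow> ('o, 'a, 'c, 'q, 'e, 'f) tfun" where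
  "comp_tfun B G F = \<lparr>FObj = compose (Obj B) (FObj G) (FObj F),
     FArr = compose (Arr B) (FArr G) (FArr F),
     FCell = compose (Cell B) (FCell G) (FCell F)\<rparr>"

definition twocat_isomorphism ::
    "('o, 'a, 'c) twocat \<Rightarrow> ('p, 'b, 'd) twocat \<Rightarrow> ('o, 'a, 'c, 'p, 'b, 'd) tfun \<Rightarrow> bool" where
  "twocat_isomorphism B D F \<longleftrightarrow> two_functor B D F \<and>
     (\<exists>G. two_functor D B G \<and> comp_tfun B G F = id_tfun B \<and> comp_tfun D F G = id_tfun D)"

definition inverts ::
    "('p, 'b, 'd) twocat \<Rightarrow> 'a set \<Rightarrow> ('o, 'a, 'c, 'p, 'b, 'd) tfun \<Rightarrow> bool" where
  "inverts D \<Sigma> F \<longleftrightarrow> (\<forall>s \<in> \<Sigma>. is_equivalence D (FArr F s))"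


section \<open>Pseudonatural transformations and modifications\<close>

text \<open>
  The 2-cell \<open>PArr \<theta> f\<close> fills the naturality square of \<open>f : X \<rightarrow> Y\<close>; it goes
  from \<open>G f \<cdot> \<theta> X\<close> to \<open>\<theta> Y \<cdot> F f\<close>. A transformation records its source and target 2-functors,
  and a modification its source and target transformations, because they are the arrows and
  2-cells of a 2-category below.
\<close>

record ('o, 'a, 'c, 'p, 'b, 'd) pnt =
  PSrc :: "('o, 'a, 'c, 'p, 'b, 'd) tfun"
  PTrg :: "('o, 'a, 'c, 'p, 'b, 'd) tfun"
  PObj :: "'o \<Rightarrow> 'b"
  PArr :: "'a \<Rightarrow> 'd"

record ('o, 'a, 'c, 'p, 'b, 'd) modif =
  MSrc :: "('o, 'a, 'c, 'p, 'b, 'd) pnt"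
  MTrg :: "('o, 'a, 'c, 'p, 'b, 'd) pnt"
  MObj :: "'o \<Rightarrow> 'd"

locale pseudonatural =
    F: two_functor B D "PSrc \<theta>" + G: two_functor B D "PTrg \<theta>"
  for B :: "('o, 'a, 'c) twocat"
    and D :: "('p, 'b, 'd) twocat"
    and \<theta> :: "('o, 'a, 'c, 'p, 'b, 'd) pnt" +
  assumes PObj_ext: "PObj \<theta> \<in> extensional (Obj B)"
    and PArr_ext: "PArr \<theta> \<in> extensional (Arr B)"
    and PObj_in: "X \<in> Obj B
      \<Longrightarrow> PObj \<theta> X \<in> hom D (FObj (PSrc \<theta>) X) (FObj (PTrg \<theta>) X)"
    and PArr_in: "f \<in> hom B X Y
      \<Longrightarrow> PArr \<theta> f \<in> iso_hom2 D (FArr (PTrg \<theta>) f \<cdot>\<^bsub>D\<^esub> PObj \<theta> X) (PObj \<theta> Y \<cdot>\<^bsub>D\<^esub> FArr (PSrc \<theta>) f)"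
    and PArr_Ident: "X \<in> Obj B \<Longrightarrow> PArr \<theta> (Ident B X) = CId D (PObj \<theta> X)"
    and PArr_Comp: "\<lbrakk>f \<in> hom B X Y; g \<in> hom B Y Z\<rbrakk>
      \<Longrightarrow> PArr \<theta> (g \<cdot>\<^bsub>B\<^esub> f) =
            rwhisk D (PArr \<theta> g) (FArr (PSrc \<theta>) f) \<bullet>\<^bsub>D\<^esub> lwhisk D (FArr (PTrg \<theta>) g) (PArr \<theta> f)"
    and PArr_natural: "\<lbrakk>f \<in> hom B X Y; \<alpha> \<in> hom2 B f g\<rbrakk>
      \<Longrightarrow> PArr \<theta> g \<bullet>\<^bsub>D\<^esub> rwhisk D (FCell (PTrg \<theta>) \<alpha>) (PObj \<theta> X) =
          lwhisk D (PObj \<theta> Y) (FCell (PSrc \<theta>) \<alpha>) \<bullet>\<^bsub>D\<^esub> PArr \<theta> f"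

text \<open>
  If all structure 2-cells are identities, their source and target agree, which is the strict
  naturality on arrows; \<open>pseudonatural.PArr_natural\<close> is then the strict naturality on 2-cells.
\<close>

definition strict_pnt ::
    "('o, 'a, 'c) twocat \<Rightarrow> ('p, 'b, 'd) twocat \<Rightarrow> ('o, 'a, 'c, 'p, 'b, 'd) pnt \<Rightarrow> bool" where
  "strict_pnt B D \<theta> \<longleftrightarrow>
     (\<forall>f \<in> Arr B. PArr \<theta> f = CId D (PObj \<theta> (Trg B f) \<cdot>\<^bsub>D\<^esub> FArr (PSrc \<theta>) f))"

locale modification =
    S: pseudonatural B D "MSrc \<rho>" + T: pseudonatural B D "MTrg \<rho>"
  for B :: "('o, 'a, 'c) twocat"
    and D :: "('p, 'b, 'd) twocat"
    and \<rho> :: "('o, 'a, 'c, 'p, 'b, 'd) modif" +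
  assumes same_PSrc: "PSrc (MTrg \<rho>) = PSrc (MSrc \<rho>)"
    and same_PTrg: "PTrg (MTrg \<rho>) = PTrg (MSrc \<rho>)"
    and MObj_ext: "MObj \<rho> \<in> extensional (Obj B)"
    and MObj_in: "X \<in> Obj B \<Longrightarrow> MObj \<rho> X \<in> hom2 D (PObj (MSrc \<rho>) X) (PObj (MTrg \<rho>) X)"
    and MObj_natural: "f \<in> hom B X Y
      \<Longrightarrow> rwhisk D (MObj \<rho> Y) (FArr (PSrc (MSrc \<rho>)) f) \<bullet>\<^bsub>D\<^esub> PArr (MSrc \<rho>) f =
          PArr (MTrg \<rho>) f \<bullet>\<^bsub>D\<^esub> lwhisk D (FArr (PTrg (MSrc \<rho>)) f) (MObj \<rho> X)"

definition id_pnt :: "('o, 'a, 'c) twocat \<Rightarrow> ('p, 'b, 'd) twocat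
    \<Rightarrow> ('o, 'a, 'c, 'p, 'b, 'd) tfun \<Rightarrow> ('o, 'a, 'c, 'p, 'b, 'd) pnt" where
  "id_pnt B D F = \<lparr>PSrc = F, PTrg = F,
     PObj = (\<lambda>X \<in> Obj B. Ident D (FObj F X)),
     PArr = (\<lambda>f \<in> Arr B. CId D (FArr F f))\<rparr>"

definition comp_pnt :: "('o, 'a, 'c) twocat \<Rightarrow> ('p, 'b, 'd) twocat
    \<Rightarrow> ('o, 'a, 'c, 'p, 'b, 'd) pnt \<Rightarrow> ('o, 'a, 'c, 'p, 'b, 'd) pnt
    \<Rightarrow> ('o, 'a, 'c, 'p, 'b, 'd) pnt" where
  "comp_pnt B D \<eta> \<theta> = \<lparr>PSrc = PSrc \<theta>, PTrg = PTrg \<eta>,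
     PObj = (\<lambda>X \<in> Obj B. PObj \<eta> X \<cdot>\<^bsub>D\<^esub> PObj \<theta> X),
     PArr = (\<lambda>f \<in> Arr B.
       lwhisk D (PObj \<eta> (Trg B f)) (PArr \<theta> f) \<bullet>\<^bsub>D\<^esub> rwhisk D (PArr \<eta> f) (PObj \<theta> (Src B f)))\<rparr>"

definition Hom_p :: "('o, 'a, 'c) twocat \<Rightarrow> ('p, 'b, 'd) twocat
    \<Rightarrow> (('o, 'a, 'c, 'p, 'b, 'd) tfun, ('o, 'a, 'c, 'p, 'b, 'd) pnt,
        ('o, 'a, 'c, 'p, 'b, 'd) modif) twocat" where
  "Hom_p B D = \<lparr>Obj = {F. two_functor B D F}, Arr = {\<theta>. pseudonatural B D \<theta>},
     Src = PSrc, Trg = PTrg, Ident = id_pnt B D, Comp = comp_pnt B D,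
     Cell = {\<rho>. modification B D \<rho>}, Dom = MSrc, Cod = MTrg,
     CId = (\<lambda>\<theta>. \<lparr>MSrc = \<theta>, MTrg = \<theta>, MObj = (\<lambda>X \<in> Obj B. CId D (PObj \<theta> X))\<rparr>),
     VComp = (\<lambda>\<sigma> \<rho>. \<lparr>MSrc = MSrc \<rho>, MTrg = MTrg \<sigma>,
       MObj = (\<lambda>X \<in> Obj B. MObj \<sigma> X \<bullet>\<^bsub>D\<^esub> MObj \<rho> X)\<rparr>),
     HComp = (\<lambda>\<sigma> \<rho>. \<lparr>MSrc = comp_pnt B D (MSrc \<sigma>) (MSrc \<rho>),
       MTrg = comp_pnt B D (MTrg \<sigma>) (MTrg \<rho>),
       MObj = (\<lambda>X \<in> Obj B. MObj \<sigma> X \<star>\<^bsub>D\<^esub> MObj \<rho> X)\<rparr>)\<rparr>"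

definition Hom_s :: "('o, 'a, 'c) twocat \<Rightarrow> ('p, 'b, 'd) twocat
    \<Rightarrow> (('o, 'a, 'c, 'p, 'b, 'd) tfun, ('o, 'a, 'c, 'p, 'b, 'd) pnt,
        ('o, 'a, 'c, 'p, 'b, 'd) modif) twocat" where
  "Hom_s B D = locally_full_sub2 (Hom_p B D) (strict_pnt B D)"

definition Hom_p_plus :: "'a set \<Rightarrow> ('o, 'a, 'c) twocat \<Rightarrow> ('p, 'b, 'd) twocat
    \<Rightarrow> (('o, 'a, 'c, 'p, 'b, 'd) tfun, ('o, 'a, 'c, 'p, 'b, 'd) pnt,
        ('o, 'a, 'c, 'p, 'b, 'd) modif) twocat" where
  "Hom_p_plus \<Sigma> B D = full_sub2 (Hom_p B D) (inverts D \<Sigma>)"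

definition Hom_s_plus :: "'a set \<Rightarrow> ('o, 'a, 'c) twocat \<Rightarrow> ('p, 'b, 'd) twocat
    \<Rightarrow> (('o, 'a, 'c, 'p, 'b, 'd) tfun, ('o, 'a, 'c, 'p, 'b, 'd) pnt,
        ('o, 'a, 'c, 'p, 'b, 'd) modif) twocat" where
  "Hom_s_plus \<Sigma> B D = full_sub2 (Hom_s B D) (inverts D \<Sigma>)"

definition whisker_pnt :: "('o, 'a, 'c) twocat \<Rightarrow> ('p, 'b, 'd, 'q, 'e, 'f) pnt
    \<Rightarrow> ('o, 'a, 'c, 'p, 'b, 'd) tfun \<Rightarrow> ('o, 'a, 'c, 'q, 'e, 'f) pnt" where
  "whisker_pnt B \<theta> q = \<lparr>PSrc = comp_tfun B (PSrc \<theta>) q, PTrg = comp_tfun B (PTrg \<theta>) q,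
     PObj = compose (Obj B) (PObj \<theta>) (FObj q), PArr = compose (Arr B) (PArr \<theta>) (FArr q)\<rparr>"

definition whisker_modif :: "('o, 'a, 'c) twocat \<Rightarrow> ('p, 'b, 'd, 'q, 'e, 'f) modif
    \<Rightarrow> ('o, 'a, 'c, 'p, 'b, 'd) tfun \<Rightarrow> ('o, 'a, 'c, 'q, 'e, 'f) modif" where
  "whisker_modif B \<rho> q = \<lparr>MSrc = whisker_pnt B (MSrc \<rho>) q, MTrg = whisker_pnt B (MTrg \<rho>) q,
     MObj = compose (Obj B) (MObj \<rho>) (FObj q)\<rparr>"

text \<open>
  Precomposition with a 2-functor \<open>q\<close> defined on \<open>B\<close>. The argument \<open>H\<close> is the source
  2-category of the result, one of the Hom-2-categories out of the target of \<open>q\<close>.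
\<close>

definition precomp :: "('o, 'a, 'c) twocat \<Rightarrow> ('o, 'a, 'c, 'p, 'b, 'd) tfun
    \<Rightarrow> (('p, 'b, 'd, 'q, 'e, 'f) tfun, ('p, 'b, 'd, 'q, 'e, 'f) pnt,
        ('p, 'b, 'd, 'q, 'e, 'f) modif) twocat
    \<Rightarrow> (('p, 'b, 'd, 'q, 'e, 'f) tfun, ('p, 'b, 'd, 'q, 'e, 'f) pnt,
        ('p, 'b, 'd, 'q, 'e, 'f) modif,
        ('o, 'a, 'c, 'q, 'e, 'f) tfun, ('o, 'a, 'c, 'q, 'e, 'f) pnt,
        ('o, 'a, 'c, 'q, 'e, 'f) modif) tfun" where
  "precomp B q H = \<lparr>FObj = (\<lambda>F \<in> Obj H. comp_tfun B F q),
     FArr = (\<lambda>\<theta> \<in> Arr H. whisker_pnt B \<theta> q),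
     FCell = (\<lambda>\<rho> \<in> Cell H. whisker_modif B \<rho> q)\<rparr>"


section \<open>Pseudoequivalences and 2-localizations\<close>

definition pseudoequivalence ::
    "('o, 'a, 'c) twocat \<Rightarrow> ('p, 'b, 'd) twocat \<Rightarrow> ('o, 'a, 'c, 'p, 'b, 'd) tfun \<Rightarrow> bool" where
  "pseudoequivalence B B' F \<longleftrightarrow> two_functor B B' F \<and>
     (\<exists>G. two_functor B' B G \<and>
        (\<exists>\<eta> \<in> hom (Hom_p B B) (id_tfun B) (comp_tfun B G F). is_equivalence (Hom_p B B) \<eta>) \<and>
        (\<exists>\<epsilon> \<in> hom (Hom_p B' B') (comp_tfun B' F G) (id_tfun B'). is_equivalence (Hom_p B' B') \<epsilon>))"

text \<open>
  The universal property quantifies over the 2-categories \<open>D\<close> whose carriers lie in given types;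
  these types are passed as the first argument, since a definition cannot quantify over types.
  A theorem that leaves them arbitrary is about all 2-categories \<open>D\<close>.
\<close>

definition two_localization :: "('q, 'e, 'f) twocat itself \<Rightarrow> ('o, 'a) cat \<Rightarrow> 'a set
    \<Rightarrow> ('p, 'b, 'd) twocat \<Rightarrow> ('o, 'a, 'a, 'p, 'b, 'd) tfun \<Rightarrow> bool" where
  "two_localization U A \<Sigma> L q \<longleftrightarrow> two_functor (disc A) L q \<and> inverts L \<Sigma> q \<and>
     (\<forall>D :: ('q, 'e, 'f) twocat. two_category D \<longrightarrow>
        pseudoequivalence (Hom_p L D) (Hom_p_plus \<Sigma> (disc A) D) (precomp (disc A) q (Hom_p L D)))"


section \<open>Conditions on the class of weak equivalences\<close>

definition is_section :: "('o, 'a) cat \<Rightarrow> 'a \<Rightarrow> bool" where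
  "is_section A f \<longleftrightarrow>
     f \<in> Arr A \<and> (\<exists>g \<in> hom A (Trg A f) (Src A f). g \<cdot>\<^bsub>A\<^esub> f = Ident A (Src A f))"

definition is_retraction :: "('o, 'a) cat \<Rightarrow> 'a \<Rightarrow> bool" where
  "is_retraction A f \<longleftrightarrow>
     f \<in> Arr A \<and> (\<exists>g \<in> hom A (Trg A f) (Src A f). f \<cdot>\<^bsub>A\<^esub> g = Ident A (Trg A f))"

definition is_split :: "('o, 'a) cat \<Rightarrow> 'a \<Rightarrow> bool" where
  "is_split A f \<longleftrightarrow> is_section A f \<or> is_retraction A f"

definition two_for_one :: "('o, 'a) cat \<Rightarrow> 'a set \<Rightarrow> bool" where
  "two_for_one A \<Sigma> \<longleftrightarrow> (\<forall>X Y. \<forall>f \<in> hom A X Y. \<forall>g \<in> hom A Y X.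
     g \<cdot>\<^bsub>A\<^esub> f = Ident A X \<longrightarrow> (f \<in> \<Sigma> \<longleftrightarrow> g \<in> \<Sigma>))"

inductive_set composites :: "('o, 'a) cat \<Rightarrow> 'a set \<Rightarrow> 'a set"
  for A :: "('o, 'a) cat" and S :: "'a set" where
  single: "f \<in> Arr A \<Longrightarrow> f \<in> S \<Longrightarrow> f \<in> composites A S"
| step: "f \<in> composites A S \<Longrightarrow> g \<in> Arr A \<Longrightarrow> g \<in> S \<Longrightarrow> Trg A f = Src A g
    \<Longrightarrow> g \<cdot>\<^bsub>A\<^esub> f \<in> composites A S"


section \<open>Homotopies\<close>

record ('o, 'a) cylinder =
  cylW :: 'o
  cylZ :: 'o
  cyl0 :: 'a
  cyl1 :: 'a
  cylS :: 'a
  cylX :: 'a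

type_synonym ('o, 'a) homotopy = "('o, 'a) cylinder \<times> 'a"

definition is_cylinder :: "('o, 'a) cat \<Rightarrow> 'a set \<Rightarrow> 'o \<Rightarrow> ('o, 'a) cylinder \<Rightarrow> bool" where
  "is_cylinder A \<Sigma> X C \<longleftrightarrow> X \<in> Obj A \<and> cylW C \<in> Obj A \<and> cylZ C \<in> Obj A \<and>
     cyl0 C \<in> hom A X (cylW C) \<and> cyl1 C \<in> hom A X (cylW C) \<and>
     cylS C \<in> hom A (cylW C) (cylZ C) \<and> cylX C \<in> hom A X (cylZ C) \<and> cylS C \<in> \<Sigma> \<and>
     cylS C \<cdot>\<^bsub>A\<^esub> cyl0 C = cylX C \<and> cylS C \<cdot>\<^bsub>A\<^esub> cyl1 C = cylX C"

fun is_homotopy :: "('o, 'a) cat \<Rightarrow> 'a set \<Rightarrow> 'a \<Rightarrow> 'a \<Rightarrow> ('o, 'a) homotopy \<Rightarrow> bool" where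
  "is_homotopy A \<Sigma> f g (C, h) \<longleftrightarrow>
     f \<in> Arr A \<and> g \<in> hom A (Src A f) (Trg A f) \<and> is_cylinder A \<Sigma> (Src A f) C \<and>
     h \<in> hom A (cylW C) (Trg A f) \<and> h \<cdot>\<^bsub>A\<^esub> cyl0 C = f \<and> h \<cdot>\<^bsub>A\<^esub> cyl1 C = g"

text \<open>A nonempty sequence is listed as \<open>[H\<^sub>n, \<dots>, H\<^sub>1]\<close>, the last homotopy coming first.\<close>

inductive homotopy_seq ::
    "('o, 'a) cat \<Rightarrow> 'a set \<Rightarrow> 'a \<Rightarrow> 'a \<Rightarrow> ('o, 'a) homotopy list \<Rightarrow> bool"
  for A :: "('o, 'a) cat" and \<Sigma> :: "'a set" where
  single: "is_homotopy A \<Sigma> f g H \<Longrightarrow> homotopy_seq A \<Sigma> f g [H]"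
| cons: "homotopy_seq A \<Sigma> f g Hs \<Longrightarrow> is_homotopy A \<Sigma> g k H \<Longrightarrow> homotopy_seq A \<Sigma> f k (H # Hs)"

definition cyl_hat :: "('p, 'b, 'd) twocat \<Rightarrow> ('o, 'a, 'a, 'p, 'b, 'd) tfun
    \<Rightarrow> ('o, 'a) cylinder \<Rightarrow> 'd" where
  "cyl_hat D F C = (THE \<alpha>. \<alpha> \<in> hom2 D (FArr F (cyl0 C)) (FArr F (cyl1 C)) \<and>
     lwhisk D (FArr F (cylS C)) \<alpha> = CId D (FArr F (cylX C)))"

fun homotopy_hat :: "('p, 'b, 'd) twocat \<Rightarrow> ('o, 'a, 'a, 'p, 'b, 'd) tfun
    \<Rightarrow> ('o, 'a) homotopy \<Rightarrow> 'd" where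
  "homotopy_hat D F (C, h) = lwhisk D (FArr F h) (cyl_hat D F C)"

fun seq_hat :: "('p, 'b, 'd) twocat \<Rightarrow> ('o, 'a, 'a, 'p, 'b, 'd) tfun
    \<Rightarrow> ('o, 'a) homotopy list \<Rightarrow> 'd" where
  "seq_hat D F [] = undefined"
| "seq_hat D F [H] = homotopy_hat D F H"
| "seq_hat D F (H # K # Ks) = homotopy_hat D F H \<bullet>\<^bsub>D\<^esub> seq_hat D F (K # Ks)"

text \<open>
  Two sequences are equivalent if every 2-functor to a 2-category that inverts \<open>\<Sigma>\<close> identifies
  them. A definition cannot quantify over types, so the 2-categories \<open>D\<close> range here over those with
  carriers in one type, of cardinality the maximum of \<open>\<aleph>\<^sub>0\<close>, \<open>|'o|\<close> and \<open>|'a|\<close>. This makes no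
  difference: \<open>seq_equiv_all\<close> below shows that equivalent sequences are identified by the 2-functors
  to 2-categories of arbitrary types.
\<close>

type_synonym ('o, 'a) code = "('o + 'a + nat) list"

definition seq_equiv :: "('o, 'a) cat \<Rightarrow> 'a set
    \<Rightarrow> ('o, 'a) homotopy list \<Rightarrow> ('o, 'a) homotopy list \<Rightarrow> bool" where
  "seq_equiv A \<Sigma> Hs Ks \<longleftrightarrow>
     (\<forall>(D :: (('o, 'a) code, ('o, 'a) code, ('o, 'a) code) twocat) F.
        two_functor (disc A) D F \<and> inverts D \<Sigma> F \<longrightarrow> seq_hat D F Hs = seq_hat D F Ks)"


section \<open>The homotopy 2-category\<close>

text \<open>A 2-cell is given by its source, its target and an equivalence class of sequences.\<close>

datatype ('o, 'a) ho_cell =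
  HoCell (ho_dom: 'a) (ho_cod: 'a) (ho_seqs: "('o, 'a) homotopy list set")

text \<open>
  \<open>ho_class A \<Sigma> f g S\<close> is the class, among the sequences from \<open>f\<close> to \<open>g\<close>, of the elements of \<open>S\<close>,
  which will always be a nonempty set of equivalent sequences.
\<close>

definition ho_class :: "('o, 'a) cat \<Rightarrow> 'a set \<Rightarrow> 'a \<Rightarrow> 'a
    \<Rightarrow> ('o, 'a) homotopy list set \<Rightarrow> ('o, 'a) ho_cell" where
  "ho_class A \<Sigma> f g S =
     HoCell f g {Ls. homotopy_seq A \<Sigma> f g Ls \<and> (\<exists>Hs \<in> S. seq_equiv A \<Sigma> Hs Ls)}"

definition trivial_homotopy :: "('o, 'a) cat \<Rightarrow> 'a \<Rightarrow> ('o, 'a) homotopy" where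
  "trivial_homotopy A f = (let X = Src A f in
     (\<lparr>cylW = X, cylZ = X, cyl0 = Ident A X, cyl1 = Ident A X, cylS = Ident A X,
       cylX = Ident A X\<rparr>, f))"

definition ho_vcomp :: "('o, 'a) cat \<Rightarrow> 'a set
    \<Rightarrow> ('o, 'a) ho_cell \<Rightarrow> ('o, 'a) ho_cell \<Rightarrow> ('o, 'a) ho_cell" where
  "ho_vcomp A \<Sigma> \<beta> \<alpha> = ho_class A \<Sigma> (ho_dom \<alpha>) (ho_cod \<beta>)
     {Ks @ Hs | Ks Hs. Ks \<in> ho_seqs \<beta> \<and> Hs \<in> ho_seqs \<alpha>}"

fun homotopy_post :: "('o, 'a) cat \<Rightarrow> 'a \<Rightarrow> ('o, 'a) homotopy \<Rightarrow> ('o, 'a) homotopy" where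
  "homotopy_post A r (C, h) = (C, r \<cdot>\<^bsub>A\<^esub> h)"

fun homotopy_pre :: "('o, 'a) cat \<Rightarrow> ('o, 'a) homotopy \<Rightarrow> 'a \<Rightarrow> ('o, 'a) homotopy" where
  "homotopy_pre A (C, h) l =
     (C\<lparr>cyl0 := cyl0 C \<cdot>\<^bsub>A\<^esub> l, cyl1 := cyl1 C \<cdot>\<^bsub>A\<^esub> l, cylX := cylX C \<cdot>\<^bsub>A\<^esub> l\<rparr>, h)"

definition ho_lwhisk :: "('o, 'a) cat \<Rightarrow> 'a set
    \<Rightarrow> 'a \<Rightarrow> ('o, 'a) ho_cell \<Rightarrow> ('o, 'a) ho_cell" where
  "ho_lwhisk A \<Sigma> r \<alpha> = ho_class A \<Sigma> (r \<cdot>\<^bsub>A\<^esub> ho_dom \<alpha>) (r \<cdot>\<^bsub>A\<^esub> ho_cod \<alpha>)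
     (map (homotopy_post A r) ` ho_seqs \<alpha>)"

definition ho_rwhisk :: "('o, 'a) cat \<Rightarrow> 'a set
    \<Rightarrow> ('o, 'a) ho_cell \<Rightarrow> 'a \<Rightarrow> ('o, 'a) ho_cell" where
  "ho_rwhisk A \<Sigma> \<alpha> l = ho_class A \<Sigma> (ho_dom \<alpha> \<cdot>\<^bsub>A\<^esub> l) (ho_cod \<alpha> \<cdot>\<^bsub>A\<^esub> l)
     (map (\<lambda>H. homotopy_pre A H l) ` ho_seqs \<alpha>)"

definition Ho :: "('o, 'a) cat \<Rightarrow> 'a set \<Rightarrow> ('o, 'a, ('o, 'a) ho_cell) twocat" where
  "Ho A \<Sigma> = \<lparr>Obj = Obj A, Arr = Arr A, Src = Src A, Trg = Trg A, Ident = Ident A, Comp = Comp A,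
     Cell = {ho_class A \<Sigma> f g {Hs} | f g Hs. homotopy_seq A \<Sigma> f g Hs},
     Dom = ho_dom, Cod = ho_cod,
     CId = (\<lambda>f. ho_class A \<Sigma> f f {[trivial_homotopy A f]}),
     VComp = ho_vcomp A \<Sigma>,
     HComp = (\<lambda>\<beta> \<alpha>.
       ho_vcomp A \<Sigma> (ho_rwhisk A \<Sigma> \<beta> (ho_cod \<alpha>)) (ho_lwhisk A \<Sigma> (ho_dom \<beta>) \<alpha>))\<rparr>"

definition ho_incl ::
    "('o, 'a) cat \<Rightarrow> 'a set \<Rightarrow> ('o, 'a, 'a, 'o, 'a, ('o, 'a) ho_cell) tfun" where
  "ho_incl A \<Sigma> = \<lparr>FObj = (\<lambda>X \<in> Obj A. X), FArr = (\<lambda>f \<in> Arr A. f),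
     FCell = (\<lambda>f \<in> Arr A. CId (Ho A \<Sigma>) f)\<rparr>"


section \<open>Equivalent sequences and 2-categories of arbitrary types\<close>

text \<open>
  \<open>cyl_hat_ex1\<close> shows that \<open>cyl_hat\<close> is well defined. The proof of \<open>seq_equiv_all\<close> is a
  downward Loewenheim-Skolem argument: \<open>F\<close> corestricts to the sub-2-category of \<open>D\<close> generated by its
  image and by chosen quasi-inverses of the arrows of \<open>\<Sigma>\<close> with their invertible 2-cells, whose
  elements can be coded by words.
\<close>

context two_category
begin

lemma hom2D:
  assumes "\<alpha> \<in> hom2 C f g"
  shows "\<alpha> \<in> Cell C" "Dom C \<alpha> = f" "Cod C \<alpha> = g" "f \<in> Arr C" "g \<in> Arr C"
    "Src C g = Src C f" "Trg C g = Trg C f"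
  using assms Dom_in Cod_in Src_Cod Trg_Cod by (auto simp: hom2_def)

lemma whisk_in:
  assumes "\<alpha> \<in> hom2 C f g" "r \<in> Arr C" "Src C r = Trg C f"
  shows "lwhisk C r \<alpha> \<in> hom2 C (r \<cdot> f) (r \<cdot> g)"
  by (rule HComp_in) (use assms CId_in in auto)

lemma rwhisk_in:
  assumes "\<alpha> \<in> hom2 C f g" "l \<in> Arr C" "Trg C l = Src C f"
  shows "rwhisk C \<alpha> l \<in> hom2 C (f \<cdot> l) (g \<cdot> l)"
  by (rule HComp_in) (use assms CId_in in auto)

lemma inverse_rwhisk:
  assumes "inverse_cells C f g \<alpha> \<beta>" "l \<in> Arr C" "Trg C l = Src C f"
  shows "inverse_cells C (f \<cdot> l) (g \<cdot> l) (rwhisk C \<alpha> l) (rwhisk C \<beta> l)"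
proof -
  have a: "\<alpha> \<in> hom2 C f g" and b: "\<beta> \<in> hom2 C g f" and ba: "\<beta> \<bullet> \<alpha> = CId C f" and ab: "\<alpha> \<bullet> \<beta> = CId C g"
    using assms by (auto simp: inverse_cells_def)
  note l = CId_in[OF assms(2)]
  have sg: "Src C g = Src C f" using hom2D[OF a] by auto
  have "rwhisk C \<beta> l \<bullet> rwhisk C \<alpha> l = (\<beta> \<bullet> \<alpha>) \<star> (CId C l \<bullet> CId C l)"
    using interchange[OF l l a b] assms by simp
  also have "\<dots> = CId C (f \<cdot> l)"
    using ba VComp_CId_left[OF l] HComp_CId[of l "Src C l" "Trg C l" f "Trg C f"] hom2D[OF a] assms
    by (simp add: hom_def)
  finally have 1: "rwhisk C \<beta> l \<bullet> rwhisk C \<alpha> l = CId C (f \<cdot> l)" .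
  have "rwhisk C \<alpha> l \<bullet> rwhisk C \<beta> l = (\<alpha> \<bullet> \<beta>) \<star> (CId C l \<bullet> CId C l)"
    using interchange[OF l l b a] assms sg by simp
  also have "\<dots> = CId C (g \<cdot> l)"
    using ab VComp_CId_left[OF l] HComp_CId[of l "Src C l" "Trg C l" g "Trg C g"] hom2D[OF a] assms
    by (simp add: hom_def)
  finally have 2: "rwhisk C \<alpha> l \<bullet> rwhisk C \<beta> l = CId C (g \<cdot> l)" .
  show ?thesis unfolding inverse_cells_def
    using 1 2 rwhisk_in[OF a] rwhisk_in[OF b] assms sg by auto
qed

lemma unit_natural:
  assumes \<eta>: "inverse_cells C (Ident C W) k \<eta> \<eta>'" and W: "W \<in> Obj C"
    and \<alpha>: "\<alpha> \<in> hom2 C a b" and "Trg C a = W"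
  shows "rwhisk C \<eta> b \<bullet> \<alpha> = lwhisk C k \<alpha> \<bullet> rwhisk C \<eta> a"
proof -
  have e: "\<eta> \<in> hom2 C (Ident C W) k" using \<eta> by (simp add: inverse_cells_def)
  note d = hom2D[OF \<alpha>] and de = hom2D[OF e]
  have I: "Src C (Ident C W) = W" "Ident C W \<in> Arr C" using Ident_in[OF W] by (auto simp: hom_def)
  have "(\<eta> \<bullet> CId C (Ident C W)) \<star> (CId C b \<bullet> \<alpha>) = rwhisk C \<eta> b \<bullet> (CId C (Ident C W) \<star> \<alpha>)"
    using interchange[OF \<alpha> CId_in CId_in e] d I assms by simp
  moreover have "(CId C k \<bullet> \<eta>) \<star> (\<alpha> \<bullet> CId C a) = lwhisk C k \<alpha> \<bullet> rwhisk C \<eta> a"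
    using interchange[OF CId_in \<alpha> e CId_in] d de I assms by simp
  ultimately show ?thesis
    using VComp_CId_left[OF e] VComp_CId_right[OF e] VComp_CId_left[OF \<alpha>] VComp_CId_right[OF \<alpha>]
      HComp_Ident_left[OF \<alpha>] assms by simp
qed

lemma lwhisk_Comp:
  assumes "\<alpha> \<in> hom2 C a b" "s \<in> hom C (Trg C a) V" "g \<in> hom C V Z"
  shows "lwhisk C (g \<cdot> s) \<alpha> = lwhisk C g (lwhisk C s \<alpha>)"
proof -
  have "s \<in> Arr C" "g \<in> Arr C" "Trg C a = Src C s" "Trg C s = Src C g"
    using assms by (simp_all add: hom_def)
  then show ?thesis
    using HComp_assoc[OF assms(1) CId_in CId_in, of s g] HComp_CId[OF assms(2,3)] by simp
qed

lemma VComp_cancel_right: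
  assumes "inverse_cells C f g \<eta> \<eta>'" "\<alpha> \<in> hom2 C g h" "\<beta> \<in> hom2 C g h"
    and "\<alpha> \<bullet> \<eta> = \<beta> \<bullet> \<eta>"
  shows "\<alpha> = \<beta>"
proof -
  have \<eta>: "\<eta> \<in> hom2 C f g" "\<eta>' \<in> hom2 C g f" "\<eta> \<bullet> \<eta>' = CId C g"
    using assms(1) by (auto simp: inverse_cells_def)
  have "\<alpha> = (\<alpha> \<bullet> \<eta>) \<bullet> \<eta>'"
    using VComp_assoc[OF \<eta>(2,1) assms(2)] VComp_CId_right[OF assms(2)] \<eta>(3) by simp
  also have "\<dots> = \<beta>"
    using VComp_assoc[OF \<eta>(2,1) assms(3)] VComp_CId_right[OF assms(3)] \<eta>(3) assms(4) by simp
  finally show ?thesis .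
qed

lemma VComp_cancel_left:
  assumes "inverse_cells C f g \<eta> \<eta>'" "\<alpha> \<in> hom2 C h f" "\<beta> \<in> hom2 C h f"
    and "\<eta> \<bullet> \<alpha> = \<eta> \<bullet> \<beta>"
  shows "\<alpha> = \<beta>"
proof -
  have \<eta>: "\<eta> \<in> hom2 C f g" "\<eta>' \<in> hom2 C g f" "\<eta>' \<bullet> \<eta> = CId C f"
    using assms(1) by (auto simp: inverse_cells_def)
  have "\<alpha> = \<eta>' \<bullet> (\<eta> \<bullet> \<alpha>)"
    using VComp_assoc[OF assms(2) \<eta>(1,2)] VComp_CId_left[OF assms(2)] \<eta>(3) by simp
  also have "\<dots> = \<beta>"
    using VComp_assoc[OF assms(3) \<eta>(1,2)] VComp_CId_left[OF assms(3)] \<eta>(3) assms(4) by simp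
  finally show ?thesis .
qed

lemma unit_faithful:
  assumes \<eta>: "inverse_cells C (Ident C W) k \<eta> \<eta>'" and W: "W \<in> Obj C"
    and \<alpha>: "\<alpha> \<in> hom2 C a b" and \<beta>: "\<beta> \<in> hom2 C a b" and t: "Trg C a = W"
    and eq: "lwhisk C k \<alpha> = lwhisk C k \<beta>"
  shows "\<alpha> = \<beta>"
proof (rule VComp_cancel_left)
  note d = hom2D[OF \<alpha>]
  have I: "Src C (Ident C W) = W" using Ident_in[OF W] by (auto simp: hom_def)
  have Ib: "Ident C W \<cdot> b = b" using Comp_Ident_left[of b "Src C b" W] d t by (auto simp: hom_def)
  show "inverse_cells C b (k \<cdot> b) (rwhisk C \<eta> b) (rwhisk C \<eta>' b)"
    using inverse_rwhisk[OF \<eta>, of b] d t I Ib by simp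
  show "rwhisk C \<eta> b \<bullet> \<alpha> = rwhisk C \<eta> b \<bullet> \<beta>"
    using unit_natural[OF \<eta> W \<alpha> t] unit_natural[OF \<eta> W \<beta> t] eq by simp
qed (use \<alpha> \<beta> in auto)

lemma equivalence_fully_faithful:
  assumes s: "is_equivalence C s" and a: "a \<in> hom C X (Src C s)" and b: "b \<in> hom C X (Src C s)"
    and \<beta>: "\<beta> \<in> hom2 C (s \<cdot> a) (s \<cdot> b)"
  shows "\<exists>!\<alpha>. \<alpha> \<in> hom2 C a b \<and> lwhisk C s \<alpha> = \<beta>"
proof -
  define W Z where "W = Src C s" and "Z = Trg C s"
  have sA: "s \<in> hom C W Z" using s by (simp add: hom_def W_def Z_def is_equivalence_def)
  have W: "W \<in> Obj C" and Z: "Z \<in> Obj C" using sA Src_in Trg_in by (auto simp: hom_def)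
  obtain g \<eta> \<eta>' \<epsilon> \<epsilon>' where g: "g \<in> hom C Z W"
    and \<eta>: "inverse_cells C (Ident C W) (g \<cdot> s) \<eta> \<eta>'"
    and \<epsilon>0: "inverse_cells C (s \<cdot> g) (Ident C Z) \<epsilon> \<epsilon>'"
    using s by (fastforce simp: is_equivalence_def iso_hom2_def W_def Z_def)
  have \<epsilon>: "inverse_cells C (Ident C Z) (s \<cdot> g) \<epsilon>' \<epsilon>" using \<epsilon>0 by (auto simp: inverse_cells_def)
  have a: "a \<in> hom C X W" and b: "b \<in> hom C X W" using a b by (simp_all add: W_def)
  have sa: "s \<cdot> a \<in> hom C X Z" and sb: "s \<cdot> b \<in> hom C X Z"
    using Comp_in a b sA by auto
  have gs: "g \<cdot> s \<in> hom C W W" using Comp_in sA g by auto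
  have unique: "\<alpha> = \<alpha>'" if "\<alpha> \<in> hom2 C a b" "\<alpha>' \<in> hom2 C a b" "lwhisk C s \<alpha> = lwhisk C s \<alpha>'" for \<alpha> \<alpha>'
    by (rule unit_faithful[OF \<eta> W that(1,2)])
      (use a that lwhisk_Comp[OF that(1), of s Z g W] lwhisk_Comp[OF that(2), of s Z g W] sA g in
        \<open>auto simp: hom_def\<close>)
  have g_faithful: "\<gamma> = \<gamma>'"
    if "\<gamma> \<in> hom2 C (s \<cdot> a) (s \<cdot> b)" "\<gamma>' \<in> hom2 C (s \<cdot> a) (s \<cdot> b)" "lwhisk C g \<gamma> = lwhisk C g \<gamma>'" for \<gamma> \<gamma>'
    by (rule unit_faithful[OF \<epsilon> Z that(1,2)])
      (use sa that lwhisk_Comp[OF that(1), of g W s Z] lwhisk_Comp[OF that(2), of g W s Z] sA g in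
        \<open>auto simp: hom_def\<close>)
  have I: "Src C (Ident C W) = W" using Ident_in[OF W] by (auto simp: hom_def)
  have \<eta>a: "inverse_cells C a ((g \<cdot> s) \<cdot> a) (rwhisk C \<eta> a) (rwhisk C \<eta>' a)"
    using inverse_rwhisk[OF \<eta>, of a] a I Comp_Ident_left[OF a] by (simp add: hom_def)
  have \<eta>b: "inverse_cells C b ((g \<cdot> s) \<cdot> b) (rwhisk C \<eta> b) (rwhisk C \<eta>' b)"
    using inverse_rwhisk[OF \<eta>, of b] b I Comp_Ident_left[OF b] by (simp add: hom_def)
  have g\<beta>: "lwhisk C g \<beta> \<in> hom2 C ((g \<cdot> s) \<cdot> a) ((g \<cdot> s) \<cdot> b)"
    using whisk_in[OF \<beta>, of g] g sa Comp_assoc[OF a sA g] Comp_assoc[OF b sA g] by (simp add: hom_def)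
  define \<alpha> where "\<alpha> = rwhisk C \<eta>' b \<bullet> (lwhisk C g \<beta> \<bullet> rwhisk C \<eta> a)"
  have m: "lwhisk C g \<beta> \<bullet> rwhisk C \<eta> a \<in> hom2 C a ((g \<cdot> s) \<cdot> b)"
    using VComp_in g\<beta> \<eta>a by (auto simp: inverse_cells_def)
  have \<alpha>: "\<alpha> \<in> hom2 C a b" unfolding \<alpha>_def using VComp_in m \<eta>b by (auto simp: inverse_cells_def)
  have "rwhisk C \<eta> b \<bullet> \<alpha> = lwhisk C g \<beta> \<bullet> rwhisk C \<eta> a"
    unfolding \<alpha>_def using VComp_assoc[OF m, of "rwhisk C \<eta>' b" b "rwhisk C \<eta> b" "(g \<cdot> s) \<cdot> b"]
      VComp_CId_left[OF m] \<eta>b by (auto simp: inverse_cells_def)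
  then have "lwhisk C (g \<cdot> s) \<alpha> \<bullet> rwhisk C \<eta> a = lwhisk C g \<beta> \<bullet> rwhisk C \<eta> a"
    using unit_natural[OF \<eta> W \<alpha>] a by (simp add: hom_def)
  then have "lwhisk C (g \<cdot> s) \<alpha> = lwhisk C g \<beta>"
    using VComp_cancel_right[OF \<eta>a _ g\<beta>] whisk_in[OF \<alpha>, of "g \<cdot> s"] gs a by (auto simp: hom_def)
  then have "lwhisk C g (lwhisk C s \<alpha>) = lwhisk C g \<beta>"
    using lwhisk_Comp[OF \<alpha>, of s Z g W] sA g a by (simp add: hom_def)
  then have "lwhisk C s \<alpha> = \<beta>"
    using g_faithful[OF _ \<beta>] whisk_in[OF \<alpha>, of s] sA a by (auto simp: hom_def)
  then show ?thesis using \<alpha> unique by blast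
qed

end

lemma cyl_hat_ex1:
  assumes F: "two_functor (disc A) D F" "inverts D \<Sigma> F" and C: "is_cylinder A \<Sigma> X C"
  shows "\<exists>!\<alpha>. \<alpha> \<in> hom2 D (FArr F (cyl0 C)) (FArr F (cyl1 C)) \<and>
    lwhisk D (FArr F (cylS C)) \<alpha> = CId D (FArr F (cylX C))"
proof -
  interpret F: two_functor "disc A" D F by (rule F)
  have sel: "Arr (disc A) = Arr A" "Src (disc A) = Src A" "Trg (disc A) = Trg A" "Comp (disc A) = Comp A"
    by (simp_all add: disc_def)
  have h: "FArr F f \<in> hom D (FObj F X) (FObj F Y)" if "f \<in> hom A X Y" for f X Y
    using that F.FArr_in F.F_Src F.F_Trg by (fastforce simp: hom_def sel PiE_iff)
  have s: "is_equivalence D (FArr F (cylS C))" using F(2) C by (simp add: inverts_def is_cylinder_def)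
  have src: "Src D (FArr F (cylS C)) = FObj F (cylW C)"
    using h C by (force simp: is_cylinder_def hom_def)
  have c: "FArr F (cylS C) \<cdot>\<^bsub>D\<^esub> FArr F f = FArr F (cylX C)"
    if "f \<in> hom A X (cylW C)" "cylS C \<cdot>\<^bsub>A\<^esub> f = cylX C" for f
    using F.F_Comp[of f X "cylW C" "cylS C" "cylZ C"] that C
    by (simp add: hom_def is_cylinder_def sel)
  have "FArr F (cylX C) \<in> Arr D" using h C by (force simp: is_cylinder_def hom_def)
  then show ?thesis
    using F.D.equivalence_fully_faithful[OF s, of "FArr F (cyl0 C)" "FObj F X" "FArr F (cyl1 C)"
        "CId D (FArr F (cylX C))"] h c C F.D.CId_in src
    by (auto simp: is_cylinder_def)
qed

locale sub_coding = two_category D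
  for D :: "('p, 'b, 'd) twocat" (structure) +
  fixes Os :: "'p set" and As :: "'b set" and Cs :: "'d set"
    and cO :: "'p \<Rightarrow> 'u" and cA :: "'b \<Rightarrow> 'u" and cC :: "'d \<Rightarrow> 'u"
  assumes sub: "Os \<subseteq> Obj D" "As \<subseteq> Arr D" "Cs \<subseteq> Cell D"
    and inj: "inj_on cO Os" "inj_on cA As" "inj_on cC Cs"
    and Src_s: "f \<in> As \<Longrightarrow> Src D f \<in> Os" and Trg_s: "f \<in> As \<Longrightarrow> Trg D f \<in> Os"
    and Ident_s: "X \<in> Os \<Longrightarrow> Ident D X \<in> As"
    and Comp_s: "\<lbrakk>f \<in> As; g \<in> As; Trg D f = Src D g\<rbrakk> \<Longrightarrow> g \<cdot> f \<in> As"
    and Dom_s: "\<alpha> \<in> Cs \<Longrightarrow> Dom D \<alpha> \<in> As" and Cod_s: "\<alpha> \<in> Cs \<Longrightarrow> Cod D \<alpha> \<in> As"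
    and CId_s: "f \<in> As \<Longrightarrow> CId D f \<in> Cs"
    and VComp_s: "\<lbrakk>\<alpha> \<in> Cs; \<beta> \<in> Cs; Cod D \<alpha> = Dom D \<beta>\<rbrakk> \<Longrightarrow> \<beta> \<bullet> \<alpha> \<in> Cs"
    and HComp_s: "\<lbrakk>\<alpha> \<in> Cs; \<beta> \<in> Cs; Trg D (Dom D \<alpha>) = Src D (Dom D \<beta>)\<rbrakk> \<Longrightarrow> \<beta> \<star> \<alpha> \<in> Cs"
begin

definition E :: "('u, 'u, 'u) twocat" where
  "E = (let dO = inv_into Os cO; dA = inv_into As cA; dC = inv_into Cs cC in
    \<lparr>Obj = cO ` Os, Arr = cA ` As, Src = (\<lambda>f. cO (Src D (dA f))), Trg = (\<lambda>f. cO (Trg D (dA f))),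
     Ident = (\<lambda>X. cA (Ident D (dO X))), Comp = (\<lambda>g f. cA (dA g \<cdot> dA f)),
     Cell = cC ` Cs, Dom = (\<lambda>\<alpha>. cA (Dom D (dC \<alpha>))), Cod = (\<lambda>\<alpha>. cA (Cod D (dC \<alpha>))),
     CId = (\<lambda>f. cC (CId D (dA f))), VComp = (\<lambda>\<beta> \<alpha>. cC (dC \<beta> \<bullet> dC \<alpha>)),
     HComp = (\<lambda>\<beta> \<alpha>. cC (dC \<beta> \<star> dC \<alpha>))\<rparr>)"

lemma E_simps [simp]:
  "Obj E = cO ` Os" "Arr E = cA ` As" "Cell E = cC ` Cs"
  "f \<in> As \<Longrightarrow> Src E (cA f) = cO (Src D f)" "f \<in> As \<Longrightarrow> Trg E (cA f) = cO (Trg D f)"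
  "X \<in> Os \<Longrightarrow> Ident E (cO X) = cA (Ident D X)"
  "\<lbrakk>f \<in> As; g \<in> As\<rbrakk> \<Longrightarrow> cA g \<cdot>\<^bsub>E\<^esub> cA f = cA (g \<cdot> f)"
  "\<alpha> \<in> Cs \<Longrightarrow> Dom E (cC \<alpha>) = cA (Dom D \<alpha>)" "\<alpha> \<in> Cs \<Longrightarrow> Cod E (cC \<alpha>) = cA (Cod D \<alpha>)"
  "f \<in> As \<Longrightarrow> CId E (cA f) = cC (CId D f)"
  "\<lbrakk>\<alpha> \<in> Cs; \<beta> \<in> Cs\<rbrakk> \<Longrightarrow> cC \<beta> \<bullet>\<^bsub>E\<^esub> cC \<alpha> = cC (\<beta> \<bullet> \<alpha>)"
  "\<lbrakk>\<alpha> \<in> Cs; \<beta> \<in> Cs\<rbrakk> \<Longrightarrow> cC \<beta> \<star>\<^bsub>E\<^esub> cC \<alpha> = cC (\<beta> \<star> \<alpha>)"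
  using inj by (simp_all add: E_def Let_def)

lemma code_eq [simp]:
  "X \<in> Os \<Longrightarrow> Y \<in> Os \<Longrightarrow> cO X = cO Y \<longleftrightarrow> X = Y"
  "f \<in> As \<Longrightarrow> g \<in> As \<Longrightarrow> cA f = cA g \<longleftrightarrow> f = g"
  "\<alpha> \<in> Cs \<Longrightarrow> \<beta> \<in> Cs \<Longrightarrow> cC \<alpha> = cC \<beta> \<longleftrightarrow> \<alpha> = \<beta>"
  using inj by (auto simp: inj_on_eq_iff)

lemma hom_EE:
  assumes "x \<in> hom E X Y"
  obtains f where "f \<in> As" "x = cA f" "X = cO (Src D f)" "Y = cO (Trg D f)"
  using assms by (auto simp: hom_def)

lemma hom2_EE:
  assumes "x \<in> hom2 E f g"
  obtains \<alpha> where "\<alpha> \<in> Cs" "x = cC \<alpha>" "f = cA (Dom D \<alpha>)" "g = cA (Cod D \<alpha>)"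
  using assms by (auto simp: hom2_def)

lemma hom_E [simp]:
  "f \<in> As \<Longrightarrow> X \<in> Os \<Longrightarrow> Y \<in> Os \<Longrightarrow> cA f \<in> hom E (cO X) (cO Y) \<longleftrightarrow> f \<in> hom D X Y"
  using sub Src_s Trg_s by (auto simp: hom_def)

lemma hom2_E [simp]:
  "\<alpha> \<in> Cs \<Longrightarrow> f \<in> As \<Longrightarrow> g \<in> As \<Longrightarrow> cC \<alpha> \<in> hom2 E (cA f) (cA g) \<longleftrightarrow> \<alpha> \<in> hom2 D f g"
  using sub Dom_s Cod_s by (auto simp: hom2_def)

lemma homs: "f \<in> As \<Longrightarrow> f \<in> hom D (Src D f) (Trg D f)"
  using sub by (auto simp: hom_def)

lemma hom2s: "\<alpha> \<in> Cs \<Longrightarrow> \<alpha> \<in> hom2 D (Dom D \<alpha>) (Cod D \<alpha>)"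
  using sub by (auto simp: hom2_def)

lemma D_simps:
  "f \<in> Arr D \<Longrightarrow> g \<in> Arr D \<Longrightarrow> Trg D f = Src D g \<Longrightarrow> Src D (g \<cdot> f) = Src D f"
  "f \<in> Arr D \<Longrightarrow> g \<in> Arr D \<Longrightarrow> Trg D f = Src D g \<Longrightarrow> Trg D (g \<cdot> f) = Trg D g"
  "X \<in> Obj D \<Longrightarrow> Src D (Ident D X) = X" "X \<in> Obj D \<Longrightarrow> Trg D (Ident D X) = X"
  "f \<in> Arr D \<Longrightarrow> Dom D (CId D f) = f" "f \<in> Arr D \<Longrightarrow> Cod D (CId D f) = f"
  "\<alpha> \<in> Cell D \<Longrightarrow> \<beta> \<in> Cell D \<Longrightarrow> Cod D \<alpha> = Dom D \<beta> \<Longrightarrow> Dom D (\<beta> \<bullet> \<alpha>) = Dom D \<alpha>"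
  "\<alpha> \<in> Cell D \<Longrightarrow> \<beta> \<in> Cell D \<Longrightarrow> Cod D \<alpha> = Dom D \<beta> \<Longrightarrow> Cod D (\<beta> \<bullet> \<alpha>) = Cod D \<beta>"
  "\<alpha> \<in> Cell D \<Longrightarrow> \<beta> \<in> Cell D \<Longrightarrow> Trg D (Dom D \<alpha>) = Src D (Dom D \<beta>)
    \<Longrightarrow> Dom D (\<beta> \<star> \<alpha>) = Dom D \<beta> \<cdot> Dom D \<alpha>"
  "\<alpha> \<in> Cell D \<Longrightarrow> \<beta> \<in> Cell D \<Longrightarrow> Trg D (Dom D \<alpha>) = Src D (Dom D \<beta>)
    \<Longrightarrow> Cod D (\<beta> \<star> \<alpha>) = Cod D \<beta> \<cdot> Cod D \<alpha>"
  using Comp_in[of f "Src D f" "Trg D f" g "Trg D g"] Ident_in[of X] CId_in[of f]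
    VComp_in[of \<alpha> "Dom D \<alpha>" "Cod D \<alpha>" \<beta> "Cod D \<beta>"]
    HComp_in[of \<alpha> "Dom D \<alpha>" "Cod D \<alpha>" \<beta> "Dom D \<beta>" "Cod D \<beta>"]
  by (simp_all add: hom_def hom2_def)

lemma subD: "X \<in> Os \<Longrightarrow> X \<in> Obj D" "f \<in> As \<Longrightarrow> f \<in> Arr D" "\<alpha> \<in> Cs \<Longrightarrow> \<alpha> \<in> Cell D"
  using sub by auto

lemmas closed = Src_s Trg_s Ident_s Comp_s Dom_s Cod_s CId_s VComp_s HComp_s

lemma cellD: "\<alpha> \<in> Cell D \<Longrightarrow> Src D (Cod D \<alpha>) = Src D (Dom D \<alpha>)"
  "\<alpha> \<in> Cell D \<Longrightarrow> Trg D (Cod D \<alpha>) = Trg D (Dom D \<alpha>)"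
  using Src_Cod Trg_Cod by auto

sublocale E: two_category E
proof
  fix f assume "f \<in> Arr E" then show "Src E f \<in> Obj E" using closed by auto
next
  fix f assume "f \<in> Arr E" then show "Trg E f \<in> Obj E" using closed by auto
next
  fix X assume "X \<in> Obj E" then show "Ident E X \<in> hom E X X"
    using closed Ident_in sub by auto
next
  fix f g X Y Z assume "f \<in> hom E X Y" "g \<in> hom E Y Z"
  then show "g \<cdot>\<^bsub>E\<^esub> f \<in> hom E X Z"
    by (elim hom_EE) (simp add: closed D_simps subD hom_def)
next
  fix f X Y assume "f \<in> hom E X Y"
  then show "Ident E Y \<cdot>\<^bsub>E\<^esub> f = f"
    by (elim hom_EE) (simp add: closed Comp_Ident_left[OF homs])
next
  fix f X Y assume "f \<in> hom E X Y"
  then show "f \<cdot>\<^bsub>E\<^esub> Ident E X = f"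
    by (elim hom_EE) (simp add: closed Comp_Ident_right[OF homs])
next
  fix f g h X Y Z V assume "f \<in> hom E X Y" "g \<in> hom E Y Z" "h \<in> hom E Z V"
  then show "h \<cdot>\<^bsub>E\<^esub> g \<cdot>\<^bsub>E\<^esub> f = h \<cdot>\<^bsub>E\<^esub> (g \<cdot>\<^bsub>E\<^esub> f)"
  proof (elim hom_EE, goal_cases)
    case (1 f' g' h')
    then have "Trg D f' = Src D g'" "Trg D g' = Src D h'" using closed by auto
    moreover from this have "(h' \<cdot> g') \<cdot> f' = h' \<cdot> (g' \<cdot> f')"
      using Comp_assoc homs 1(1,5,9) by metis
    ultimately show ?case using 1(1,2,5,6,9,10) by (simp add: closed D_simps subD)
  qed
next
  fix \<alpha> assume "\<alpha> \<in> Cell E" then show "Dom E \<alpha> \<in> Arr E" using closed by auto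
next
  fix \<alpha> assume "\<alpha> \<in> Cell E" then show "Cod E \<alpha> \<in> Arr E" using closed by auto
next
  fix \<alpha> assume "\<alpha> \<in> Cell E" then show "Src E (Cod E \<alpha>) = Src E (Dom E \<alpha>)"
    using closed cellD subD by auto
next
  fix \<alpha> assume "\<alpha> \<in> Cell E" then show "Trg E (Cod E \<alpha>) = Trg E (Dom E \<alpha>)"
    using closed cellD subD by auto
next
  fix f assume "f \<in> Arr E" then show "CId E f \<in> hom2 E f f"
    using closed CId_in sub by auto
next
  fix \<alpha> \<beta> f g h assume "\<alpha> \<in> hom2 E f g" "\<beta> \<in> hom2 E g h"
  then show "\<beta> \<bullet>\<^bsub>E\<^esub> \<alpha> \<in> hom2 E f h"
    by (elim hom2_EE) (simp add: closed VComp_in[OF hom2s] hom2s)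
next
  fix \<alpha> f g assume "\<alpha> \<in> hom2 E f g"
  then show "CId E g \<bullet>\<^bsub>E\<^esub> \<alpha> = \<alpha>"
    by (elim hom2_EE) (simp add: closed VComp_CId_left[OF hom2s])
next
  fix \<alpha> f g assume "\<alpha> \<in> hom2 E f g"
  then show "\<alpha> \<bullet>\<^bsub>E\<^esub> CId E f = \<alpha>"
    by (elim hom2_EE) (simp add: closed VComp_CId_right[OF hom2s])
next
  fix \<alpha> \<beta> \<gamma> f g h k assume "\<alpha> \<in> hom2 E f g" "\<beta> \<in> hom2 E g h" "\<gamma> \<in> hom2 E h k"
  then show "\<gamma> \<bullet>\<^bsub>E\<^esub> \<beta> \<bullet>\<^bsub>E\<^esub> \<alpha> = \<gamma> \<bullet>\<^bsub>E\<^esub> (\<beta> \<bullet>\<^bsub>E\<^esub> \<alpha>)"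
  proof (elim hom2_EE, goal_cases)
    case (1 \<alpha>' \<beta>' \<gamma>')
    then have "Cod D \<alpha>' = Dom D \<beta>'" "Cod D \<beta>' = Dom D \<gamma>'" using closed by auto
    moreover from this have "(\<gamma>' \<bullet> \<beta>') \<bullet> \<alpha>' = \<gamma>' \<bullet> (\<beta>' \<bullet> \<alpha>')"
      using VComp_assoc hom2s 1(1,5,9) by metis
    ultimately show ?case using 1(1,2,5,6,9,10) by (simp add: closed D_simps subD)
  qed
next
  fix \<alpha> \<beta> f f' g g' assume "\<alpha> \<in> hom2 E f f'" "\<beta> \<in> hom2 E g g'" "Trg E f = Src E g"
  then show "\<beta> \<star>\<^bsub>E\<^esub> \<alpha> \<in> hom2 E (g \<cdot>\<^bsub>E\<^esub> f) (g' \<cdot>\<^bsub>E\<^esub> f')"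
    by (elim hom2_EE) (simp add: closed HComp_in hom2s cellD subD)
next
  fix \<alpha> f f' assume "\<alpha> \<in> hom2 E f f'"
  then show "CId E (Ident E (Trg E f)) \<star>\<^bsub>E\<^esub> \<alpha> = \<alpha>"
    by (elim hom2_EE) (simp add: closed HComp_Ident_left[OF hom2s])
next
  fix \<alpha> f f' assume "\<alpha> \<in> hom2 E f f'"
  then show "\<alpha> \<star>\<^bsub>E\<^esub> CId E (Ident E (Src E f)) = \<alpha>"
    by (elim hom2_EE) (simp add: closed HComp_Ident_right[OF hom2s])
next
  fix \<alpha> \<beta> \<gamma> f f' g g' h h'
  assume "\<alpha> \<in> hom2 E f f'" "\<beta> \<in> hom2 E g g'" "\<gamma> \<in> hom2 E h h'"
    "Trg E f = Src E g" "Trg E g = Src E h"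
  then show "\<gamma> \<star>\<^bsub>E\<^esub> \<beta> \<star>\<^bsub>E\<^esub> \<alpha> = \<gamma> \<star>\<^bsub>E\<^esub> (\<beta> \<star>\<^bsub>E\<^esub> \<alpha>)"
  proof (elim hom2_EE, goal_cases)
    case (1 \<alpha>' \<beta>' \<gamma>')
    then have "Trg D (Dom D \<alpha>') = Src D (Dom D \<beta>')" "Trg D (Dom D \<beta>') = Src D (Dom D \<gamma>')"
      using closed by auto
    moreover from this have "(\<gamma>' \<star> \<beta>') \<star> \<alpha>' = \<gamma>' \<star> (\<beta>' \<star> \<alpha>')"
      using HComp_assoc hom2s 1(3,7,11) by metis
    ultimately show ?case using 1 by (simp add: closed D_simps subD)
  qed
next
  fix f g X Y Z assume "f \<in> hom E X Y" "g \<in> hom E Y Z"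
  then show "CId E g \<star>\<^bsub>E\<^esub> CId E f = CId E (g \<cdot>\<^bsub>E\<^esub> f)"
  proof (elim hom_EE, goal_cases)
    case (1 f' g')
    then have "Trg D f' = Src D g'" using closed by auto
    moreover from this have "CId D g' \<star> CId D f' = CId D (g' \<cdot> f')"
      using HComp_CId homs 1(1,5) by metis
    ultimately show ?case using 1(1,2,5,6) by (simp add: closed D_simps subD)
  qed
next
  fix \<alpha> \<alpha>' \<beta> \<beta>' f f' f'' g g' g''
  assume "\<alpha> \<in> hom2 E f f'" "\<alpha>' \<in> hom2 E f' f''" "\<beta> \<in> hom2 E g g'" "\<beta>' \<in> hom2 E g' g''"
    "Trg E f = Src E g"
  then show "(\<beta>' \<bullet>\<^bsub>E\<^esub> \<beta>) \<star>\<^bsub>E\<^esub> (\<alpha>' \<bullet>\<^bsub>E\<^esub> \<alpha>) = \<beta>' \<star>\<^bsub>E\<^esub> \<alpha>' \<bullet>\<^bsub>E\<^esub> (\<beta> \<star>\<^bsub>E\<^esub> \<alpha>)"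
  proof (elim hom2_EE, goal_cases)
    case (1 a a' b b')
    then have c: "Cod D a = Dom D a'" "Cod D b = Dom D b'" "Trg D (Dom D a) = Src D (Dom D b)"
      using closed by auto
    moreover from this have "(b' \<bullet> b) \<star> (a' \<bullet> a) = (b' \<star> a') \<bullet> (b \<star> a)"
      using interchange hom2s 1(2,6,10,14) by metis
    moreover have "Trg D (Dom D a') = Src D (Dom D b')"
      using c cellD[of a] cellD[of b] 1 subD by metis
    ultimately show ?case using 1 by (simp add: closed D_simps subD)
  qed
qed

end

locale coded_functor = sub_coding D Os As Cs cO cA cC + F: two_functor "disc A" D F
  for A :: "('o, 'a) cat" and D :: "('p, 'b, 'd) twocat" (structure)
    and Os As Cs and cO :: "'p \<Rightarrow> 'u" and cA :: "'b \<Rightarrow> 'u" and cC :: "'d \<Rightarrow> 'u" and F +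
  fixes \<Sigma> :: "'a set"
  assumes F_Os: "X \<in> Obj A \<Longrightarrow> FObj F X \<in> Os" and F_As: "f \<in> Arr A \<Longrightarrow> FArr F f \<in> As"
    and \<Sigma>: "\<Sigma> \<subseteq> Arr A"
    and quasi_inverse: "s \<in> \<Sigma> \<Longrightarrow> \<exists>g \<in> As. g \<in> hom D (Trg D (FArr F s)) (Src D (FArr F s)) \<and>
      (\<exists>\<eta> \<in> Cs. \<exists>\<eta>' \<in> Cs. inverse_cells D (Ident D (Src D (FArr F s))) (g \<cdot> FArr F s) \<eta> \<eta>') \<and>
      (\<exists>\<epsilon> \<in> Cs. \<exists>\<epsilon>' \<in> Cs. inverse_cells D (FArr F s \<cdot> g) (Ident D (Trg D (FArr F s))) \<epsilon> \<epsilon>')"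
begin

definition F' :: "('o, 'a, 'a, 'u, 'u, 'u) tfun" where
  "F' = \<lparr>FObj = (\<lambda>X \<in> Obj A. cO (FObj F X)), FArr = (\<lambda>f \<in> Arr A. cA (FArr F f)),
    FCell = (\<lambda>f \<in> Arr A. cC (FCell F f))\<rparr>"

lemma F'_simps [simp]:
  "X \<in> Obj A \<Longrightarrow> FObj F' X = cO (FObj F X)" "f \<in> Arr A \<Longrightarrow> FArr F' f = cA (FArr F f)"
  "f \<in> Arr A \<Longrightarrow> FCell F' f = cC (FCell F f)"
  by (simp_all add: F'_def)

lemma F_cell: "f \<in> Arr A \<Longrightarrow> FCell F f = CId D (FArr F f)"
  using F.F_CId by simp

lemma F_Cs: "f \<in> Arr A \<Longrightarrow> FCell F f \<in> Cs"
  using F_As CId_s by (simp add: F_cell)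

lemma A_simps:
  "f \<in> Arr A \<Longrightarrow> Src A f \<in> Obj A" "f \<in> Arr A \<Longrightarrow> Trg A f \<in> Obj A"
  "f \<in> hom A X Y \<Longrightarrow> g \<in> hom A Y Z \<Longrightarrow> g \<cdot>\<^bsub>A\<^esub> f \<in> hom A X Z"
  "X \<in> Obj A \<Longrightarrow> Ident A X \<in> hom A X X"
  using F.B.Src_in F.B.Trg_in F.B.Comp_in F.B.Ident_in by auto

lemma F_hom: "f \<in> hom A X Y \<Longrightarrow> FArr F f \<in> hom D (FObj F X) (FObj F Y)"
  using F.F_Src[of f] F.F_Trg[of f] F_As[of f] sub by (auto simp: hom_def)

lemma F_Comp': "f \<in> hom A X Y \<Longrightarrow> g \<in> hom A Y Z \<Longrightarrow> FArr F (g \<cdot>\<^bsub>A\<^esub> f) = FArr F g \<cdot> FArr F f"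
  using F.F_Comp[of f X Y g Z] by simp

lemma two_functor_F': "two_functor (disc A) E F'"
proof -
  have "two_functor_axioms (disc A) E F'"
  proof (unfold_locales, goal_cases)
    case (7 f X Y g Z)
    then have "f \<in> Arr A" "g \<in> Arr A" "g \<cdot>\<^bsub>A\<^esub> f \<in> Arr A"
      using A_simps(3)[of f X Y g Z] by (auto simp: hom_def)
    then show ?case using F_Comp'[of f X Y g Z] 7 by (simp add: F_As)
  next
    case (11 f g h i) then show ?case 
      by (auto simp: hom2_def F_As F_cell CId_s VComp_CId_left[OF CId_in] subD)
  next
    case (12 \<alpha> f f' \<beta> g g')
    then have *: "f \<in> hom A (Src A f) (Trg A f)" "g \<in> hom A (Trg A f) (Trg A g)"
      "\<alpha> = f" "\<beta> = g" "f' = f" "g' = g"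
      by (auto simp: hom2_def hom_def)
    then have "g \<cdot>\<^bsub>A\<^esub> f \<in> Arr A" using A_simps(3) by (auto simp: hom_def)
    moreover have "FCell F (g \<cdot>\<^bsub>A\<^esub> f) = FCell F g \<star> FCell F f"
      using F.F_HComp[of f f f g g g] * by (auto simp: hom2_def hom_def)
    ultimately show ?case using * by (simp add: hom_def F_Cs)
  next
    case (6 X)
    then have "Ident A X \<in> Arr A" using A_simps(4) by (auto simp: hom_def)
    then show ?case using 6 F.F_Ident[of X] F_Os by simp
  next
    case (4 f) then show ?case using F.F_Src[of f] by (simp add: F_As A_simps)
  next
    case (5 f) then show ?case using F.F_Trg[of f] by (simp add: F_As A_simps)
  next
    case (8 f) then show ?case by (simp add: F_As F_cell CId_s D_simps subD)
  next
    case (9 f) then show ?case by (simp add: F_As F_cell CId_s D_simps subD)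
  next
    case (10 f) then show ?case by (simp add: F_As F_cell)
  next
    case 1 show ?case using F_Os by (simp add: F'_def)
  next
    case 2 show ?case using F_As by (simp add: F'_def)
  next
    case 3 show ?case using F_Cs by (simp add: F'_def)
  qed
  then show ?thesis
    using F.B.two_category_axioms E.two_category_axioms by (simp add: two_functor_def)
qed

lemma inverts_F': "inverts E \<Sigma> F'"
  unfolding inverts_def
proof
  fix s assume s: "s \<in> \<Sigma>"
  then have sA: "s \<in> Arr A" using \<Sigma> by auto
  define t where "t = FArr F s"
  have t: "t \<in> As" using F_As sA by (simp add: t_def)
  obtain g \<eta> \<eta>' \<epsilon> \<epsilon>' where g: "g \<in> As" "g \<in> hom D (Trg D t) (Src D t)"
    and cells: "\<eta> \<in> Cs" "\<eta>' \<in> Cs" "\<epsilon> \<in> Cs" "\<epsilon>' \<in> Cs"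
    and inv: "inverse_cells D (Ident D (Src D t)) (g \<cdot> t) \<eta> \<eta>'"
      "inverse_cells D (t \<cdot> g) (Ident D (Trg D t)) \<epsilon> \<epsilon>'"
    using quasi_inverse[OF s] unfolding t_def by blast
  have tr: "inverse_cells E (cA f) (cA k) (cC \<alpha>) (cC \<beta>)"
    if "f \<in> As" "k \<in> As" "\<alpha> \<in> Cs" "\<beta> \<in> Cs" "inverse_cells D f k \<alpha> \<beta>" for f k \<alpha> \<beta>
    using that by (simp add: inverse_cells_def)
  have gs: "Trg D t = Src D g" "Trg D g = Src D t" using g by (auto simp: hom_def)
  have "inverse_cells E (Ident E (Src E (cA t))) (cA g \<cdot>\<^bsub>E\<^esub> cA t) (cC \<eta>) (cC \<eta>')"
    using tr[OF _ _ cells(1,2) inv(1)] g t gs by (simp add: closed)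
  moreover have "inverse_cells E (cA t \<cdot>\<^bsub>E\<^esub> cA g) (Ident E (Trg E (cA t))) (cC \<epsilon>) (cC \<epsilon>')"
    using tr[OF _ _ cells(3,4) inv(2)] g t gs by (simp add: closed)
  moreover have "cA g \<in> hom E (Trg E (cA t)) (Src E (cA t))"
    using g t by (simp add: closed)
  ultimately have "is_equivalence E (cA t)"
    unfolding is_equivalence_def iso_hom2_def using t by auto
  then show "is_equivalence E (FArr F' s)" using sA by (simp add: t_def)
qed

lemma F_inverts: "inverts D \<Sigma> F"
  unfolding inverts_def is_equivalence_def iso_hom2_def
  using quasi_inverse \<Sigma> F_As sub by blast

lemma cyl_hat_code:
  assumes C: "is_cylinder A \<Sigma> X C"
  shows "cyl_hat D F C \<in> Cs" "cyl_hat D F C \<in> hom2 D (FArr F (cyl0 C)) (FArr F (cyl1 C))"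
    "cyl_hat E F' C = cC (cyl_hat D F C)"
proof -
  let ?P = "\<lambda>\<alpha>. \<alpha> \<in> hom2 D (FArr F (cyl0 C)) (FArr F (cyl1 C)) \<and>
    lwhisk D (FArr F (cylS C)) \<alpha> = CId D (FArr F (cylX C))"
  let ?Q = "\<lambda>\<alpha>. \<alpha> \<in> hom2 E (FArr F' (cyl0 C)) (FArr F' (cyl1 C)) \<and>
    lwhisk E (FArr F' (cylS C)) \<alpha> = CId E (FArr F' (cylX C))"
  have ex: "\<exists>!\<alpha>. ?P \<alpha>" by (rule cyl_hat_ex1[OF F.two_functor_axioms F_inverts C])
  have ex': "\<exists>!\<alpha>. ?Q \<alpha>" by (rule cyl_hat_ex1[OF two_functor_F' inverts_F' C])
  have arrs: "cyl0 C \<in> Arr A" "cyl1 C \<in> Arr A" "cylS C \<in> Arr A" "cylX C \<in> Arr A"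
    and t: "Trg A (cyl0 C) = Src A (cylS C)"
    using C by (auto simp: is_cylinder_def hom_def)
  obtain x where x: "?Q x" using ex' by blast
  then obtain \<alpha> where \<alpha>: "\<alpha> \<in> Cs" "x = cC \<alpha>" "cA (FArr F (cyl0 C)) = cA (Dom D \<alpha>)"
    using arrs by (auto elim!: hom2_EE)
  have d: "Dom D \<alpha> = FArr F (cyl0 C)" using \<alpha> arrs by (simp add: F_As closed)
  have tt: "Trg D (Dom D \<alpha>) = Src D (FArr F (cylS C))"
    using arrs t d F.F_Src F.F_Trg by simp
  then have "CId D (FArr F (cylS C)) \<star> \<alpha> \<in> Cs" using HComp_s \<alpha> arrs
    by (simp add: CId_s F_As D_simps subD)
  then have lC: "lwhisk D (FArr F (cylS C)) \<alpha> \<in> Cs" .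
  have As: "FArr F (cyl0 C) \<in> As" "FArr F (cyl1 C) \<in> As" "FArr F (cylS C) \<in> As" "FArr F (cylX C) \<in> As"
    using F_As arrs by auto
  have "cC \<alpha> \<in> hom2 E (cA (FArr F (cyl0 C))) (cA (FArr F (cyl1 C)))"
    and w: "lwhisk E (cA (FArr F (cylS C))) (cC \<alpha>) = CId E (cA (FArr F (cylX C)))"
    using x arrs unfolding \<alpha>(2) by simp_all
  then have "\<alpha> \<in> hom2 D (FArr F (cyl0 C)) (FArr F (cyl1 C))"
    using hom2_E[OF \<alpha>(1) As(1,2)] by blast
  moreover have "cC (lwhisk D (FArr F (cylS C)) \<alpha>) = cC (CId D (FArr F (cylX C)))"
    using w \<alpha>(1) As(3,4) CId_s by simp
  then have "lwhisk D (FArr F (cylS C)) \<alpha> = CId D (FArr F (cylX C))"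
    using code_eq(3)[OF lC CId_s[OF As(4)]] by blast
  ultimately have P: "?P \<alpha>" by blast
  have 1: "cyl_hat D F C = \<alpha>" unfolding cyl_hat_def by (rule the1_equality[OF ex P])
  have "?Q (cyl_hat E F' C)" unfolding cyl_hat_def by (rule theI'[OF ex'])
  then have 2: "cyl_hat E F' C = x" using ex' x by blast
  show "cyl_hat D F C \<in> Cs" "cyl_hat D F C \<in> hom2 D (FArr F (cyl0 C)) (FArr F (cyl1 C))"
    "cyl_hat E F' C = cC (cyl_hat D F C)"
    unfolding 1 2 using P \<alpha>(1,2) by blast+
qed

lemma homotopy_hat_code:
  assumes "is_homotopy A \<Sigma> f g H"
  shows "homotopy_hat D F H \<in> Cs" "homotopy_hat D F H \<in> hom2 D (FArr F f) (FArr F g)"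
    "homotopy_hat E F' H = cC (homotopy_hat D F H)"
proof -
  obtain C h where H: "H = (C, h)" by (cases H)
  have C: "is_cylinder A \<Sigma> (Src A f) C" and h: "h \<in> hom A (cylW C) (Trg A f)"
    and fg: "h \<cdot>\<^bsub>A\<^esub> cyl0 C = f" "h \<cdot>\<^bsub>A\<^esub> cyl1 C = g"
    using assms by (auto simp: H)
  note c = cyl_hat_code[OF C]
  have cy: "cyl0 C \<in> hom A (Src A f) (cylW C)" "cyl1 C \<in> hom A (Src A f) (cylW C)"
    using C by (auto simp: is_cylinder_def)
  have hA: "FArr F h \<in> Arr D" "h \<in> Arr A" "Src D (FArr F h) = Trg D (FArr F (cyl0 C))"
    using F_hom[OF h] F_hom[OF cy(1)] h by (auto simp: hom_def)
  have "FArr F f = FArr F h \<cdot> FArr F (cyl0 C)" "FArr F g = FArr F h \<cdot> FArr F (cyl1 C)"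
    using F_Comp'[OF cy(1) h] F_Comp'[OF cy(2) h] fg by simp_all
  then show "homotopy_hat D F H \<in> hom2 D (FArr F f) (FArr F g)"
    using whisk_in[OF c(2) hA(1,3)] by (simp add: H)
  have "Dom D (cyl_hat D F C) = FArr F (cyl0 C)" using c(2) by (simp add: hom2_def)
  then show "homotopy_hat D F H \<in> Cs" 
    using HComp_s[OF c(1) CId_s[OF F_As[OF hA(2)]]] hA by (simp add: H D_simps)
  show "homotopy_hat E F' H = cC (homotopy_hat D F H)"
    using c(1,3) hA by (simp add: H F_As CId_s)
qed

lemma seq_hat_code:
  assumes "homotopy_seq A \<Sigma> f g Hs"
  shows "seq_hat D F Hs \<in> Cs \<and> seq_hat D F Hs \<in> hom2 D (FArr F f) (FArr F g) \<and>
    seq_hat E F' Hs = cC (seq_hat D F Hs)"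
  using assms
proof induction
  case (single f g H)
  then show ?case using homotopy_hat_code by simp
next
  case (cons f g Hs k H)
  note h = homotopy_hat_code[OF cons(2)]
  obtain K Ks where Hs: "Hs = K # Ks" using cons(1) by (cases rule: homotopy_seq.cases) auto
  have "Cod D (seq_hat D F Hs) = Dom D (homotopy_hat D F H)"
    using cons(3) h(2) by (simp add: hom2_def)
  then show ?case
    using cons(3) h VComp_s[of "seq_hat D F Hs" "homotopy_hat D F H"]
      VComp_in[of "seq_hat D F Hs" "FArr F f" "FArr F g" "homotopy_hat D F H" "FArr F k"]
    by (simp add: Hs)
qed

end

text \<open>Words for the generated arrows and 2-cells; the prefixed length makes them uniquely readable.\<close>

inductive arr_code :: "('o, 'a) cat \<Rightarrow> 'a set \<Rightarrow> ('p, 'b, 'd) twocat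
    \<Rightarrow> ('o, 'a, 'a, 'p, 'b, 'd) tfun \<Rightarrow> ('a \<Rightarrow> 'b) \<Rightarrow> ('o, 'a) code \<Rightarrow> 'b \<Rightarrow> bool"
  for A \<Sigma> D F q where
  "a \<in> Arr A \<Longrightarrow> arr_code A \<Sigma> D F q [Inr (Inl a)] (FArr F a)"
| "s \<in> \<Sigma> \<Longrightarrow> arr_code A \<Sigma> D F q [Inr (Inl s), Inr (Inl s)] (q s)"
| "arr_code A \<Sigma> D F q u f \<Longrightarrow> arr_code A \<Sigma> D F q v g \<Longrightarrow> Trg D f = Src D g
    \<Longrightarrow> arr_code A \<Sigma> D F q (Inr (Inr (length u)) # u @ v) (g \<cdot>\<^bsub>D\<^esub> f)"

inductive cell_code :: "('o, 'a) cat \<Rightarrow> 'a set \<Rightarrow> ('p, 'b, 'd) twocat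
    \<Rightarrow> ('o, 'a, 'a, 'p, 'b, 'd) tfun \<Rightarrow> ('a \<Rightarrow> 'b) \<Rightarrow> (nat \<Rightarrow> 'a \<Rightarrow> 'd) \<Rightarrow> ('o, 'a) code \<Rightarrow> 'd \<Rightarrow> bool"
  for A \<Sigma> D F q k where
  "arr_code A \<Sigma> D F q u f \<Longrightarrow> cell_code A \<Sigma> D F q k (Inr (Inr 0) # u) (CId D f)"
| "s \<in> \<Sigma> \<Longrightarrow> n < 4 \<Longrightarrow> cell_code A \<Sigma> D F q k [Inr (Inl s), Inr (Inr n)] (k n s)"
| "cell_code A \<Sigma> D F q k u \<alpha> \<Longrightarrow> cell_code A \<Sigma> D F q k v \<beta> \<Longrightarrow> Cod D \<alpha> = Dom D \<beta>
    \<Longrightarrow> cell_code A \<Sigma> D F q k (Inr (Inr 1) # Inr (Inr (length u)) # u @ v) (\<beta> \<bullet>\<^bsub>D\<^esub> \<alpha>)"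
| "cell_code A \<Sigma> D F q k u \<alpha> \<Longrightarrow> cell_code A \<Sigma> D F q k v \<beta>
    \<Longrightarrow> Trg D (Dom D \<alpha>) = Src D (Dom D \<beta>)
    \<Longrightarrow> cell_code A \<Sigma> D F q k (Inr (Inr 2) # Inr (Inr (length u)) # u @ v) (\<beta> \<star>\<^bsub>D\<^esub> \<alpha>)"

lemma arr_code_functional:
  "arr_code A \<Sigma> D F q w f \<Longrightarrow> arr_code A \<Sigma> D F q w g \<Longrightarrow> f = g"
proof (induction arbitrary: g rule: arr_code.induct)
  case (3 u f v g')
  from 3(6) obtain u' f' v' g'' where
    "Inr (Inr (length u)) # u @ v = Inr (Inr (length u')) # u' @ v'" "g = g'' \<cdot>\<^bsub>D\<^esub> f'"
    "arr_code A \<Sigma> D F q u' f'" "arr_code A \<Sigma> D F q v' g''"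
    by (cases rule: arr_code.cases) auto
  then show ?case using 3(4)[of f'] 3(5)[of g''] by auto
next
  case (1 a)
  from 1(2) show ?case by (cases rule: arr_code.cases) auto
next
  case (2 s)
  from 2(2) show ?case by (cases rule: arr_code.cases) auto
qed

lemma cell_code_functional:
  "cell_code A \<Sigma> D F q k w \<alpha> \<Longrightarrow> cell_code A \<Sigma> D F q k w \<beta> \<Longrightarrow> \<alpha> = \<beta>"
proof (induction arbitrary: \<beta> rule: cell_code.induct)
  case (1 u f)
  from 1(2) show ?case by (cases rule: cell_code.cases) (use 1 arr_code_functional[of A \<Sigma> D F q u] in auto)
next
  case (3 u \<alpha> v \<gamma>)
  from 3(6) obtain u' \<alpha>' v' \<gamma>' where
    "Inr (Inr 1) # Inr (Inr (length u)) # u @ v = Inr (Inr 1) # Inr (Inr (length u')) # u' @ v'"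
    "\<beta> = \<gamma>' \<bullet>\<^bsub>D\<^esub> \<alpha>'" "cell_code A \<Sigma> D F q k u' \<alpha>'" "cell_code A \<Sigma> D F q k v' \<gamma>'"
    by (cases rule: cell_code.cases) auto
  then show ?case using 3(4)[of \<alpha>'] 3(5)[of \<gamma>'] by auto
next
  case (4 u \<alpha> v \<gamma>)
  from 4(6) obtain u' \<alpha>' v' \<gamma>' where
    "Inr (Inr 2) # Inr (Inr (length u)) # u @ v = Inr (Inr 2) # Inr (Inr (length u')) # u' @ v'"
    "\<beta> = \<gamma>' \<star>\<^bsub>D\<^esub> \<alpha>'" "cell_code A \<Sigma> D F q k u' \<alpha>'" "cell_code A \<Sigma> D F q k v' \<gamma>'"
    by (cases rule: cell_code.cases) auto
  then show ?case using 4(4)[of \<alpha>'] 4(5)[of \<gamma>'] by auto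
next
  case (2 s n)
  from 2(3) show ?case by (cases rule: cell_code.cases) auto
qed

lemma inj_on_some_code:
  assumes "\<And>w x y. R w x \<Longrightarrow> R w y \<Longrightarrow> x = y"
  shows "inj_on (\<lambda>x. SOME w. R w x) {x. \<exists>w. R w x}"
proof (rule inj_onI)
  fix x y assume x: "x \<in> {x. \<exists>w. R w x}" and y: "y \<in> {x. \<exists>w. R w x}"
    and eq: "(SOME w. R w x) = (SOME w. R w y)"
  have "R (SOME w. R w x) x" using x someI_ex[of "\<lambda>w. R w x"] by simp
  moreover have "R (SOME w. R w y) y" using y someI_ex[of "\<lambda>w. R w y"] by simp
  ultimately show "x = y" using assms[of "SOME w. R w y" x y] eq by simp
qed

theorem seq_equiv_all:
  fixes A :: "('o, 'a) cat" and D :: "('p, 'b, 'd) twocat"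
  assumes F: "two_functor (disc A) D F" "inverts D \<Sigma> F" and \<Sigma>: "\<Sigma> \<subseteq> Arr A"
    and Hs: "homotopy_seq A \<Sigma> f g Hs" and Ks: "homotopy_seq A \<Sigma> f g Ks"
    and eq: "seq_equiv A \<Sigma> Hs Ks"
  shows "seq_hat D F Hs = seq_hat D F Ks"
proof -
  interpret F: two_functor "disc A" D F by (rule F)
  let ?t = "FArr F"
  define P where "P s g c \<longleftrightarrow> g \<in> hom D (Trg D (?t s)) (Src D (?t s)) \<and>
      inverse_cells D (Ident D (Src D (?t s))) (g \<cdot>\<^bsub>D\<^esub> ?t s) (c 0) (c 1) \<and>
      inverse_cells D (?t s \<cdot>\<^bsub>D\<^esub> g) (Ident D (Trg D (?t s))) (c 2) (c 3)" for s g and c :: "nat \<Rightarrow> 'd"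
  have "\<exists>p. P s (fst p) (snd p)" if s: "s \<in> \<Sigma>" for s
  proof -
    obtain g \<eta> \<eta>' \<epsilon> \<epsilon>' where "g \<in> hom D (Trg D (?t s)) (Src D (?t s))"
      "inverse_cells D (Ident D (Src D (?t s))) (g \<cdot>\<^bsub>D\<^esub> ?t s) \<eta> \<eta>'"
      "inverse_cells D (?t s \<cdot>\<^bsub>D\<^esub> g) (Ident D (Trg D (?t s))) \<epsilon> \<epsilon>'"
      using F(2) s by (fastforce simp: inverts_def is_equivalence_def iso_hom2_def)
    then show ?thesis
      by (intro exI[of _ "(g, \<lambda>n. [\<eta>, \<eta>', \<epsilon>, \<epsilon>'] ! n)"]) (simp add: P_def)
  qed
  then obtain p where p: "\<And>s. s \<in> \<Sigma> \<Longrightarrow> P s (fst (p s)) (snd (p s))"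
    using bchoice[of \<Sigma> "\<lambda>s p. P s (fst p) (snd p)"] by blast
  define q where "q s = fst (p s)" for s
  define k where "k n s = snd (p s) n" for n s
  have q: "q s \<in> hom D (Trg D (?t s)) (Src D (?t s))"
    and k01: "inverse_cells D (Ident D (Src D (?t s))) (q s \<cdot>\<^bsub>D\<^esub> ?t s) (k 0 s) (k 1 s)"
    and k23: "inverse_cells D (?t s \<cdot>\<^bsub>D\<^esub> q s) (Ident D (Trg D (?t s))) (k 2 s) (k 3 s)"
    if "s \<in> \<Sigma>" for s
    using p[OF that] by (simp_all add: P_def q_def k_def)
  define Os where "Os = FObj F ` Obj A"
  define RA where "RA = arr_code A \<Sigma> D F q"
  define RC where "RC = cell_code A \<Sigma> D F q k"
  define As where "As = {x. \<exists>w. RA w x}"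
  define Cs where "Cs = {x. \<exists>w. RC w x}"
  define cO :: "'p \<Rightarrow> ('o, 'a) code" where "cO x = [Inl (inv_into (Obj A) (FObj F) x)]" for x
  define cA where "cA x = (SOME w. RA w x)" for x
  define cC where "cC x = (SOME w. RC w x)" for x
  have tA: "?t s \<in> As" if "s \<in> Arr A" for s
    using arr_code.intros(1)[OF that, of \<Sigma> D F q] by (auto simp: As_def RA_def)
  have st: "Src D (?t s) \<in> Os" "Trg D (?t s) \<in> Os" "?t s \<in> Arr D" if "s \<in> Arr A" for s
    using that F.F_Src F.F_Trg F.B.Src_in F.B.Trg_in F.FArr_in by (auto simp: Os_def)
  have qA: "q s \<in> As" if "s \<in> \<Sigma>" for s
    using arr_code.intros(2)[OF that, of A D F q] by (auto simp: As_def RA_def)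
  have kC: "k n s \<in> Cs" if "s \<in> \<Sigma>" "n < 4" for s n
    using cell_code.intros(2)[OF that, of A D F q k] by (auto simp: Cs_def RC_def)
  have As_prop: "f \<in> Arr D \<and> Src D f \<in> Os \<and> Trg D f \<in> Os" if "f \<in> As" for f
  proof -
    from that obtain w where "arr_code A \<Sigma> D F q w f" by (auto simp: As_def RA_def)
    then show ?thesis
    proof induction
      case (1 a) then show ?case using st by auto
    next
      case (2 s) then show ?case using q[OF 2] st \<Sigma> by (auto simp: hom_def)
    next
      case (3 u f v g)
      then show ?case using F.D.Comp_in[of f "Src D f" "Trg D f" g "Trg D g"] by (simp add: hom_def)
    qed
  qed
  have Comp_s: "g \<cdot>\<^bsub>D\<^esub> f \<in> As" if "f \<in> As" "g \<in> As" "Trg D f = Src D g" for f g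
    using that arr_code.intros(3)[of A \<Sigma> D F q _ f _ g] by (fastforce simp: As_def RA_def)
  have Ident_s: "Ident D X \<in> As" if X: "X \<in> Os" for X
  proof -
    from X obtain Y where Y: "Y \<in> Obj A" "X = FObj F Y" by (auto simp: Os_def)
    then have "Ident D X = ?t (Ident A Y)" using F.F_Ident[of Y] by simp
    then show ?thesis using tA[of "Ident A Y"] F.B.Ident_in[of Y] Y by (simp add: hom_def)
  qed
  have Cs_prop: "\<alpha> \<in> Cell D \<and> Dom D \<alpha> \<in> As \<and> Cod D \<alpha> \<in> As" if "\<alpha> \<in> Cs" for \<alpha>
  proof -
    from that obtain w where "cell_code A \<Sigma> D F q k w \<alpha>" by (auto simp: Cs_def RC_def)
    then show ?thesis
    proof induction
      case (1 u f)
      then have "f \<in> As" by (auto simp: As_def RA_def)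
      then show ?case using F.D.CId_in[of f] As_prop[of f] by (simp add: hom2_def)
    next
      case (2 s n)
      then have s: "s \<in> Arr A" using \<Sigma> by auto
      have c: "q s \<cdot>\<^bsub>D\<^esub> ?t s \<in> As" "?t s \<cdot>\<^bsub>D\<^esub> q s \<in> As"
        using Comp_s[OF tA[OF s] qA[OF 2(1)]] Comp_s[OF qA[OF 2(1)] tA[OF s]] q[OF 2(1)]
        by (auto simp: hom_def)
      have n: "n = 0 \<or> n = 1 \<or> n = 2 \<or> n = 3" using 2(2) by auto
      then show ?case
        using k01[OF 2(1)] k23[OF 2(1)] c Ident_s st[OF s]
        by (auto simp: inverse_cells_def hom2_def)
    next
      case (3 u \<alpha> v \<beta>)
      then show ?case using F.D.VComp_in[of \<alpha> "Dom D \<alpha>" "Cod D \<alpha>" \<beta> "Cod D \<beta>"]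
        by (simp add: hom2_def)
    next
      case (4 u \<alpha> v \<beta>)
      then have "\<beta> \<star>\<^bsub>D\<^esub> \<alpha> \<in> hom2 D (Dom D \<beta> \<cdot>\<^bsub>D\<^esub> Dom D \<alpha>) (Cod D \<beta> \<cdot>\<^bsub>D\<^esub> Cod D \<alpha>)"
        by (intro F.D.HComp_in) (auto simp: hom2_def)
      moreover have "Trg D (Cod D \<alpha>) = Src D (Cod D \<beta>)"
        using 4 F.D.Src_Cod F.D.Trg_Cod by simp
      ultimately show ?case using 4 Comp_s by (simp add: hom2_def)
    qed
  qed
  interpret coded_functor A D Os As Cs cO cA cC F \<Sigma>
  proof (unfold_locales, goal_cases)
    case 1 show ?case using F.FObj_in by (auto simp: Os_def)
  next
    case 2 show ?case using As_prop by auto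
  next
    case 3 show ?case using Cs_prop by auto
  next
    case 4 show ?case unfolding Os_def cO_def by (auto intro!: inj_onI dest: inv_into_injective)
  next
    case 5 show ?case unfolding cA_def As_def
      by (rule inj_on_some_code) (auto simp: RA_def dest: arr_code_functional)
  next
    case 6 show ?case unfolding cC_def Cs_def
      by (rule inj_on_some_code) (auto simp: RC_def dest: cell_code_functional)
  next
    case 13 then show ?case using cell_code.intros(1)[of A \<Sigma> D F q]
      by (fastforce simp: As_def RA_def Cs_def RC_def)
  next
    case (14 \<alpha> \<beta>) then show ?case using cell_code.intros(3)[of A \<Sigma> D F q k _ \<alpha> _ \<beta>]
      by (fastforce simp: Cs_def RC_def)
  next
    case (15 \<alpha> \<beta>) then show ?case using cell_code.intros(4)[of A \<Sigma> D F q k _ \<alpha> _ \<beta>]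
      by (fastforce simp: Cs_def RC_def)
  next
    case (19 s)
    have "k 0 s \<in> Cs" "k 1 s \<in> Cs" "k 2 s \<in> Cs" "k 3 s \<in> Cs" using kC[OF 19] by auto
    then show ?case using q[OF 19] k01[OF 19] k23[OF 19] qA[OF 19] by blast
  qed (use As_prop Cs_prop Comp_s Ident_s tA \<Sigma> in \<open>auto simp: Os_def\<close>)
  have "seq_hat E F' Hs = seq_hat E F' Ks"
    using eq two_functor_F' inverts_F' by (simp add: seq_equiv_def)
  then show ?thesis using seq_hat_code[OF Hs] seq_hat_code[OF Ks] by simp
qed

end

theory Submission
  imports Defs
begin

text \<open>
  A 2-cell \<open>\<alpha>\<close> of the homotopy 2-category is determined by the family of its images \<open>cell_hat D F \<alpha>\<close>
  under the functors \<open>F\<close> that invert \<open>\<Sigma>\<close>, and these images respect all operations; hence the axioms of a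
  2-category hold in \<open>Ho A \<Sigma>\<close> because they hold in each \<open>D\<close>, and \<open>cell_hat D F\<close> extends \<open>F\<close> to \<open>Ho A \<Sigma>\<close>.
  In \<open>Ho A \<Sigma>\<close> a homotopy is invertible, its inverse being given by the cylinder with \<open>d\<^sub>0\<close> and \<open>d\<^sub>1\<close>
  exchanged. If \<open>g \<cdot> f = id\<close> with \<open>f\<close>, \<open>g\<close> in \<open>\<Sigma>\<close>, the cylinder \<open>(Y, X, f \<cdot> g, id, g, g)\<close> gives a homotopy
  from \<open>f \<cdot> g\<close> to \<open>id\<close>, so split weak equivalences, and therefore all weak equivalences, become
  equivalences. Since an equivalence is faithful on 2-cells, a 2-functor \<open>K\<close> on \<open>Ho A \<Sigma>\<close> must send the
  2-cell of a cylinder to \<open>cyl_hat\<close>, so it is determined by its restriction to \<open>A\<close>; for the same reason a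
  pseudonatural transformation on \<open>A\<close> is automatically natural with respect to homotopies. So restriction
  along the inclusion is bijective on 2-functors, on transformations and on modifications.
\<close>

section \<open>2-categories\<close>

text \<open>Equivalence of sequences is tested only in 2-categories with carriers in one fixed type,
  while the theorem concerns arbitrary \<open>D\<close>. Two directions are therefore kept apart: an
  equation between 2-cells of \<open>Ho A \<Sigma>\<close> is checked in the test 2-categories
  (\<open>Ho_cell_eqI\<close>), whereas \<open>cell_hat_class\<close> uses
  \<open>seq_equiv_all\<close> to make \<open>cell_hat D F\<close> independent of the representative
  for every \<open>D\<close>. Restriction is an isomorphism, not merely an equivalence, because
  \<open>A\<close> and \<open>Ho A \<Sigma>\<close> share objects and arrows, so an extension has no
  choice there; and since all components are extensional, agreement on the carriers is equality. The
  required pseudoequivalence then has identity transformations as unit and counit. Isomorphisms of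
  2-categories, and equivalences in \<open>Hom_p\<close>, presuppose the 2-category axioms for the
  Hom-2-categories; a large part of the development establishes these. The "2 for 1" condition
  brings the retraction of a split pair into \<Sigma>: the cylinder needs the retraction as its
  \<open>s\<close>, even when the section is the arrow given.\<close>

context two_category
begin

text \<open>The axioms speak of hom-sets with explicit endpoints, which the simplifier cannot guess.
  Here the endpoints are computed by \<open>Src\<close>, \<open>Trg\<close>, \<open>Dom\<close> and
  \<open>Cod\<close>, so that side conditions of later rewriting are themselves discharged by
  rewriting.\<close>

lemma typing:
  "f \<in> Arr C \<Longrightarrow> Src C f \<in> Obj C" "f \<in> Arr C \<Longrightarrow> Trg C f \<in> Obj C"
  "X \<in> Obj C \<Longrightarrow> Ident C X \<in> Arr C"
  "X \<in> Obj C \<Longrightarrow> Src C (Ident C X) = X" "X \<in> Obj C \<Longrightarrow> Trg C (Ident C X) = X"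
  "f \<in> Arr C \<Longrightarrow> g \<in> Arr C \<Longrightarrow> Trg C f = Src C g \<Longrightarrow> g \<cdot> f \<in> Arr C"
  "f \<in> Arr C \<Longrightarrow> g \<in> Arr C \<Longrightarrow> Trg C f = Src C g \<Longrightarrow> Src C (g \<cdot> f) = Src C f"
  "f \<in> Arr C \<Longrightarrow> g \<in> Arr C \<Longrightarrow> Trg C f = Src C g \<Longrightarrow> Trg C (g \<cdot> f) = Trg C g"
  "\<alpha> \<in> Cell C \<Longrightarrow> Dom C \<alpha> \<in> Arr C" "\<alpha> \<in> Cell C \<Longrightarrow> Cod C \<alpha> \<in> Arr C"
  "\<alpha> \<in> Cell C \<Longrightarrow> Src C (Cod C \<alpha>) = Src C (Dom C \<alpha>)"
  "\<alpha> \<in> Cell C \<Longrightarrow> Trg C (Cod C \<alpha>) = Trg C (Dom C \<alpha>)"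
  "f \<in> Arr C \<Longrightarrow> CId C f \<in> Cell C"
  "f \<in> Arr C \<Longrightarrow> Dom C (CId C f) = f" "f \<in> Arr C \<Longrightarrow> Cod C (CId C f) = f"
  "\<alpha> \<in> Cell C \<Longrightarrow> \<beta> \<in> Cell C \<Longrightarrow> Cod C \<alpha> = Dom C \<beta> \<Longrightarrow> \<beta> \<bullet> \<alpha> \<in> Cell C"
  "\<alpha> \<in> Cell C \<Longrightarrow> \<beta> \<in> Cell C \<Longrightarrow> Cod C \<alpha> = Dom C \<beta> \<Longrightarrow> Dom C (\<beta> \<bullet> \<alpha>) = Dom C \<alpha>"
  "\<alpha> \<in> Cell C \<Longrightarrow> \<beta> \<in> Cell C \<Longrightarrow> Cod C \<alpha> = Dom C \<beta> \<Longrightarrow> Cod C (\<beta> \<bullet> \<alpha>) = Cod C \<beta>"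
  "\<alpha> \<in> Cell C \<Longrightarrow> \<beta> \<in> Cell C \<Longrightarrow> Trg C (Dom C \<alpha>) = Src C (Dom C \<beta>) \<Longrightarrow> \<beta> \<star> \<alpha> \<in> Cell C"
  "\<alpha> \<in> Cell C \<Longrightarrow> \<beta> \<in> Cell C \<Longrightarrow> Trg C (Dom C \<alpha>) = Src C (Dom C \<beta>)
    \<Longrightarrow> Dom C (\<beta> \<star> \<alpha>) = Dom C \<beta> \<cdot> Dom C \<alpha>"
  "\<alpha> \<in> Cell C \<Longrightarrow> \<beta> \<in> Cell C \<Longrightarrow> Trg C (Dom C \<alpha>) = Src C (Dom C \<beta>)
    \<Longrightarrow> Cod C (\<beta> \<star> \<alpha>) = Cod C \<beta> \<cdot> Cod C \<alpha>"
  using Src_in[of f] Trg_in[of f] Dom_in[of \<alpha>] Cod_in[of \<alpha>] Src_Cod[of \<alpha>] Trg_Cod[of \<alpha>]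
    Comp_in[of f "Src C f" "Trg C f" g "Trg C g"] Ident_in[of X] CId_in[of f]
    VComp_in[of \<alpha> "Dom C \<alpha>" "Cod C \<alpha>" \<beta> "Cod C \<beta>"]
    HComp_in[of \<alpha> "Dom C \<alpha>" "Cod C \<alpha>" \<beta> "Dom C \<beta>" "Cod C \<beta>"]
  by (simp_all add: hom_def hom2_def)

text \<open>Interchange, with the identity 2-cell of \<open>r\<close> written as its own vertical
  square.\<close>

lemma lwhisk_VComp:
  assumes "\<alpha> \<in> Cell C" "\<beta> \<in> Cell C" "Cod C \<alpha> = Dom C \<beta>" "r \<in> Arr C" "Trg C (Dom C \<alpha>) = Src C r"
  shows "lwhisk C r (\<beta> \<bullet> \<alpha>) = lwhisk C r \<beta> \<bullet> lwhisk C r \<alpha>"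
  using interchange[of \<alpha> "Dom C \<alpha>" "Cod C \<alpha>" \<beta> "Cod C \<beta>" "CId C r" r r "CId C r" r]
    VComp_CId_left[of "CId C r" r r] assms by (simp add: hom2_def typing)

lemma rwhisk_VComp:
  assumes "\<alpha> \<in> Cell C" "\<beta> \<in> Cell C" "Cod C \<alpha> = Dom C \<beta>" "r \<in> Arr C" "Trg C r = Src C (Dom C \<alpha>)"
  shows "rwhisk C (\<beta> \<bullet> \<alpha>) r = rwhisk C \<beta> r \<bullet> rwhisk C \<alpha> r"
  using interchange[of "CId C r" r r "CId C r" r \<alpha> "Dom C \<alpha>" "Cod C \<alpha>" \<beta> "Cod C \<beta>" ]
    VComp_CId_left[of "CId C r" r r] assms by (simp add: hom2_def typing)

text \<open>Endpoints are variables bound by equational premises, so each left-hand side matches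
  whatever form an endpoint currently has. The last rule splits whiskering with a composite on the
  left; on the right, associativity and the rule for identity 2-cells merge successive whiskerings
  into one.\<close>

lemma unit_assoc:
  "f \<in> Arr C \<Longrightarrow> Trg C f = Y \<Longrightarrow> Ident C Y \<cdot> f = f"
  "f \<in> Arr C \<Longrightarrow> Src C f = X \<Longrightarrow> f \<cdot> Ident C X = f"
  "f \<in> Arr C \<Longrightarrow> g \<in> Arr C \<Longrightarrow> h \<in> Arr C \<Longrightarrow> Trg C f = Src C g \<Longrightarrow> Trg C g = Src C h
    \<Longrightarrow> (h \<cdot> g) \<cdot> f = h \<cdot> (g \<cdot> f)"
  "\<alpha> \<in> Cell C \<Longrightarrow> Cod C \<alpha> = g \<Longrightarrow> CId C g \<bullet> \<alpha> = \<alpha>"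
  "\<alpha> \<in> Cell C \<Longrightarrow> Dom C \<alpha> = f \<Longrightarrow> \<alpha> \<bullet> CId C f = \<alpha>"
  "\<alpha> \<in> Cell C \<Longrightarrow> \<beta> \<in> Cell C \<Longrightarrow> \<gamma> \<in> Cell C \<Longrightarrow> Cod C \<alpha> = Dom C \<beta> \<Longrightarrow> Cod C \<beta> = Dom C \<gamma>
    \<Longrightarrow> (\<gamma> \<bullet> \<beta>) \<bullet> \<alpha> = \<gamma> \<bullet> (\<beta> \<bullet> \<alpha>)"
  "\<alpha> \<in> Cell C \<Longrightarrow> \<beta> \<in> Cell C \<Longrightarrow> \<gamma> \<in> Cell C \<Longrightarrow> Trg C (Dom C \<alpha>) = Src C (Dom C \<beta>)
    \<Longrightarrow> Trg C (Dom C \<beta>) = Src C (Dom C \<gamma>) \<Longrightarrow> (\<gamma> \<star> \<beta>) \<star> \<alpha> = \<gamma> \<star> (\<beta> \<star> \<alpha>)"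
  "\<alpha> \<in> Cell C \<Longrightarrow> Trg C (Dom C \<alpha>) = Y \<Longrightarrow> CId C (Ident C Y) \<star> \<alpha> = \<alpha>"
  "\<alpha> \<in> Cell C \<Longrightarrow> Src C (Dom C \<alpha>) = X \<Longrightarrow> \<alpha> \<star> CId C (Ident C X) = \<alpha>"
  "f \<in> Arr C \<Longrightarrow> g \<in> Arr C \<Longrightarrow> Trg C f = Src C g \<Longrightarrow> CId C g \<star> CId C f = CId C (g \<cdot> f)"
  "f \<in> Arr C \<Longrightarrow> g \<in> Arr C \<Longrightarrow> \<alpha> \<in> Cell C \<Longrightarrow> Trg C f = Src C g \<Longrightarrow> Trg C (Dom C \<alpha>) = Src C f
    \<Longrightarrow> CId C (g \<cdot> f) \<star> \<alpha> = CId C g \<star> (CId C f \<star> \<alpha>)"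
  using Comp_Ident_left[of f "Src C f" "Trg C f"] Comp_Ident_right[of f "Src C f" "Trg C f"]
      Comp_assoc[of f "Src C f" "Trg C f" g "Trg C g" h "Trg C h"]
      VComp_CId_left[of \<alpha> "Dom C \<alpha>" "Cod C \<alpha>"] VComp_CId_right[of \<alpha> "Dom C \<alpha>" "Cod C \<alpha>"]
      VComp_assoc[of \<alpha> "Dom C \<alpha>" "Cod C \<alpha>" \<beta> "Cod C \<beta>" \<gamma> "Cod C \<gamma>"]
      HComp_assoc[of \<alpha> "Dom C \<alpha>" "Cod C \<alpha>" \<beta> "Dom C \<beta>" "Cod C \<beta>" \<gamma> "Dom C \<gamma>" "Cod C \<gamma>"]
      HComp_Ident_left[of \<alpha> "Dom C \<alpha>" "Cod C \<alpha>"] HComp_Ident_right[of \<alpha> "Dom C \<alpha>" "Cod C \<alpha>"]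
      HComp_CId[of f "Src C f" "Trg C f" g "Trg C g"] lwhisk_Comp[of \<alpha> "Dom C \<alpha>" "Cod C \<alpha>" f "Trg C f" g "Trg C g"]
  by (simp_all add: hom_def hom2_def)

text \<open>As a rewrite system these rules bring a 2-cell into the form of a right-nested vertical
  composite of 2-cells \<open>l\<^sub>1 \<star> (\<dots> \<star> (\<alpha> \<star> r))\<close> with \<open>l\<^sub>i\<close>, \<open>r\<close> identity 2-cells.\<close>

lemmas normalize = unit_assoc lwhisk_VComp rwhisk_VComp

text \<open>Insert an identity 2-cell after \<alpha> and one before \<beta>, then apply interchange.
  Horizontal composition in \<open>Ho A \<Sigma>\<close> is defined by this very formula.\<close>

lemma HComp_left_right:
  assumes "\<alpha> \<in> Cell C" "\<beta> \<in> Cell C" "Trg C (Dom C \<alpha>) = Src C (Dom C \<beta>)"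
  shows "\<beta> \<star> \<alpha> = rwhisk C \<beta> (Cod C \<alpha>) \<bullet> lwhisk C (Dom C \<beta>) \<alpha>"
  using interchange[of \<alpha> "Dom C \<alpha>" "Cod C \<alpha>" "CId C (Cod C \<alpha>)" "Cod C \<alpha>" "CId C (Dom C \<beta>)" "Dom C \<beta>" "Dom C \<beta>" \<beta> "Cod C \<beta>"]
    assms by (simp add: hom2_def typing normalize)

lemma HComp_right_left:
  assumes "\<alpha> \<in> Cell C" "\<beta> \<in> Cell C" "Trg C (Dom C \<alpha>) = Src C (Dom C \<beta>)"
  shows "\<beta> \<star> \<alpha> = lwhisk C (Cod C \<beta>) \<alpha> \<bullet> rwhisk C \<beta> (Dom C \<alpha>)"
  using interchange[of "CId C (Dom C \<alpha>)" "Dom C \<alpha>" "Dom C \<alpha>" \<alpha> "Cod C \<alpha>" \<beta> "Dom C \<beta>" "Cod C \<beta>" "CId C (Cod C \<beta>)" "Cod C \<beta>"]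
    assms by (simp add: hom2_def typing normalize)

text \<open>Both sides equal the horizontal composite of \<alpha> and \<beta>. This is the form of
  interchange used in all pasting arguments below.\<close>

lemma slide:
  assumes "\<alpha> \<in> Cell C" "\<beta> \<in> Cell C" "Trg C (Dom C \<alpha>) = Src C (Dom C \<beta>)"
    "Dom C \<alpha> = a" "Cod C \<alpha> = a'" "Dom C \<beta> = b" "Cod C \<beta> = b'"
  shows "rwhisk C \<beta> a' \<bullet> lwhisk C b \<alpha> = lwhisk C b' \<alpha> \<bullet> rwhisk C \<beta> a"
  using HComp_left_right[OF assms(1-3)] HComp_right_left[OF assms(1-3)] assms by simp

lemma inverse_cellsD:
  assumes "inverse_cells C f g \<alpha> \<beta>"
  shows "\<alpha> \<in> Cell C" "\<beta> \<in> Cell C" "Dom C \<alpha> = f" "Cod C \<alpha> = g" "Dom C \<beta> = g" "Cod C \<beta> = f"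
    "\<beta> \<bullet> \<alpha> = CId C f" "\<alpha> \<bullet> \<beta> = CId C g" "f \<in> Arr C" "g \<in> Arr C"
    "Src C g = Src C f" "Trg C g = Trg C f"
proof -
  have h: "\<alpha> \<in> hom2 C f g" "\<beta> \<in> hom2 C g f" "\<beta> \<bullet> \<alpha> = CId C f" "\<alpha> \<bullet> \<beta> = CId C g"
    using assms by (simp_all add: inverse_cells_def)
  show "\<alpha> \<in> Cell C" "\<beta> \<in> Cell C" "Dom C \<alpha> = f" "Cod C \<alpha> = g" "Dom C \<beta> = g" "Cod C \<beta> = f"
    "\<beta> \<bullet> \<alpha> = CId C f" "\<alpha> \<bullet> \<beta> = CId C g" "f \<in> Arr C" "g \<in> Arr C"
    "Src C g = Src C f" "Trg C g = Trg C f"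
    using hom2D[OF h(1)] hom2D[OF h(2)] h(3,4) by blast+
qed

lemma inverse_VComp:
  assumes "inverse_cells C f g \<alpha> \<alpha>'" "inverse_cells C g h \<beta> \<beta>'"
  shows "inverse_cells C f h (\<beta> \<bullet> \<alpha>) (\<alpha>' \<bullet> \<beta>')"
proof -
  note e = inverse_cellsD[OF assms(1)] inverse_cellsD[OF assms(2)]
  \<comment> \<open>Right-nesting never exposes the inverse pair, so the instance of associativity
    that brings \<open>\<beta>'\<close> next to \<beta> is supplied explicitly.\<close>
  have "\<beta>' \<bullet> (\<beta> \<bullet> \<alpha>) = \<alpha>" using normalize(6)[of \<alpha> \<beta> \<beta>'] e by (simp add: normalize)
  moreover have "\<alpha> \<bullet> (\<alpha>' \<bullet> \<beta>') = \<beta>'" using normalize(6)[of \<beta>' \<alpha>' \<alpha>] e by (simp add: normalize)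
  ultimately show ?thesis using e by (simp add: inverse_cells_def hom2_def typing normalize)
qed

lemma inverse_lwhisk:
  assumes "inverse_cells C f g \<alpha> \<beta>" "r \<in> Arr C" "Trg C f = Src C r"
  shows "inverse_cells C (r \<cdot> f) (r \<cdot> g) (lwhisk C r \<alpha>) (lwhisk C r \<beta>)"
proof -
  note e = inverse_cellsD[OF assms(1)]
  have "lwhisk C r \<beta> \<bullet> lwhisk C r \<alpha> = CId C (r \<cdot> f)" "lwhisk C r \<alpha> \<bullet> lwhisk C r \<beta> = CId C (r \<cdot> g)"
    by (simp_all add: e assms(2,3) typing unit_assoc flip: lwhisk_VComp)
  then show ?thesis using e assms(2,3) by (simp add: inverse_cells_def hom2_def typing)
qed

lemma equivalenceI:
  assumes "f \<in> Arr C" "Src C f = X" "Trg C f = Y" "g \<in> hom C Y X"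
    "\<eta> \<in> iso_hom2 C (Ident C X) (g \<cdot> f)" "\<epsilon> \<in> iso_hom2 C (f \<cdot> g) (Ident C Y)"
  shows "is_equivalence C f"
  unfolding is_equivalence_def using assms by auto

lemma equivalenceE:
  assumes "is_equivalence C f"
  obtains g \<eta> \<epsilon> where "f \<in> Arr C" "g \<in> Arr C" "Src C g = Trg C f" "Trg C g = Src C f"
    "\<eta> \<in> iso_hom2 C (Ident C (Src C f)) (g \<cdot> f)" "\<epsilon> \<in> iso_hom2 C (f \<cdot> g) (Ident C (Trg C f))"
  using assms by (fastforce simp: is_equivalence_def hom_def)

lemma iso_CId: "f \<in> Arr C \<Longrightarrow> CId C f \<in> iso_hom2 C f f"
  by (auto simp: iso_hom2_def inverse_cells_def hom2_def typing normalize intro!: exI[of _ "CId C f"])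

lemma iso_VComp:
  "\<alpha> \<in> iso_hom2 C f g \<Longrightarrow> \<beta> \<in> iso_hom2 C g h \<Longrightarrow> \<beta> \<bullet> \<alpha> \<in> iso_hom2 C f h"
  unfolding iso_hom2_def using inverse_VComp by blast

lemma iso_lwhisk:
  "\<alpha> \<in> iso_hom2 C f g \<Longrightarrow> r \<in> Arr C \<Longrightarrow> Trg C f = Src C r
    \<Longrightarrow> lwhisk C r \<alpha> \<in> iso_hom2 C (r \<cdot> f) (r \<cdot> g)"
  unfolding iso_hom2_def using inverse_lwhisk by blast

lemma iso_rwhisk:
  "\<alpha> \<in> iso_hom2 C f g \<Longrightarrow> l \<in> Arr C \<Longrightarrow> Trg C l = Src C f
    \<Longrightarrow> rwhisk C \<alpha> l \<in> iso_hom2 C (f \<cdot> l) (g \<cdot> l)"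
  unfolding iso_hom2_def using inverse_rwhisk by blast

lemma equivalence_Ident:
  assumes "X \<in> Obj C"
  shows "is_equivalence C (Ident C X)"
proof -
  have "Ident C X \<in> hom C X X" "Ident C X \<cdot> Ident C X = Ident C X" "Src C (Ident C X) = X" "Trg C (Ident C X) = X"
    using assms by (simp_all add: hom_def typing normalize)
  moreover have "CId C (Ident C X) \<in> iso_hom2 C (Ident C X) (Ident C X)"
    using assms by (simp add: iso_CId typing)
  ultimately show ?thesis by (intro equivalenceI[of _ X X "Ident C X"]) (use assms in \<open>simp_all add: typing\<close>)
qed

lemma equivalence_Comp:
  assumes "is_equivalence C f" "is_equivalence C g" "Trg C f = Src C g"
  shows "is_equivalence C (g \<cdot> f)"
proof -
  obtain f' \<eta> \<epsilon> where f: "f \<in> Arr C" "f' \<in> Arr C" "Src C f' = Trg C f" "Trg C f' = Src C f"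
    "\<eta> \<in> iso_hom2 C (Ident C (Src C f)) (f' \<cdot> f)" "\<epsilon> \<in> iso_hom2 C (f \<cdot> f') (Ident C (Trg C f))"
    using assms(1) by (rule equivalenceE)
  obtain g' \<eta>' \<epsilon>' where g: "g \<in> Arr C" "g' \<in> Arr C" "Src C g' = Trg C g" "Trg C g' = Src C g"
    "\<eta>' \<in> iso_hom2 C (Ident C (Src C g)) (g' \<cdot> g)" "\<epsilon>' \<in> iso_hom2 C (g \<cdot> g') (Ident C (Trg C g))"
    using assms(2) by (rule equivalenceE)
  note s = f(1-4) g(1-4) assms(3) typing normalize
  \<comment> \<open>The quasi-inverse of the composite is \<open>f' \<cdot> g'\<close>. Its unit
    inserts the unit of \<open>g\<close> between \<open>f'\<close> and \<open>f\<close> after the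
    unit of \<open>f\<close>; its counit is built in the dual way.\<close>
  have "lwhisk C f' (rwhisk C \<eta>' f) \<in> iso_hom2 C (f' \<cdot> (Ident C (Src C g) \<cdot> f)) (f' \<cdot> ((g' \<cdot> g) \<cdot> f))"
    by (intro iso_lwhisk iso_rwhisk g) (simp_all add: s)
  then have 1: "lwhisk C f' (rwhisk C \<eta>' f) \<bullet> \<eta> \<in> iso_hom2 C (Ident C (Src C f)) ((f' \<cdot> g') \<cdot> (g \<cdot> f))"
    by (intro iso_VComp[OF f(5)]) (simp add: s)
  have "lwhisk C g (rwhisk C \<epsilon> g') \<in> iso_hom2 C (g \<cdot> ((f \<cdot> f') \<cdot> g')) (g \<cdot> (Ident C (Trg C f) \<cdot> g'))"
    by (intro iso_lwhisk iso_rwhisk f) (simp_all add: s)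
  then have 2: "\<epsilon>' \<bullet> lwhisk C g (rwhisk C \<epsilon> g') \<in> iso_hom2 C ((g \<cdot> f) \<cdot> (f' \<cdot> g')) (Ident C (Trg C g))"
    by (intro iso_VComp[OF _ g(6)]) (simp add: s)
  show ?thesis by (rule equivalenceI[OF _ _ _ _ 1 2]) (simp_all add: hom_def s)
qed

end

section \<open>Images of invertible 2-cells and of equivalences under 2-functors\<close>

context two_functor
begin

lemma F_typing:
  "X \<in> Obj B \<Longrightarrow> FObj F X \<in> Obj D" "f \<in> Arr B \<Longrightarrow> FArr F f \<in> Arr D"
  "\<alpha> \<in> Cell B \<Longrightarrow> FCell F \<alpha> \<in> Cell D"
  "f \<in> Arr B \<Longrightarrow> Src D (FArr F f) = FObj F (Src B f)"
  "f \<in> Arr B \<Longrightarrow> Trg D (FArr F f) = FObj F (Trg B f)"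
  "\<alpha> \<in> Cell B \<Longrightarrow> Dom D (FCell F \<alpha>) = FArr F (Dom B \<alpha>)"
  "\<alpha> \<in> Cell B \<Longrightarrow> Cod D (FCell F \<alpha>) = FArr F (Cod B \<alpha>)"
  using FObj_in FArr_in FCell_in F_Src F_Trg F_Dom F_Cod by auto

lemma F_preserves:
  "X \<in> Obj B \<Longrightarrow> FArr F (Ident B X) = Ident D (FObj F X)"
  "f \<in> Arr B \<Longrightarrow> g \<in> Arr B \<Longrightarrow> Trg B f = Src B g \<Longrightarrow> FArr F (g \<cdot>\<^bsub>B\<^esub> f) = FArr F g \<cdot>\<^bsub>D\<^esub> FArr F f"
  "f \<in> Arr B \<Longrightarrow> FCell F (CId B f) = CId D (FArr F f)"
  "\<alpha> \<in> Cell B \<Longrightarrow> \<beta> \<in> Cell B \<Longrightarrow> Cod B \<alpha> = Dom B \<beta>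
    \<Longrightarrow> FCell F (\<beta> \<bullet>\<^bsub>B\<^esub> \<alpha>) = FCell F \<beta> \<bullet>\<^bsub>D\<^esub> FCell F \<alpha>"
  "\<alpha> \<in> Cell B \<Longrightarrow> \<beta> \<in> Cell B \<Longrightarrow> Trg B (Dom B \<alpha>) = Src B (Dom B \<beta>)
    \<Longrightarrow> FCell F (\<beta> \<star>\<^bsub>B\<^esub> \<alpha>) = FCell F \<beta> \<star>\<^bsub>D\<^esub> FCell F \<alpha>"
  using F_Ident F_Comp[of f "Src B f" "Trg B f" g "Trg B g"] F_CId
    F_VComp[of \<alpha> "Dom B \<alpha>" "Cod B \<alpha>" \<beta> "Cod B \<beta>"]
    F_HComp[of \<alpha> "Dom B \<alpha>" "Cod B \<alpha>" \<beta> "Dom B \<beta>" "Cod B \<beta>"]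
  by (simp_all add: hom_def hom2_def)

lemma iso_image:
  assumes "\<alpha> \<in> iso_hom2 B f g"
  shows "FCell F \<alpha> \<in> iso_hom2 D (FArr F f) (FArr F g)"
proof -
  obtain \<beta> where b: "inverse_cells B f g \<alpha> \<beta>" using assms by (auto simp: iso_hom2_def)
  note e = B.inverse_cellsD[OF b]
  have "inverse_cells D (FArr F f) (FArr F g) (FCell F \<alpha>) (FCell F \<beta>)"
    using F_preserves(4)[of \<alpha> \<beta>] F_preserves(4)[of \<beta> \<alpha>]
    by (simp add: inverse_cells_def hom2_def F_typing F_preserves(3) e)
  then show ?thesis by (auto simp: iso_hom2_def)
qed

lemma equivalence_image:
  assumes "is_equivalence B f"
  shows "is_equivalence D (FArr F f)"
proof -
  obtain g \<eta> \<epsilon> where f: "f \<in> Arr B" "g \<in> Arr B" "Src B g = Trg B f" "Trg B g = Src B f"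
    "\<eta> \<in> iso_hom2 B (Ident B (Src B f)) (g \<cdot>\<^bsub>B\<^esub> f)" "\<epsilon> \<in> iso_hom2 B (f \<cdot>\<^bsub>B\<^esub> g) (Ident B (Trg B f))"
    using assms by (rule B.equivalenceE)
  have "FCell F \<eta> \<in> iso_hom2 D (Ident D (FObj F (Src B f))) (FArr F g \<cdot>\<^bsub>D\<^esub> FArr F f)"
    "FCell F \<epsilon> \<in> iso_hom2 D (FArr F f \<cdot>\<^bsub>D\<^esub> FArr F g) (Ident D (FObj F (Trg B f)))"
    using iso_image[OF f(5)] iso_image[OF f(6)] f(1-4) by (simp_all add: F_preserves B.typing)
  then show ?thesis by (rule D.equivalenceI[rotated 4]) (use f(1-4) in \<open>simp_all add: F_typing hom_def\<close>)
qed

end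

section \<open>The 2-category of pseudonatural transformations and modifications\<close>

context two_category
begin

text \<open>Normal forms are right-nested, so an equation between two composites does not match when
  a further 2-cell \<gamma> is composed below. This lemma applies the equation at the top of such a
  longer composite.\<close>

lemma VComp_eq_comp:
  assumes "\<beta> \<bullet> \<alpha> = \<beta>' \<bullet> \<alpha>'" "\<alpha> \<in> Cell C" "\<beta> \<in> Cell C" "\<alpha>' \<in> Cell C" "\<beta>' \<in> Cell C" "\<gamma> \<in> Cell C"
    "Cod C \<alpha> = Dom C \<beta>" "Cod C \<alpha>' = Dom C \<beta>'" "Cod C \<gamma> = Dom C \<alpha>" "Cod C \<gamma> = Dom C \<alpha>'"
  shows "\<beta> \<bullet> (\<alpha> \<bullet> \<gamma>) = \<beta>' \<bullet> (\<alpha>' \<bullet> \<gamma>)"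
  using assms normalize(6)[of \<gamma> \<alpha> \<beta>] normalize(6)[of \<gamma> \<alpha>' \<beta>'] by simp

lemma slide_comp:
  assumes "\<alpha> \<in> Cell C" "\<beta> \<in> Cell C" "Trg C (Dom C \<alpha>) = Src C (Dom C \<beta>)"
    "Dom C \<alpha> = a" "Cod C \<alpha> = a'" "Dom C \<beta> = b" "Cod C \<beta> = b'" "\<gamma> \<in> Cell C" "Cod C \<gamma> = b \<cdot> a"
  shows "rwhisk C \<beta> a' \<bullet> (lwhisk C b \<alpha> \<bullet> \<gamma>) = lwhisk C b' \<alpha> \<bullet> (rwhisk C \<beta> a \<bullet> \<gamma>)"
proof (rule VComp_eq_comp[OF slide[OF assms(1-7)]])
qed (use assms(1-3,8,9) in \<open>auto simp: typing simp flip: assms(4-7)\<close>)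

end

lemma tfun_eqI:
  assumes "two_functor B D F" "two_functor B D G" "\<And>X. X \<in> Obj B \<Longrightarrow> FObj F X = FObj G X"
    "\<And>f. f \<in> Arr B \<Longrightarrow> FArr F f = FArr G f" "\<And>\<alpha>. \<alpha> \<in> Cell B \<Longrightarrow> FCell F \<alpha> = FCell G \<alpha>"
  shows "F = G"
proof -
  interpret F: two_functor B D F by fact
  interpret G: two_functor B D G by fact
  show ?thesis
    by (rule tfun.equality)
      (auto intro!: PiE_ext[OF F.FObj_in G.FObj_in] PiE_ext[OF F.FArr_in G.FArr_in]
        PiE_ext[OF F.FCell_in G.FCell_in] assms)
qed

context pseudonatural
begin

lemma P_typing:
  "X \<in> Obj B \<Longrightarrow> PObj \<theta> X \<in> Arr D"
  "X \<in> Obj B \<Longrightarrow> Src D (PObj \<theta> X) = FObj (PSrc \<theta>) X"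
  "X \<in> Obj B \<Longrightarrow> Trg D (PObj \<theta> X) = FObj (PTrg \<theta>) X"
  "f \<in> Arr B \<Longrightarrow> PArr \<theta> f \<in> Cell D"
  "f \<in> Arr B \<Longrightarrow> Dom D (PArr \<theta> f) = FArr (PTrg \<theta>) f \<cdot>\<^bsub>D\<^esub> PObj \<theta> (Src B f)"
  "f \<in> Arr B \<Longrightarrow> Cod D (PArr \<theta> f) = PObj \<theta> (Trg B f) \<cdot>\<^bsub>D\<^esub> FArr (PSrc \<theta>) f"
  using PObj_in[of X] PArr_in[of f "Src B f" "Trg B f"]
  by (auto simp: hom_def iso_hom2_def inverse_cells_def hom2_def)

lemma P_Comp:
  "f \<in> Arr B \<Longrightarrow> g \<in> Arr B \<Longrightarrow> Trg B f = Src B g \<Longrightarrow> PArr \<theta> (g \<cdot>\<^bsub>B\<^esub> f) =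
    rwhisk D (PArr \<theta> g) (FArr (PSrc \<theta>) f) \<bullet>\<^bsub>D\<^esub> lwhisk D (FArr (PTrg \<theta>) g) (PArr \<theta> f)"
  using PArr_Comp[of f "Src B f" "Trg B f" g "Trg B g"] by (simp add: hom_def)

lemma P_natural:
  "\<alpha> \<in> Cell B \<Longrightarrow> PArr \<theta> (Cod B \<alpha>) \<bullet>\<^bsub>D\<^esub> rwhisk D (FCell (PTrg \<theta>) \<alpha>) (PObj \<theta> (Src B (Dom B \<alpha>))) =
    lwhisk D (PObj \<theta> (Trg B (Dom B \<alpha>))) (FCell (PSrc \<theta>) \<alpha>) \<bullet>\<^bsub>D\<^esub> PArr \<theta> (Dom B \<alpha>)"
  using PArr_natural[of "Dom B \<alpha>" "Src B (Dom B \<alpha>)" "Trg B (Dom B \<alpha>)" \<alpha> "Cod B \<alpha>"]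
  by (simp add: hom_def hom2_def F.B.typing)

end

lemma pnt_eqI:
  assumes "pseudonatural B D \<theta>" "pseudonatural B D \<eta>" "PSrc \<theta> = PSrc \<eta>" "PTrg \<theta> = PTrg \<eta>"
    "\<And>X. X \<in> Obj B \<Longrightarrow> PObj \<theta> X = PObj \<eta> X" "\<And>f. f \<in> Arr B \<Longrightarrow> PArr \<theta> f = PArr \<eta> f"
  shows "\<theta> = \<eta>"
proof -
  interpret \<theta>: pseudonatural B D \<theta> by fact
  interpret \<eta>: pseudonatural B D \<eta> by fact
  show ?thesis
    by (rule pnt.equality)
      (auto intro!: extensionalityI[OF \<theta>.PObj_ext \<eta>.PObj_ext] extensionalityI[OF \<theta>.PArr_ext \<eta>.PArr_ext] assms)
qed

context modification
begin

lemma M_typing: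
  "X \<in> Obj B \<Longrightarrow> MObj \<rho> X \<in> Cell D"
  "X \<in> Obj B \<Longrightarrow> Dom D (MObj \<rho> X) = PObj (MSrc \<rho>) X"
  "X \<in> Obj B \<Longrightarrow> Cod D (MObj \<rho> X) = PObj (MTrg \<rho>) X"
  using MObj_in[of X] by (auto simp: hom2_def)

lemma M_natural:
  "f \<in> Arr B \<Longrightarrow> rwhisk D (MObj \<rho> (Trg B f)) (FArr (PSrc (MSrc \<rho>)) f) \<bullet>\<^bsub>D\<^esub> PArr (MSrc \<rho>) f =
    PArr (MTrg \<rho>) f \<bullet>\<^bsub>D\<^esub> lwhisk D (FArr (PTrg (MSrc \<rho>)) f) (MObj \<rho> (Src B f))"
  using MObj_natural[of f "Src B f" "Trg B f"] by (simp add: hom_def)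

end

lemma modif_eqI:
  assumes "modification B D \<rho>" "modification B D \<sigma>" "MSrc \<rho> = MSrc \<sigma>" "MTrg \<rho> = MTrg \<sigma>"
    "\<And>X. X \<in> Obj B \<Longrightarrow> MObj \<rho> X = MObj \<sigma> X"
  shows "\<rho> = \<sigma>"
proof -
  interpret \<rho>: modification B D \<rho> by fact
  interpret \<sigma>: modification B D \<sigma> by fact
  show ?thesis
    by (rule modif.equality) (auto intro!: extensionalityI[OF \<rho>.MObj_ext \<sigma>.MObj_ext] assms)
qed

section \<open>Identities and composites of transformations and modifications\<close>

context two_functor
begin

lemma pseudonatural_id: "pseudonatural B D (id_pnt B D F)"
proof -
  have "pseudonatural_axioms B D (id_pnt B D F)"
    by unfold_locales
      (auto simp: id_pnt_def hom_def hom2_def F_typing F_preserves D.typing D.normalize B.typing intro!: D.iso_CId)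
  then show ?thesis
    using two_functor_axioms by (simp add: pseudonatural_def id_pnt_def)
qed

end

lemma pseudonatural_comp:
  assumes "pseudonatural B D \<theta>" "pseudonatural B D \<eta>" "PTrg \<theta> = PSrc \<eta>"
  shows "pseudonatural B D (comp_pnt B D \<eta> \<theta>)"
proof -
  interpret \<theta>: pseudonatural B D \<theta> by fact
  interpret \<eta>: pseudonatural B D \<eta> by fact
  note t = \<theta>.F.D.typing \<theta>.F.F_typing \<theta>.P_typing \<eta>.F.F_typing \<eta>.G.F_typing \<eta>.P_typing assms(3) \<theta>.F.B.typing
  note n = t \<theta>.F.D.normalize \<theta>.F.F_preserves \<theta>.G.F_preserves \<eta>.G.F_preserves
  have 1: "PArr (comp_pnt B D \<eta> \<theta>) f \<in> iso_hom2 D (FArr (PTrg \<eta>) f \<cdot>\<^bsub>D\<^esub> (PObj \<eta> X \<cdot>\<^bsub>D\<^esub> PObj \<theta> X))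
      ((PObj \<eta> Y \<cdot>\<^bsub>D\<^esub> PObj \<theta> Y) \<cdot>\<^bsub>D\<^esub> FArr (PSrc \<theta>) f)" if f: "f \<in> hom B X Y" for f X Y
  proof -
    have e: "f \<in> Arr B" "Src B f = X" "Trg B f = Y" "X \<in> Obj B" "Y \<in> Obj B"
      using f \<theta>.F.B.typing by (auto simp: hom_def)
    have "lwhisk D (PObj \<eta> Y) (PArr \<theta> f) \<in> iso_hom2 D (PObj \<eta> Y \<cdot>\<^bsub>D\<^esub> (FArr (PSrc \<eta>) f \<cdot>\<^bsub>D\<^esub> PObj \<theta> X))
       (PObj \<eta> Y \<cdot>\<^bsub>D\<^esub> (PObj \<theta> Y \<cdot>\<^bsub>D\<^esub> FArr (PSrc \<theta>) f))"
      by (rule \<theta>.F.D.iso_lwhisk[OF \<theta>.PArr_in[OF f, unfolded assms(3)]]) (simp_all add: e t)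
    moreover have "rwhisk D (PArr \<eta> f) (PObj \<theta> X) \<in> iso_hom2 D ((FArr (PTrg \<eta>) f \<cdot>\<^bsub>D\<^esub> PObj \<eta> X) \<cdot>\<^bsub>D\<^esub> PObj \<theta> X)
       ((PObj \<eta> Y \<cdot>\<^bsub>D\<^esub> FArr (PSrc \<eta>) f) \<cdot>\<^bsub>D\<^esub> PObj \<theta> X)"
      by (rule \<theta>.F.D.iso_rwhisk[OF \<eta>.PArr_in[OF f]]) (simp_all add: e t)
    then have "rwhisk D (PArr \<eta> f) (PObj \<theta> X) \<in> iso_hom2 D (FArr (PTrg \<eta>) f \<cdot>\<^bsub>D\<^esub> (PObj \<eta> X \<cdot>\<^bsub>D\<^esub> PObj \<theta> X))
       (PObj \<eta> Y \<cdot>\<^bsub>D\<^esub> (FArr (PSrc \<eta>) f \<cdot>\<^bsub>D\<^esub> PObj \<theta> X))"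
      by (simp add: e n)
    ultimately have "lwhisk D (PObj \<eta> Y) (PArr \<theta> f) \<bullet>\<^bsub>D\<^esub> rwhisk D (PArr \<eta> f) (PObj \<theta> X)
      \<in> iso_hom2 D (FArr (PTrg \<eta>) f \<cdot>\<^bsub>D\<^esub> (PObj \<eta> X \<cdot>\<^bsub>D\<^esub> PObj \<theta> X))
       (PObj \<eta> Y \<cdot>\<^bsub>D\<^esub> (PObj \<theta> Y \<cdot>\<^bsub>D\<^esub> FArr (PSrc \<theta>) f))"
      using \<theta>.F.D.iso_VComp by blast
    then show ?thesis by (simp add: e n comp_pnt_def)
  qed
  have "pseudonatural_axioms B D (comp_pnt B D \<eta> \<theta>)"
  proof (unfold_locales, goal_cases)
    case 1 show ?case by (simp add: comp_pnt_def)
  next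
    case 2 show ?case by (simp add: comp_pnt_def)
  next
    case (3 X) then show ?case by (simp add: comp_pnt_def hom_def t)
  next
    case (4 f X Y)
    then show ?case using 1[OF 4] \<theta>.F.B.typing(1,2)[of f] by (auto simp: comp_pnt_def hom_def)
  next
    case (5 X) then show ?case by (simp add: comp_pnt_def n \<theta>.PArr_Ident \<eta>.PArr_Ident)
  next
    case (6 f X Y g Z)
    then have e: "f \<in> Arr B" "g \<in> Arr B" "Src B f = X" "Trg B f = Y" "Src B g = Y" "Trg B g = Z"
      "X \<in> Obj B" "Y \<in> Obj B" "Z \<in> Obj B"
      using \<theta>.F.B.typing(1,2)[of f] \<theta>.F.B.typing(1,2)[of g] by (auto simp: hom_def)
    \<comment> \<open>After distributing the whiskerings, the two sides differ only in the order of
      the structure 2-cell of \<theta> at \<open>f\<close> and that of \<eta> at \<open>g\<close>.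
      These are whiskered on opposite sides and slide past each other.\<close>
    show ?case
      using \<theta>.F.D.slide_comp[of "PArr \<theta> f" "PArr \<eta> g" "FArr (PTrg \<theta>) f \<cdot>\<^bsub>D\<^esub> PObj \<theta> X"
          "PObj \<theta> Y \<cdot>\<^bsub>D\<^esub> FArr (PSrc \<theta>) f" "FArr (PTrg \<eta>) g \<cdot>\<^bsub>D\<^esub> PObj \<eta> Y"
          "PObj \<eta> Z \<cdot>\<^bsub>D\<^esub> FArr (PSrc \<eta>) g" "lwhisk D (FArr (PTrg \<eta>) g) (rwhisk D (PArr \<eta> f) (PObj \<theta> X))"]
      by (simp add: comp_pnt_def n e \<theta>.P_Comp \<eta>.P_Comp)
  next
    case (7 f X Y \<alpha> g)
    then have e: "\<alpha> \<in> Cell B" "Dom B \<alpha> = f" "Cod B \<alpha> = g" "f \<in> Arr B" "g \<in> Arr B" "Src B f = X" "Trg B f = Y"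
      "X \<in> Obj B" "Y \<in> Obj B" "Src B g = X" "Trg B g = Y"
      using \<theta>.F.B.typing(1,2)[of f] \<theta>.F.B.hom2D[of \<alpha> f g] by (auto simp: hom_def)
    \<comment> \<open>The naturality square of \<eta> is whiskered with \<theta> at
      \<open>X\<close>, giving \<open>a\<close>, and that of \<theta> with \<eta> at
      \<open>Y\<close>, giving \<open>b\<close>. The two share the image of \<alpha> under the
      middle 2-functor and are pasted along it.\<close>
    have "PArr \<eta> g \<bullet>\<^bsub>D\<^esub> rwhisk D (FCell (PTrg \<eta>) \<alpha>) (PObj \<eta> X) =
        lwhisk D (PObj \<eta> Y) (FCell (PSrc \<eta>) \<alpha>) \<bullet>\<^bsub>D\<^esub> PArr \<eta> f"
      using \<eta>.P_natural[OF e(1)] e by simp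
    then have "rwhisk D (PArr \<eta> g \<bullet>\<^bsub>D\<^esub> rwhisk D (FCell (PTrg \<eta>) \<alpha>) (PObj \<eta> X)) (PObj \<theta> X) =
        rwhisk D (lwhisk D (PObj \<eta> Y) (FCell (PSrc \<eta>) \<alpha>) \<bullet>\<^bsub>D\<^esub> PArr \<eta> f) (PObj \<theta> X)"
      by simp
    then have a: "rwhisk D (PArr \<eta> g) (PObj \<theta> X) \<bullet>\<^bsub>D\<^esub> rwhisk D (FCell (PTrg \<eta>) \<alpha>) (PObj \<eta> X \<cdot>\<^bsub>D\<^esub> PObj \<theta> X) =
        lwhisk D (PObj \<eta> Y) (rwhisk D (FCell (PSrc \<eta>) \<alpha>) (PObj \<theta> X)) \<bullet>\<^bsub>D\<^esub> rwhisk D (PArr \<eta> f) (PObj \<theta> X)"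
      by (simp add: n e)
    have "PArr \<theta> g \<bullet>\<^bsub>D\<^esub> rwhisk D (FCell (PSrc \<eta>) \<alpha>) (PObj \<theta> X) =
        lwhisk D (PObj \<theta> Y) (FCell (PSrc \<theta>) \<alpha>) \<bullet>\<^bsub>D\<^esub> PArr \<theta> f"
      using \<theta>.P_natural[OF e(1)] e assms(3) by simp
    then have "lwhisk D (PObj \<eta> Y) (PArr \<theta> g \<bullet>\<^bsub>D\<^esub> rwhisk D (FCell (PSrc \<eta>) \<alpha>) (PObj \<theta> X)) =
        lwhisk D (PObj \<eta> Y) (lwhisk D (PObj \<theta> Y) (FCell (PSrc \<theta>) \<alpha>) \<bullet>\<^bsub>D\<^esub> PArr \<theta> f)"
      by simp
    then have b: "lwhisk D (PObj \<eta> Y) (PArr \<theta> g) \<bullet>\<^bsub>D\<^esub> lwhisk D (PObj \<eta> Y) (rwhisk D (FCell (PSrc \<eta>) \<alpha>) (PObj \<theta> X)) =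
        lwhisk D (PObj \<eta> Y) (lwhisk D (PObj \<theta> Y) (FCell (PSrc \<theta>) \<alpha>)) \<bullet>\<^bsub>D\<^esub> lwhisk D (PObj \<eta> Y) (PArr \<theta> f)"
      by (simp add: n e)
    show ?case
      using \<theta>.F.D.VComp_eq_comp[OF b, of "rwhisk D (PArr \<eta> f) (PObj \<theta> X)"]
      by (simp add: comp_pnt_def n e a)
  qed
  then show ?thesis
    using \<theta>.F.two_functor_axioms \<eta>.G.two_functor_axioms by (simp add: pseudonatural_def comp_pnt_def)
qed

lemma Hom_p_simps [simp]:
  "Obj (Hom_p B D) = {F. two_functor B D F}" "Arr (Hom_p B D) = {\<theta>. pseudonatural B D \<theta>}"
  "Src (Hom_p B D) = PSrc" "Trg (Hom_p B D) = PTrg"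
  "Ident (Hom_p B D) = id_pnt B D" "Comp (Hom_p B D) = comp_pnt B D"
  "Cell (Hom_p B D) = {\<rho>. modification B D \<rho>}" "Dom (Hom_p B D) = MSrc" "Cod (Hom_p B D) = MTrg"
  "MSrc (CId (Hom_p B D) \<theta>) = \<theta>" "MTrg (CId (Hom_p B D) \<theta>) = \<theta>"
  "MSrc (\<sigma> \<bullet>\<^bsub>Hom_p B D\<^esub> \<rho>) = MSrc \<rho>" "MTrg (\<sigma> \<bullet>\<^bsub>Hom_p B D\<^esub> \<rho>) = MTrg \<sigma>"
  "MSrc (\<sigma> \<star>\<^bsub>Hom_p B D\<^esub> \<rho>) = comp_pnt B D (MSrc \<sigma>) (MSrc \<rho>)"
  "MTrg (\<sigma> \<star>\<^bsub>Hom_p B D\<^esub> \<rho>) = comp_pnt B D (MTrg \<sigma>) (MTrg \<rho>)"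
  "X \<in> Obj B \<Longrightarrow> MObj (CId (Hom_p B D) \<theta>) X = CId D (PObj \<theta> X)"
  "X \<in> Obj B \<Longrightarrow> MObj (\<sigma> \<bullet>\<^bsub>Hom_p B D\<^esub> \<rho>) X = MObj \<sigma> X \<bullet>\<^bsub>D\<^esub> MObj \<rho> X"
  "X \<in> Obj B \<Longrightarrow> MObj (\<sigma> \<star>\<^bsub>Hom_p B D\<^esub> \<rho>) X = MObj \<sigma> X \<star>\<^bsub>D\<^esub> MObj \<rho> X"
  "MObj (CId (Hom_p B D) \<theta>) \<in> extensional (Obj B)"
  "MObj (\<sigma> \<bullet>\<^bsub>Hom_p B D\<^esub> \<rho>) \<in> extensional (Obj B)"
  "MObj (\<sigma> \<star>\<^bsub>Hom_p B D\<^esub> \<rho>) \<in> extensional (Obj B)"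
  by (simp_all add: Hom_p_def)

lemma pnt_simps [simp]:
  "PSrc (id_pnt B D F) = F" "PTrg (id_pnt B D F) = F"
  "PSrc (comp_pnt B D \<eta> \<theta>) = PSrc \<theta>" "PTrg (comp_pnt B D \<eta> \<theta>) = PTrg \<eta>"
  "X \<in> Obj B \<Longrightarrow> PObj (id_pnt B D F) X = Ident D (FObj F X)"
  "X \<in> Obj B \<Longrightarrow> PObj (comp_pnt B D \<eta> \<theta>) X = PObj \<eta> X \<cdot>\<^bsub>D\<^esub> PObj \<theta> X"
  "f \<in> Arr B \<Longrightarrow> PArr (id_pnt B D F) f = CId D (FArr F f)"
  "f \<in> Arr B \<Longrightarrow> PArr (comp_pnt B D \<eta> \<theta>) f =
    lwhisk D (PObj \<eta> (Trg B f)) (PArr \<theta> f) \<bullet>\<^bsub>D\<^esub> rwhisk D (PArr \<eta> f) (PObj \<theta> (Src B f))"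
  by (simp_all add: id_pnt_def comp_pnt_def)

lemma comp_pnt_id:
  assumes "pseudonatural B D \<theta>"
  shows "comp_pnt B D (id_pnt B D (PTrg \<theta>)) \<theta> = \<theta>" "comp_pnt B D \<theta> (id_pnt B D (PSrc \<theta>)) = \<theta>"
proof -
  interpret f: pseudonatural B D \<theta> by fact
  note t = f.F.F_typing f.G.F_typing f.P_typing f.F.B.typing f.F.D.typing f.F.D.normalize
  show "comp_pnt B D (id_pnt B D (PTrg \<theta>)) \<theta> = \<theta>"
    by (rule pnt_eqI[where B = B and D = D])
      (auto simp: t assms intro!: pseudonatural_comp f.G.pseudonatural_id)
  show "comp_pnt B D \<theta> (id_pnt B D (PSrc \<theta>)) = \<theta>"
    by (rule pnt_eqI[where B = B and D = D])
      (auto simp: t assms intro!: pseudonatural_comp f.F.pseudonatural_id)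
qed

lemma comp_pnt_assoc:
  assumes "pseudonatural B D f" "pseudonatural B D g" "pseudonatural B D h" "PTrg f = PSrc g" "PTrg g = PSrc h"
  shows "comp_pnt B D (comp_pnt B D h g) f = comp_pnt B D h (comp_pnt B D g f)"
proof -
  interpret f: pseudonatural B D f by fact
  interpret g: pseudonatural B D g by fact
  interpret h: pseudonatural B D h by fact
  note t = f.F.F_typing g.F.F_typing h.F.F_typing f.G.F_typing g.G.F_typing h.G.F_typing f.P_typing g.P_typing
    h.P_typing f.F.B.typing f.F.D.typing f.F.D.normalize
  show ?thesis
    by (rule pnt_eqI[where B = B and D = D]) (use assms in \<open>auto simp: t intro!: pseudonatural_comp\<close>)
qed

lemma modificationI:
  assumes "pseudonatural B D (MSrc \<rho>)" "pseudonatural B D (MTrg \<rho>)"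
    "PSrc (MTrg \<rho>) = PSrc (MSrc \<rho>)" "PTrg (MTrg \<rho>) = PTrg (MSrc \<rho>)" "MObj \<rho> \<in> extensional (Obj B)"
    "\<And>X. X \<in> Obj B \<Longrightarrow> MObj \<rho> X \<in> hom2 D (PObj (MSrc \<rho>) X) (PObj (MTrg \<rho>) X)"
    "\<And>f. f \<in> Arr B \<Longrightarrow> rwhisk D (MObj \<rho> (Trg B f)) (FArr (PSrc (MSrc \<rho>)) f) \<bullet>\<^bsub>D\<^esub> PArr (MSrc \<rho>) f =
      PArr (MTrg \<rho>) f \<bullet>\<^bsub>D\<^esub> lwhisk D (FArr (PTrg (MSrc \<rho>)) f) (MObj \<rho> (Src B f))"
  shows "modification B D \<rho>"
  using assms by (auto simp: modification_def modification_axioms_def hom_def)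

lemma modification_CId:
  assumes "pseudonatural B D \<theta>"
  shows "modification B D (CId (Hom_p B D) \<theta>)"
proof -
  interpret \<theta>: pseudonatural B D \<theta> by fact
  note n = \<theta>.F.B.typing \<theta>.F.D.typing \<theta>.F.F_typing \<theta>.G.F_typing \<theta>.P_typing \<theta>.F.D.normalize
  show ?thesis
    by (rule modificationI) (simp_all add: assms hom2_def n)
qed

lemma modification_VComp:
  assumes "modification B D \<rho>" "modification B D \<sigma>" "MTrg \<rho> = MSrc \<sigma>"
  shows "modification B D (\<sigma> \<bullet>\<^bsub>Hom_p B D\<^esub> \<rho>)"
proof -
  interpret \<rho>: modification B D \<rho> by fact
  interpret \<sigma>: modification B D \<sigma> by fact
  note s = \<rho>.same_PSrc[unfolded assms(3)] \<rho>.same_PTrg[unfolded assms(3)] \<sigma>.same_PSrc \<sigma>.same_PTrg assms(3)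
  note t = \<rho>.S.F.B.typing \<rho>.S.F.D.typing \<rho>.S.F.F_typing \<rho>.S.G.F_typing \<rho>.S.P_typing \<rho>.T.P_typing
    \<rho>.M_typing \<sigma>.M_typing \<sigma>.S.P_typing \<sigma>.T.P_typing s
  note n = t \<rho>.S.F.D.normalize
  show ?thesis
  proof (rule modificationI)
    fix f assume f: "f \<in> Arr B"
    have "rwhisk D (MObj \<rho> (Trg B f)) (FArr (PSrc (MSrc \<rho>)) f) \<bullet>\<^bsub>D\<^esub> PArr (MSrc \<rho>) f =
      PArr (MSrc \<sigma>) f \<bullet>\<^bsub>D\<^esub> lwhisk D (FArr (PTrg (MSrc \<rho>)) f) (MObj \<rho> (Src B f))"
      using \<rho>.M_natural[OF f] by (simp add: s)
    moreover have "rwhisk D (MObj \<sigma> (Trg B f)) (FArr (PSrc (MSrc \<rho>)) f) \<bullet>\<^bsub>D\<^esub>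
        (PArr (MSrc \<sigma>) f \<bullet>\<^bsub>D\<^esub> lwhisk D (FArr (PTrg (MSrc \<rho>)) f) (MObj \<rho> (Src B f))) =
      PArr (MTrg \<sigma>) f \<bullet>\<^bsub>D\<^esub> (lwhisk D (FArr (PTrg (MSrc \<rho>)) f) (MObj \<sigma> (Src B f)) \<bullet>\<^bsub>D\<^esub>
        lwhisk D (FArr (PTrg (MSrc \<rho>)) f) (MObj \<rho> (Src B f)))"
      by (rule \<rho>.S.F.D.VComp_eq_comp[OF \<sigma>.M_natural[OF f, unfolded s]]) (simp_all add: t f)
    ultimately show "rwhisk D (MObj (\<sigma> \<bullet>\<^bsub>Hom_p B D\<^esub> \<rho>) (Trg B f)) (FArr (PSrc (MSrc (\<sigma> \<bullet>\<^bsub>Hom_p B D\<^esub> \<rho>))) f)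
        \<bullet>\<^bsub>D\<^esub> PArr (MSrc (\<sigma> \<bullet>\<^bsub>Hom_p B D\<^esub> \<rho>)) f =
      PArr (MTrg (\<sigma> \<bullet>\<^bsub>Hom_p B D\<^esub> \<rho>)) f \<bullet>\<^bsub>D\<^esub> lwhisk D (FArr (PTrg (MSrc (\<sigma> \<bullet>\<^bsub>Hom_p B D\<^esub> \<rho>))) f)
        (MObj (\<sigma> \<bullet>\<^bsub>Hom_p B D\<^esub> \<rho>) (Src B f))"
      by (simp add: n f)
  qed (simp_all add: t \<rho>.S.pseudonatural_axioms \<sigma>.T.pseudonatural_axioms hom2_def)
qed

text \<open>The two components are pushed through the composite structure 2-cell one at a time. In
  the proof, \<open>1\<close> and \<open>4\<close> are the whiskered naturality squares of \<rho>
  and \<sigma>, while \<open>2\<close> and \<open>3\<close> slide a component of one modification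
  past a structure 2-cell of the other level. The decomposition \<open>HComp_left_right\<close> is
  used at both ends.\<close>

lemma modification_HComp:
  assumes "modification B D \<rho>" "modification B D \<sigma>" "PTrg (MSrc \<rho>) = PSrc (MSrc \<sigma>)"
  shows "modification B D (\<sigma> \<star>\<^bsub>Hom_p B D\<^esub> \<rho>)"
proof -
  interpret \<rho>: modification B D \<rho> by fact
  interpret \<sigma>: modification B D \<sigma> by fact
  note s = \<rho>.same_PSrc \<rho>.same_PTrg \<sigma>.same_PSrc \<sigma>.same_PTrg assms(3)
  note t = \<rho>.S.F.B.typing \<rho>.S.F.D.typing \<rho>.S.F.F_typing \<sigma>.S.F.F_typing \<sigma>.S.G.F_typing
    \<rho>.S.P_typing \<rho>.T.P_typing \<rho>.M_typing \<sigma>.M_typing \<sigma>.S.P_typing \<sigma>.T.P_typing s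
  note n = t \<rho>.S.F.D.normalize
  let ?\<theta> = "MSrc \<rho>" and ?\<theta>' = "MTrg \<rho>" and ?\<eta> = "MSrc \<sigma>" and ?\<eta>' = "MTrg \<sigma>"
  let ?F = "FArr (PSrc (MSrc \<rho>))" and ?G = "FArr (PSrc (MSrc \<sigma>))" and ?H = "FArr (PTrg (MSrc \<sigma>))"
  show ?thesis
  proof (rule modificationI)
    fix f assume f: "f \<in> Arr B"
    define X Y where X: "X = Src B f" and Y: "Y = Trg B f"
    have XY: "X \<in> Obj B" "Y \<in> Obj B" using f by (simp_all add: X Y t)
    note e = f XY X[symmetric] Y[symmetric]
    have "lwhisk D (PObj ?\<eta> Y) (rwhisk D (MObj \<rho> Y) (?F f) \<bullet>\<^bsub>D\<^esub> PArr ?\<theta> f) =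
      lwhisk D (PObj ?\<eta> Y) (PArr ?\<theta>' f \<bullet>\<^bsub>D\<^esub> lwhisk D (?G f) (MObj \<rho> X))"
      using \<rho>.M_natural[OF f] by (simp add: e s)
    then have "lwhisk D (PObj ?\<eta> Y) (rwhisk D (MObj \<rho> Y) (?F f)) \<bullet>\<^bsub>D\<^esub> lwhisk D (PObj ?\<eta> Y) (PArr ?\<theta> f) =
      lwhisk D (PObj ?\<eta> Y) (PArr ?\<theta>' f) \<bullet>\<^bsub>D\<^esub> lwhisk D (PObj ?\<eta> Y) (lwhisk D (?G f) (MObj \<rho> X))"
      by (simp add: n e)
    note 1 = \<rho>.S.F.D.VComp_eq_comp[OF this, of "rwhisk D (PArr ?\<eta> f) (PObj ?\<theta> X)"]
    note 2 = \<rho>.S.F.D.slide[of "MObj \<rho> X" "PArr ?\<eta> f" "PObj ?\<theta> X" "PObj ?\<theta>' X" "?H f \<cdot>\<^bsub>D\<^esub> PObj ?\<eta> X" "PObj ?\<eta> Y \<cdot>\<^bsub>D\<^esub> ?G f"]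
    let ?g = "rwhisk D (PArr ?\<eta> f) (PObj ?\<theta>' X) \<bullet>\<^bsub>D\<^esub> lwhisk D (?H f) (lwhisk D (PObj ?\<eta> X) (MObj \<rho> X))"
    note 3 = \<rho>.S.F.D.slide_comp[of "PArr ?\<theta>' f" "MObj \<sigma> Y" "?G f \<cdot>\<^bsub>D\<^esub> PObj ?\<theta>' X" "PObj ?\<theta>' Y \<cdot>\<^bsub>D\<^esub> ?F f" "PObj ?\<eta> Y" "PObj ?\<eta>' Y" ?g]
    have "rwhisk D (rwhisk D (MObj \<sigma> Y) (?G f) \<bullet>\<^bsub>D\<^esub> PArr ?\<eta> f) (PObj ?\<theta>' X) =
      rwhisk D (PArr ?\<eta>' f \<bullet>\<^bsub>D\<^esub> lwhisk D (?H f) (MObj \<sigma> X)) (PObj ?\<theta>' X)"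
      using \<sigma>.M_natural[OF f] by (simp add: e s)
    then have "rwhisk D (MObj \<sigma> Y) (?G f \<cdot>\<^bsub>D\<^esub> PObj ?\<theta>' X) \<bullet>\<^bsub>D\<^esub> rwhisk D (PArr ?\<eta> f) (PObj ?\<theta>' X) =
      rwhisk D (PArr ?\<eta>' f) (PObj ?\<theta>' X) \<bullet>\<^bsub>D\<^esub> lwhisk D (?H f) (rwhisk D (MObj \<sigma> X) (PObj ?\<theta>' X))"
      by (simp add: n e)
    note 4 = \<rho>.S.F.D.VComp_eq_comp[OF this, of "lwhisk D (?H f) (lwhisk D (PObj ?\<eta> X) (MObj \<rho> X))"]
    note d = \<rho>.S.F.D.HComp_left_right[of "MObj \<rho> X" "MObj \<sigma> X"] \<rho>.S.F.D.HComp_left_right[of "MObj \<rho> Y" "MObj \<sigma> Y"]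
    have "rwhisk D (MObj \<sigma> Y \<star>\<^bsub>D\<^esub> MObj \<rho> Y) (?F f) \<bullet>\<^bsub>D\<^esub>
        (lwhisk D (PObj ?\<eta> Y) (PArr ?\<theta> f) \<bullet>\<^bsub>D\<^esub> rwhisk D (PArr ?\<eta> f) (PObj ?\<theta> X)) =
      rwhisk D (MObj \<sigma> Y) (PObj ?\<theta>' Y \<cdot>\<^bsub>D\<^esub> ?F f) \<bullet>\<^bsub>D\<^esub> (lwhisk D (PObj ?\<eta> Y) (rwhisk D (MObj \<rho> Y) (?F f)) \<bullet>\<^bsub>D\<^esub>
        (lwhisk D (PObj ?\<eta> Y) (PArr ?\<theta> f) \<bullet>\<^bsub>D\<^esub> rwhisk D (PArr ?\<eta> f) (PObj ?\<theta> X)))"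
      using d(2) by (simp add: n e)
    also have "\<dots> = rwhisk D (MObj \<sigma> Y) (PObj ?\<theta>' Y \<cdot>\<^bsub>D\<^esub> ?F f) \<bullet>\<^bsub>D\<^esub> (lwhisk D (PObj ?\<eta> Y) (PArr ?\<theta>' f) \<bullet>\<^bsub>D\<^esub> ?g)"
      using 1 2 by (simp add: n e)
    also have "\<dots> = lwhisk D (PObj ?\<eta>' Y) (PArr ?\<theta>' f) \<bullet>\<^bsub>D\<^esub> (rwhisk D (MObj \<sigma> Y) (?G f \<cdot>\<^bsub>D\<^esub> PObj ?\<theta>' X) \<bullet>\<^bsub>D\<^esub> ?g)"
      by (rule 3) (simp_all add: n e)
    also have "\<dots> = lwhisk D (PObj ?\<eta>' Y) (PArr ?\<theta>' f) \<bullet>\<^bsub>D\<^esub> (rwhisk D (PArr ?\<eta>' f) (PObj ?\<theta>' X) \<bullet>\<^bsub>D\<^esub>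
        (lwhisk D (?H f) (rwhisk D (MObj \<sigma> X) (PObj ?\<theta>' X)) \<bullet>\<^bsub>D\<^esub> lwhisk D (?H f) (lwhisk D (PObj ?\<eta> X) (MObj \<rho> X))))"
      using 4 by (simp add: n e)
    also have "\<dots> = (lwhisk D (PObj ?\<eta>' Y) (PArr ?\<theta>' f) \<bullet>\<^bsub>D\<^esub> rwhisk D (PArr ?\<eta>' f) (PObj ?\<theta>' X)) \<bullet>\<^bsub>D\<^esub>
      lwhisk D (?H f) (MObj \<sigma> X \<star>\<^bsub>D\<^esub> MObj \<rho> X)"
      using d(1) by (simp add: n e)
    finally show "rwhisk D (MObj (\<sigma> \<star>\<^bsub>Hom_p B D\<^esub> \<rho>) (Trg B f)) (FArr (PSrc (MSrc (\<sigma> \<star>\<^bsub>Hom_p B D\<^esub> \<rho>))) f)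
        \<bullet>\<^bsub>D\<^esub> PArr (MSrc (\<sigma> \<star>\<^bsub>Hom_p B D\<^esub> \<rho>)) f =
      PArr (MTrg (\<sigma> \<star>\<^bsub>Hom_p B D\<^esub> \<rho>)) f \<bullet>\<^bsub>D\<^esub> lwhisk D (FArr (PTrg (MSrc (\<sigma> \<star>\<^bsub>Hom_p B D\<^esub> \<rho>))) f)
        (MObj (\<sigma> \<star>\<^bsub>Hom_p B D\<^esub> \<rho>) (Src B f))"
      by (simp add: e)
  qed (auto simp add: t \<rho>.S.pseudonatural_axioms \<rho>.T.pseudonatural_axioms \<sigma>.S.pseudonatural_axioms
      \<sigma>.T.pseudonatural_axioms hom2_def intro!: pseudonatural_comp)
qed

section \<open>The 2-category axioms for \<open>Hom_p\<close>\<close>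

locale two_category_pair = B: two_category B + D: two_category D
  for B :: "('o, 'a, 'c) twocat" and D :: "('p, 'b, 'd) twocat"
begin

text \<open>By \<open>modif_eqI\<close> each equation between modifications becomes the
  corresponding axiom of \<open>D\<close> at every object. The endpoints of horizontal composites
  are transformations, so their agreement needs the unit and associativity laws of
  \<open>comp_pnt\<close>.\<close>

sublocale Hom_p: two_category "Hom_p B D"
proof (unfold_locales, goal_cases)
  case (1 f)
  then show ?case by (simp add: pseudonatural_def)
next
  case (2 f)
  then show ?case by (simp add: pseudonatural_def)
next
  case (3 X)
  then show ?case by (simp add: hom_def two_functor.pseudonatural_id)
next
  case (4 f X Y g Z)
  then show ?case by (auto simp: hom_def intro: pseudonatural_comp)
next
  case (5 f X Y)
  then show ?case by (auto simp: hom_def comp_pnt_id)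
next
  case (6 f X Y)
  then show ?case by (auto simp: hom_def comp_pnt_id)
next
  case (7 f X Y g Z h V)
  then show ?case by (auto simp: hom_def comp_pnt_assoc)
next
  case (8 \<alpha>)
  then show ?case by (simp add: modification_def)
next
  case (9 \<alpha>)
  then show ?case by (simp add: modification_def)
next
  case (10 \<alpha>)
  then show ?case by (simp add: modification.same_PSrc)
next
  case (11 \<alpha>)
  then show ?case by (simp add: modification.same_PTrg)
next
  case (12 f)
  then show ?case by (simp add: hom2_def modification_CId)
next
  case (13 \<alpha> f g \<beta> h)
  then show ?case by (auto simp: hom2_def intro: modification_VComp)
next
  case (14 \<alpha> f g)
  then interpret a: modification B D \<alpha> by (simp add: hom2_def)
  note t = a.M_typing a.S.P_typing a.T.P_typing B.typing D.typing D.normalize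
  show ?case
    by (rule modif_eqI)
      (use 14 a.T.pseudonatural_axioms in \<open>auto simp: hom2_def t intro: modification_VComp modification_CId\<close>)
next
  case (15 \<alpha> f g)
  then interpret a: modification B D \<alpha> by (simp add: hom2_def)
  note t = a.M_typing a.S.P_typing a.T.P_typing B.typing D.typing D.normalize
  show ?case
    by (rule modif_eqI)
      (use 15 a.S.pseudonatural_axioms in \<open>auto simp: hom2_def t intro: modification_VComp modification_CId\<close>)
next
  case (16 \<alpha> f g \<beta> h \<gamma> k)
  then interpret a: modification B D \<alpha> by (simp add: hom2_def)
  from 16 interpret b: modification B D \<beta> by (simp add: hom2_def)
  from 16 interpret c: modification B D \<gamma> by (simp add: hom2_def)
  note t = a.M_typing b.M_typing c.M_typing a.S.P_typing b.S.P_typing c.S.P_typing c.T.P_typing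
    B.typing D.typing D.normalize
  show ?case
    by (rule modif_eqI) (use 16 in \<open>auto simp: hom2_def t intro!: modification_VComp\<close>)
next
  case (17 \<alpha> f f' \<beta> g g')
  then interpret a: modification B D \<alpha> by (simp add: hom2_def)
  from 17 interpret b: modification B D \<beta> by (simp add: hom2_def)
  show ?case
    using 17 modification_HComp[OF a.modification_axioms b.modification_axioms] by (simp add: hom2_def)
next
  case (18 \<alpha> f f')
  then interpret a: modification B D \<alpha> by (simp add: hom2_def)
  note t = a.M_typing a.S.P_typing a.T.P_typing a.S.F.F_typing a.S.G.F_typing B.typing D.typing D.normalize
  note i = comp_pnt_id[OF a.S.pseudonatural_axioms] comp_pnt_id[OF a.T.pseudonatural_axioms, unfolded a.same_PSrc a.same_PTrg]
  show ?case
    by (rule modif_eqI)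
      (use 18 in \<open>auto simp: hom2_def t i intro!: modification_HComp modification_CId a.S.G.pseudonatural_id\<close>)
next
  case (19 \<alpha> f f')
  then interpret a: modification B D \<alpha> by (simp add: hom2_def)
  note t = a.M_typing a.S.P_typing a.T.P_typing a.S.F.F_typing a.S.G.F_typing B.typing D.typing D.normalize
  note i = comp_pnt_id[OF a.S.pseudonatural_axioms] comp_pnt_id[OF a.T.pseudonatural_axioms, unfolded a.same_PSrc a.same_PTrg]
  show ?case
    by (rule modif_eqI)
      (use 19 in \<open>auto simp: hom2_def t i intro!: modification_HComp modification_CId a.S.F.pseudonatural_id\<close>)
next
  case (20 \<alpha> f f' \<beta> g g' \<gamma> h h')
  then interpret a: modification B D \<alpha> by (simp add: hom2_def)
  from 20 interpret b: modification B D \<beta> by (simp add: hom2_def)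
  from 20 interpret c: modification B D \<gamma> by (simp add: hom2_def)
  note s = a.same_PSrc b.same_PSrc c.same_PSrc a.same_PTrg b.same_PTrg c.same_PTrg
    a.S.pseudonatural_axioms b.S.pseudonatural_axioms c.S.pseudonatural_axioms
    a.T.pseudonatural_axioms b.T.pseudonatural_axioms c.T.pseudonatural_axioms
  note t = a.M_typing b.M_typing c.M_typing a.S.P_typing b.S.P_typing c.S.P_typing
    B.typing D.typing D.normalize
  show ?case
    by (rule modif_eqI) (use 20 in \<open>auto simp: hom2_def t s comp_pnt_assoc intro!: modification_HComp\<close>)
next
  case (21 f X Y g Z)
  then interpret f: pseudonatural B D f by (simp add: hom_def)
  from 21 interpret g: pseudonatural B D g by (simp add: hom_def)
  note t = f.P_typing g.P_typing D.typing D.normalize f.pseudonatural_axioms g.pseudonatural_axioms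
  show ?case
    by (rule modif_eqI)
      (use 21 in \<open>auto simp: hom_def t intro!: modification_HComp modification_CId pseudonatural_comp\<close>)
next
  case (22 \<alpha> f f' \<alpha>' f'' \<beta> g g' \<beta>' g'')
  then interpret a: modification B D \<alpha> by (simp add: hom2_def)
  from 22 interpret b: modification B D \<beta> by (simp add: hom2_def)
  from 22 interpret a': modification B D \<alpha>' by (simp add: hom2_def)
  from 22 interpret b': modification B D \<beta>' by (simp add: hom2_def)
  note t = a.M_typing b.M_typing a'.M_typing b'.M_typing a.S.P_typing b.S.P_typing a'.S.P_typing b'.S.P_typing
  have x: "(MObj \<beta>' X \<bullet>\<^bsub>D\<^esub> MObj \<beta> X) \<star>\<^bsub>D\<^esub> (MObj \<alpha>' X \<bullet>\<^bsub>D\<^esub> MObj \<alpha> X) =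
      (MObj \<beta>' X \<star>\<^bsub>D\<^esub> MObj \<alpha>' X) \<bullet>\<^bsub>D\<^esub> (MObj \<beta> X \<star>\<^bsub>D\<^esub> MObj \<alpha> X)" if "X \<in> Obj B" for X
    by (rule D.interchange) (use 22 that in \<open>auto simp: hom2_def t\<close>)
  note s = a.same_PSrc b.same_PSrc a.same_PTrg b.same_PTrg
  show ?case
    by (rule modif_eqI)
      (use 22 s in \<open>auto simp: hom2_def x intro!: modification_VComp modification_HComp\<close>)
qed

end

section \<open>Sub-2-categories, isomorphisms and precomposition\<close>

lemma two_functorI:
  assumes "two_category B" "two_category D"
    "FObj F \<in> Obj B \<rightarrow>\<^sub>E Obj D" "FArr F \<in> Arr B \<rightarrow>\<^sub>E Arr D" "FCell F \<in> Cell B \<rightarrow>\<^sub>E Cell D"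
    "\<And>f. f \<in> Arr B \<Longrightarrow> Src D (FArr F f) = FObj F (Src B f)"
    "\<And>f. f \<in> Arr B \<Longrightarrow> Trg D (FArr F f) = FObj F (Trg B f)"
    "\<And>X. X \<in> Obj B \<Longrightarrow> FArr F (Ident B X) = Ident D (FObj F X)"
    "\<And>f g. f \<in> Arr B \<Longrightarrow> g \<in> Arr B \<Longrightarrow> Trg B f = Src B g \<Longrightarrow> FArr F (g \<cdot>\<^bsub>B\<^esub> f) = FArr F g \<cdot>\<^bsub>D\<^esub> FArr F f"
    "\<And>\<alpha>. \<alpha> \<in> Cell B \<Longrightarrow> Dom D (FCell F \<alpha>) = FArr F (Dom B \<alpha>)"
    "\<And>\<alpha>. \<alpha> \<in> Cell B \<Longrightarrow> Cod D (FCell F \<alpha>) = FArr F (Cod B \<alpha>)"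
    "\<And>f. f \<in> Arr B \<Longrightarrow> FCell F (CId B f) = CId D (FArr F f)"
    "\<And>\<alpha> \<beta>. \<alpha> \<in> Cell B \<Longrightarrow> \<beta> \<in> Cell B \<Longrightarrow> Cod B \<alpha> = Dom B \<beta>
      \<Longrightarrow> FCell F (\<beta> \<bullet>\<^bsub>B\<^esub> \<alpha>) = FCell F \<beta> \<bullet>\<^bsub>D\<^esub> FCell F \<alpha>"
    "\<And>\<alpha> \<beta>. \<alpha> \<in> Cell B \<Longrightarrow> \<beta> \<in> Cell B \<Longrightarrow> Trg B (Dom B \<alpha>) = Src B (Dom B \<beta>)
      \<Longrightarrow> FCell F (\<beta> \<star>\<^bsub>B\<^esub> \<alpha>) = FCell F \<beta> \<star>\<^bsub>D\<^esub> FCell F \<alpha>"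
  shows "two_functor B D F"
  using assms by (auto simp: two_functor_def two_functor_axioms_def hom_def hom2_def)

text \<open>The operations agree as total functions, not just on the smaller carriers:
  \<open>full_sub2\<close> and \<open>locally_full_sub2\<close> only replace carriers of a record.
  Equational axioms are thus inherited verbatim, and only closure has to be checked.\<close>

locale sub_two_category = C: two_category C
  for C :: "('o, 'a, 'c) twocat" and S :: "('o, 'a, 'c) twocat" +
  assumes sub: "Obj S \<subseteq> Obj C" "Arr S \<subseteq> Arr C" "Cell S \<subseteq> Cell C"
    and same: "Src S = Src C" "Trg S = Trg C" "Ident S = Ident C" "Comp S = Comp C"
      "Dom S = Dom C" "Cod S = Cod C" "CId S = CId C" "VComp S = VComp C" "HComp S = HComp C"
    and closed: "f \<in> Arr S \<Longrightarrow> Src C f \<in> Obj S" "f \<in> Arr S \<Longrightarrow> Trg C f \<in> Obj S"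
      "X \<in> Obj S \<Longrightarrow> Ident C X \<in> Arr S"
      "\<lbrakk>f \<in> Arr S; g \<in> Arr S; Trg C f = Src C g\<rbrakk> \<Longrightarrow> g \<cdot>\<^bsub>C\<^esub> f \<in> Arr S"
      "\<alpha> \<in> Cell S \<Longrightarrow> Dom C \<alpha> \<in> Arr S" "\<alpha> \<in> Cell S \<Longrightarrow> Cod C \<alpha> \<in> Arr S"
      "f \<in> Arr S \<Longrightarrow> CId C f \<in> Cell S"
      "\<lbrakk>\<alpha> \<in> Cell S; \<beta> \<in> Cell S; Cod C \<alpha> = Dom C \<beta>\<rbrakk> \<Longrightarrow> \<beta> \<bullet>\<^bsub>C\<^esub> \<alpha> \<in> Cell S"
      "\<lbrakk>\<alpha> \<in> Cell S; \<beta> \<in> Cell S; Trg C (Dom C \<alpha>) = Src C (Dom C \<beta>)\<rbrakk> \<Longrightarrow> \<beta> \<star>\<^bsub>C\<^esub> \<alpha> \<in> Cell S"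
begin

lemma subD: "X \<in> Obj S \<Longrightarrow> X \<in> Obj C" "f \<in> Arr S \<Longrightarrow> f \<in> Arr C" "\<alpha> \<in> Cell S \<Longrightarrow> \<alpha> \<in> Cell C"
  using sub by auto

lemma hom_S: "f \<in> hom S X Y \<Longrightarrow> f \<in> hom C X Y" "\<alpha> \<in> hom2 S a b \<Longrightarrow> \<alpha> \<in> hom2 C a b"
  using sub by (auto simp: hom_def hom2_def same)

sublocale S: two_category S
proof (unfold_locales, unfold same, goal_cases)
  case (3 X)
  then show ?case by (auto simp: hom_def same closed subD C.typing)
next
  case (4 f X Y g Z)
  then show ?case by (auto simp: hom_def same closed subD C.typing)
next
  case (5 f X Y) then show ?case using C.Comp_Ident_left hom_S(1) by blast
next
  case (6 f X Y) then show ?case using C.Comp_Ident_right hom_S(1) by blast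
next
  case (7 f X Y g Z h V) then show ?case using C.Comp_assoc hom_S(1) by blast
next
  case (13 \<alpha> f g \<beta> h) then show ?case by (auto simp: hom2_def same closed subD C.typing)
next
  case (14 \<alpha> f g) then show ?case using C.VComp_CId_left hom_S(2) by blast
next
  case (15 \<alpha> f g) then show ?case using C.VComp_CId_right hom_S(2) by blast
next
  case (16 \<alpha> f g \<beta> h \<gamma> k) then show ?case using C.VComp_assoc hom_S(2) by blast
next
  case (17 \<alpha> f f' \<beta> g g')
  then show ?case by (auto simp: hom2_def same closed subD C.typing)
next
  case (18 \<alpha> f f') then show ?case using C.HComp_Ident_left hom_S(2) by blast
next
  case (19 \<alpha> f f') then show ?case using C.HComp_Ident_right hom_S(2) by blast
next
  case (20 \<alpha> f f' \<beta> g g' \<gamma> h h') then show ?case using C.HComp_assoc hom_S(2) by blast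
next
  case (21 f X Y g Z) then show ?case using C.HComp_CId hom_S(1) by blast
next
  case (22 \<alpha> f f' \<alpha>' f'' \<beta> g g' \<beta>' g'') then show ?case using C.interchange hom_S(2) by blast
qed (auto simp: hom2_def same closed subD C.typing)

end

lemma full_sub2_simps [simp]:
  "Obj (full_sub2 C P) = {X \<in> Obj C. P X}"
  "Arr (full_sub2 C P) = {f \<in> Arr C. P (Src C f) \<and> P (Trg C f)}"
  "Cell (full_sub2 C P) = {\<alpha> \<in> Cell C. P (Src C (Dom C \<alpha>)) \<and> P (Trg C (Dom C \<alpha>))}"
  by (simp_all add: full_sub2_def)

lemma locally_full_sub2_simps [simp]:
  "Obj (locally_full_sub2 C P) = Obj C" "Arr (locally_full_sub2 C P) = {f \<in> Arr C. P f}"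
  "Cell (locally_full_sub2 C P) = {\<alpha> \<in> Cell C. P (Dom C \<alpha>) \<and> P (Cod C \<alpha>)}"
  by (simp_all add: locally_full_sub2_def)

lemma sub_full_sub2:
  assumes "two_category C"
  shows "sub_two_category C (full_sub2 C P)"
proof -
  interpret two_category C by fact
  show ?thesis by unfold_locales (auto simp: typing, auto simp: full_sub2_def)
qed

lemma sub_locally_full_sub2:
  assumes "two_category C" "\<And>X. X \<in> Obj C \<Longrightarrow> P (Ident C X)"
    "\<And>f g. \<lbrakk>f \<in> Arr C; g \<in> Arr C; Trg C f = Src C g; P f; P g\<rbrakk> \<Longrightarrow> P (g \<cdot>\<^bsub>C\<^esub> f)"
  shows "sub_two_category C (locally_full_sub2 C P)"
proof -
  interpret two_category C by fact
  show ?thesis by unfold_locales (auto simp: typing assms(2,3), auto simp: locally_full_sub2_def)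
qed

text \<open>Allows functoriality of precomposition to be proved once, on the whole of
  \<open>Hom_p\<close>, and then cut down to the strict and \<Sigma>-inverting versions.\<close>

lemma two_functor_sub:
  assumes "two_functor B D F" "sub_two_category B B'" "sub_two_category D D'"
    "\<And>X. X \<in> Obj B' \<Longrightarrow> FObj F X \<in> Obj D'" "\<And>f. f \<in> Arr B' \<Longrightarrow> FArr F f \<in> Arr D'"
    "\<And>\<alpha>. \<alpha> \<in> Cell B' \<Longrightarrow> FCell F \<alpha> \<in> Cell D'"
  shows "two_functor B' D' \<lparr>FObj = restrict (FObj F) (Obj B'), FArr = restrict (FArr F) (Arr B'),
    FCell = restrict (FCell F) (Cell B')\<rparr>"
proof -
  interpret F: two_functor B D F by fact
  interpret B: sub_two_category B B' by fact
  interpret D: sub_two_category D D' by fact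
  show ?thesis
    by (rule two_functorI)
      (auto simp: assms(4-6) B.same D.same B.closed B.subD F.F_typing F.F_preserves B.S.two_category_axioms
        D.S.two_category_axioms)
qed

section \<open>Isomorphisms of 2-categories and pseudoequivalences\<close>

lemma two_functor_id:
  assumes "two_category B"
  shows "two_functor B B (id_tfun B)"
proof -
  interpret two_category B by fact
  show ?thesis by (rule two_functorI) (auto simp: id_tfun_def typing assms)
qed

lemma twocat_isomorphismI:
  assumes "two_functor B D F" "bij_betw (FObj F) (Obj B) (Obj D)" "bij_betw (FArr F) (Arr B) (Arr D)"
    "bij_betw (FCell F) (Cell B) (Cell D)"
  shows "twocat_isomorphism B D F"
proof -
  interpret F: two_functor B D F by fact
  define G where "G = \<lparr>FObj = restrict (inv_into (Obj B) (FObj F)) (Obj D),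
    FArr = restrict (inv_into (Arr B) (FArr F)) (Arr D), FCell = restrict (inv_into (Cell B) (FCell F)) (Cell D)\<rparr>"
  have im: "Obj D = FObj F ` Obj B" "Arr D = FArr F ` Arr B" "Cell D = FCell F ` Cell B"
    and inj: "inj_on (FObj F) (Obj B)" "inj_on (FArr F) (Arr B)" "inj_on (FCell F) (Cell B)"
    using assms by (auto simp: bij_betw_def)
  have GF: "X \<in> Obj B \<Longrightarrow> FObj G (FObj F X) = X" "f \<in> Arr B \<Longrightarrow> FArr G (FArr F f) = f"
    "\<alpha> \<in> Cell B \<Longrightarrow> FCell G (FCell F \<alpha>) = \<alpha>" for X f \<alpha>
    using inj by (simp_all add: G_def F.F_typing)
  have eqs: "X \<in> Obj B \<Longrightarrow> Y \<in> Obj B \<Longrightarrow> FObj F X = FObj F Y \<longleftrightarrow> X = Y"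
    "f \<in> Arr B \<Longrightarrow> g \<in> Arr B \<Longrightarrow> FArr F f = FArr F g \<longleftrightarrow> f = g" for X Y f g
    using inj by (auto simp: inj_on_eq_iff)
  have "two_functor D B G"
  proof (rule two_functorI)
    show "FObj G \<in> Obj D \<rightarrow>\<^sub>E Obj B" "FArr G \<in> Arr D \<rightarrow>\<^sub>E Arr B" "FCell G \<in> Cell D \<rightarrow>\<^sub>E Cell B"
      by (auto simp: G_def im inj)
  \<comment> \<open>Every element of a carrier of \<open>D\<close> is an image under
    \<open>F\<close>, so each law for \<open>G\<close> is the law for \<open>F\<close> read
    backwards; injectivity transfers the conditions of composability.\<close>
  qed (auto simp: im GF eqs F.F_typing F.B.typing F.B.two_category_axioms F.D.two_category_axioms
      simp flip: F.F_preserves)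
  moreover have "comp_tfun B G F = id_tfun B"
    by (auto simp: comp_tfun_def id_tfun_def compose_def GF restrict_def)
  moreover have "comp_tfun D F G = id_tfun D"
    by (auto simp: comp_tfun_def id_tfun_def compose_def im GF restrict_def fun_eq_iff)
  ultimately show ?thesis using assms(1) by (auto simp: twocat_isomorphism_def)
qed

text \<open>A strict inverse makes both composites identity 2-functors, so identity transformations
  serve as unit and counit. They are equivalences because identity arrows of any 2-category are,
  applied to \<open>Hom_p B B\<close> and \<open>Hom_p D D\<close>.\<close>

lemma isomorphism_imp_pseudoequivalence:
  assumes "twocat_isomorphism B D F"
  shows "pseudoequivalence B D F"
proof -
  obtain G where G: "two_functor B D F" "two_functor D B G" "comp_tfun B G F = id_tfun B"
    "comp_tfun D F G = id_tfun D"
    using assms by (auto simp: twocat_isomorphism_def)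
  \<comment> \<open>Stated with its own type variables because it is instantiated at both
    \<open>B\<close> and \<open>D\<close>, whose types differ.\<close>
  have *: "\<exists>\<eta> \<in> hom (Hom_p C C) (id_tfun C) (id_tfun C). is_equivalence (Hom_p C C) \<eta>"
    if C: "two_category C" for C :: "('x, 'y, 'z) twocat"
  proof -
    interpret two_category_pair C C using C by (simp add: two_category_pair_def)
    have "id_pnt C C (id_tfun C) \<in> hom (Hom_p C C) (id_tfun C) (id_tfun C)"
      using two_functor.pseudonatural_id[OF two_functor_id[OF C]] by (simp add: hom_def)
    moreover have "is_equivalence (Hom_p C C) (id_pnt C C (id_tfun C))"
      using Hom_p.equivalence_Ident[of "id_tfun C"] two_functor_id[OF C] by simp
    ultimately show ?thesis by blast
  qed
  then show ?thesis
    using G *[of B] *[of D] unfolding pseudoequivalence_def by (metis two_functor_def)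
qed

section \<open>Whiskering with a 2-functor, and precomposition as a 2-functor\<close>

lemma pseudonaturalD:
  "pseudonatural B D \<theta> \<Longrightarrow> two_functor B D (PSrc \<theta>)" "pseudonatural B D \<theta> \<Longrightarrow> two_functor B D (PTrg \<theta>)"
  by (simp_all add: pseudonatural_def)

lemma modificationD:
  "modification B D \<rho> \<Longrightarrow> pseudonatural B D (MSrc \<rho>)" "modification B D \<rho> \<Longrightarrow> pseudonatural B D (MTrg \<rho>)"
  by (simp_all add: modification_def)

lemma comp_tfun_simps [simp]:
  "X \<in> Obj B \<Longrightarrow> FObj (comp_tfun B G F) X = FObj G (FObj F X)"
  "f \<in> Arr B \<Longrightarrow> FArr (comp_tfun B G F) f = FArr G (FArr F f)"
  "\<alpha> \<in> Cell B \<Longrightarrow> FCell (comp_tfun B G F) \<alpha> = FCell G (FCell F \<alpha>)"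
  by (simp_all add: comp_tfun_def compose_def)

lemma whisker_simps [simp]:
  "PSrc (whisker_pnt B \<theta> q) = comp_tfun B (PSrc \<theta>) q" "PTrg (whisker_pnt B \<theta> q) = comp_tfun B (PTrg \<theta>) q"
  "X \<in> Obj B \<Longrightarrow> PObj (whisker_pnt B \<theta> q) X = PObj \<theta> (FObj q X)"
  "f \<in> Arr B \<Longrightarrow> PArr (whisker_pnt B \<theta> q) f = PArr \<theta> (FArr q f)"
  "MSrc (whisker_modif B \<rho> q) = whisker_pnt B (MSrc \<rho>) q" "MTrg (whisker_modif B \<rho> q) = whisker_pnt B (MTrg \<rho>) q"
  "X \<in> Obj B \<Longrightarrow> MObj (whisker_modif B \<rho> q) X = MObj \<rho> (FObj q X)"
  by (simp_all add: whisker_pnt_def whisker_modif_def compose_def)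

context two_functor
begin

lemma two_functor_comp:
  assumes "two_functor D E G"
  shows "two_functor B E (comp_tfun B G F)"
proof -
  interpret G: two_functor D E G by fact
  show ?thesis
  proof (rule two_functorI)
    show "FObj (comp_tfun B G F) \<in> Obj B \<rightarrow>\<^sub>E Obj E" "FArr (comp_tfun B G F) \<in> Arr B \<rightarrow>\<^sub>E Arr E"
      "FCell (comp_tfun B G F) \<in> Cell B \<rightarrow>\<^sub>E Cell E"
      by (auto simp: comp_tfun_def compose_def F_typing G.F_typing)
  qed (simp_all add: F_typing G.F_typing F_preserves G.F_preserves B.typing B.two_category_axioms
      G.D.two_category_axioms)
qed

lemma pseudonatural_whisker:
  assumes "pseudonatural D E \<theta>"
  shows "pseudonatural B E (whisker_pnt B \<theta> F)"
proof -
  interpret \<theta>: pseudonatural D E \<theta> by fact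
  have h: "FArr F f \<in> hom D (FObj F X) (FObj F Y)" if "f \<in> hom B X Y" for f X Y
    using that by (auto simp: hom_def F_typing)
  have "pseudonatural_axioms B E (whisker_pnt B \<theta> F)"
  proof (unfold_locales, goal_cases)
    case 1 show ?case by (simp add: whisker_pnt_def)
  next
    case 2 show ?case by (simp add: whisker_pnt_def)
  next
    case (3 X) then show ?case by (simp add: \<theta>.PObj_in F_typing)
  next
    case (4 f X Y)
    then have "f \<in> Arr B" "X \<in> Obj B" "Y \<in> Obj B" using B.typing(1,2)[of f] by (auto simp: hom_def)
    then show ?case using \<theta>.PArr_in[OF h[OF 4]] by simp
  next
    case (5 X) then show ?case by (simp add: \<theta>.PArr_Ident F_preserves F_typing B.typing)
  next
    case (6 f X Y g Z)
    then have "f \<in> Arr B" "g \<in> Arr B" "Trg B f = Src B g" by (auto simp: hom_def)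
    then show ?case using \<theta>.PArr_Comp[OF h[OF 6(1)] h[OF 6(2)]] by (simp add: F_preserves B.typing)
  next
    case (7 f X Y \<alpha> g)
    then have "f \<in> Arr B" "g \<in> Arr B" "\<alpha> \<in> Cell B" "X \<in> Obj B" "Y \<in> Obj B"
      "FCell F \<alpha> \<in> hom2 D (FArr F f) (FArr F g)"
      using B.typing(1,2)[of f] B.hom2D[OF 7(2)] by (auto simp: hom_def hom2_def F_typing)
    then show ?case using \<theta>.PArr_natural[OF h[OF 7(1)]] by simp
  qed
  then show ?thesis
    using two_functor_comp[OF \<theta>.F.two_functor_axioms] two_functor_comp[OF \<theta>.G.two_functor_axioms]
    by (simp add: pseudonatural_def)
qed

lemma modification_whisker:
  assumes "modification D E \<rho>"
  shows "modification B E (whisker_modif B \<rho> F)"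
proof -
  interpret \<rho>: modification D E \<rho> by fact
  show ?thesis
  proof (rule modificationI)
    fix f assume "f \<in> Arr B"
    then show "rwhisk E (MObj (whisker_modif B \<rho> F) (Trg B f)) (FArr (PSrc (MSrc (whisker_modif B \<rho> F))) f) \<bullet>\<^bsub>E\<^esub>
        PArr (MSrc (whisker_modif B \<rho> F)) f =
      PArr (MTrg (whisker_modif B \<rho> F)) f \<bullet>\<^bsub>E\<^esub>
        lwhisk E (FArr (PTrg (MSrc (whisker_modif B \<rho> F))) f) (MObj (whisker_modif B \<rho> F) (Src B f))"
      using \<rho>.M_natural[of "FArr F f"] by (simp add: F_typing B.typing)
  qed (simp_all add: pseudonatural_whisker \<rho>.S.pseudonatural_axioms \<rho>.T.pseudonatural_axioms
      \<rho>.same_PSrc \<rho>.same_PTrg \<rho>.MObj_in F_typing, simp add: whisker_modif_def)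
qed

lemma two_functor_precomp:
  assumes "two_category E"
  shows "two_functor (Hom_p D E) (Hom_p B E) (precomp B F (Hom_p D E))"
proof -
  interpret DE: two_category_pair D E
    using assms D.two_category_axioms by (simp add: two_category_pair_def)
  interpret BE: two_category_pair B E
    using assms B.two_category_axioms by (simp add: two_category_pair_def)
  show ?thesis
  proof (rule two_functorI)
    show "FArr (precomp B F (Hom_p D E)) (Ident (Hom_p D E) G) =
        Ident (Hom_p B E) (FObj (precomp B F (Hom_p D E)) G)"
      if "G \<in> Obj (Hom_p D E)" for G
    proof -
      interpret G: two_functor D E G using that by simp
      note two_functor.pseudonatural_id[OF two_functor_comp[OF G.two_functor_axioms]]
      then have "whisker_pnt B (id_pnt D E G) F = id_pnt B E (comp_tfun B G F)"
        by (intro pnt_eqI[where B = B and D = E])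
          (simp_all add: pseudonatural_whisker G.pseudonatural_id F_typing)
      then show ?thesis using that G.pseudonatural_id by (simp add: precomp_def)
    qed
    \<comment> \<open>Used twice: for composition of arrows, and to match the source and target of
      horizontally composed modifications.\<close>
    have c: "whisker_pnt B (comp_pnt D E \<eta> \<theta>) F = comp_pnt B E (whisker_pnt B \<eta> F) (whisker_pnt B \<theta> F)"
      if "pseudonatural D E \<theta>" "pseudonatural D E \<eta>" "PTrg \<theta> = PSrc \<eta>" for \<eta> \<theta>
      using that by (intro pnt_eqI[where B = B and D = E])
        (auto simp: F_typing B.typing intro!: pseudonatural_whisker pseudonatural_comp)
    then show "FArr (precomp B F (Hom_p D E)) (\<eta> \<cdot>\<^bsub>Hom_p D E\<^esub> \<theta>) =
        FArr (precomp B F (Hom_p D E)) \<eta> \<cdot>\<^bsub>Hom_p B E\<^esub> FArr (precomp B F (Hom_p D E)) \<theta>"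
      if "\<theta> \<in> Arr (Hom_p D E)" "\<eta> \<in> Arr (Hom_p D E)" "Trg (Hom_p D E) \<theta> = Src (Hom_p D E) \<eta>" for \<theta> \<eta>
      using that by (simp add: precomp_def pseudonatural_comp)
    show "FCell (precomp B F (Hom_p D E)) (CId (Hom_p D E) \<theta>) =
        CId (Hom_p B E) (FArr (precomp B F (Hom_p D E)) \<theta>)"
      if "\<theta> \<in> Arr (Hom_p D E)" for \<theta>
    proof -
      have "whisker_modif B (CId (Hom_p D E) \<theta>) F = CId (Hom_p B E) (whisker_pnt B \<theta> F)"
        using that by (intro modif_eqI[where B = B and D = E])
          (simp_all add: modification_whisker modification_CId pseudonatural_whisker F_typing)
      then show ?thesis using that by (simp add: precomp_def modification_CId)
    qed
    show "FCell (precomp B F (Hom_p D E)) (\<sigma> \<bullet>\<^bsub>Hom_p D E\<^esub> \<rho>) =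
        FCell (precomp B F (Hom_p D E)) \<sigma> \<bullet>\<^bsub>Hom_p B E\<^esub> FCell (precomp B F (Hom_p D E)) \<rho>"
      if "\<rho> \<in> Cell (Hom_p D E)" "\<sigma> \<in> Cell (Hom_p D E)" "Cod (Hom_p D E) \<rho> = Dom (Hom_p D E) \<sigma>" for \<rho> \<sigma>
    proof -
      have "whisker_modif B (\<sigma> \<bullet>\<^bsub>Hom_p D E\<^esub> \<rho>) F = whisker_modif B \<sigma> F \<bullet>\<^bsub>Hom_p B E\<^esub> whisker_modif B \<rho> F"
        using that by (intro modif_eqI[where B = B and D = E])
          (simp_all add: modification_whisker modification_VComp F_typing)
      then show ?thesis using that by (simp add: precomp_def modification_VComp)
    qed
    show "FCell (precomp B F (Hom_p D E)) (\<sigma> \<star>\<^bsub>Hom_p D E\<^esub> \<rho>) =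
        FCell (precomp B F (Hom_p D E)) \<sigma> \<star>\<^bsub>Hom_p B E\<^esub> FCell (precomp B F (Hom_p D E)) \<rho>"
      if "\<rho> \<in> Cell (Hom_p D E)" "\<sigma> \<in> Cell (Hom_p D E)"
        "Trg (Hom_p D E) (Dom (Hom_p D E) \<rho>) = Src (Hom_p D E) (Dom (Hom_p D E) \<sigma>)" for \<rho> \<sigma>
    proof -
      interpret \<rho>: modification D E \<rho> using that by simp
      interpret \<sigma>: modification D E \<sigma> using that by simp
      have "whisker_modif B (\<sigma> \<star>\<^bsub>Hom_p D E\<^esub> \<rho>) F = whisker_modif B \<sigma> F \<star>\<^bsub>Hom_p B E\<^esub> whisker_modif B \<rho> F"
        using that \<rho>.same_PTrg \<sigma>.same_PSrc \<rho>.S.pseudonatural_axioms \<rho>.T.pseudonatural_axioms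
          \<sigma>.S.pseudonatural_axioms \<sigma>.T.pseudonatural_axioms
        by (intro modif_eqI[where B = B and D = E])
          (simp_all add: modification_whisker modification_HComp F_typing c)
      then show ?thesis using that by (simp add: precomp_def modification_HComp)
    qed
  qed (auto simp: precomp_def two_functor_comp pseudonatural_whisker modification_whisker
      DE.Hom_p.two_category_axioms BE.Hom_p.two_category_axioms pseudonaturalD modificationD)
qed

end

section \<open>The homotopy 2-category\<close>

lemma seq_equiv_refl: "seq_equiv A \<Sigma> Hs Hs"
  by (simp add: seq_equiv_def)

lemma seq_equiv_sym: "seq_equiv A \<Sigma> Hs Ks \<Longrightarrow> seq_equiv A \<Sigma> Ks Hs"
  by (simp add: seq_equiv_def)

lemma seq_equiv_trans: "seq_equiv A \<Sigma> Hs Ks \<Longrightarrow> seq_equiv A \<Sigma> Ks Ls \<Longrightarrow> seq_equiv A \<Sigma> Hs Ls"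
  by (simp add: seq_equiv_def)

text \<open>Operations on 2-cells collect the results over all representatives. Once these are shown
  to be mutually equivalent, the set can be replaced by a single member.\<close>

lemma ho_class_eq:
  assumes "Hs \<in> S" "\<And>Ks. Ks \<in> S \<Longrightarrow> seq_equiv A \<Sigma> Hs Ks"
  shows "ho_class A \<Sigma> f g S = ho_class A \<Sigma> f g {Hs}"
  unfolding ho_class_def using assms seq_equiv_trans seq_equiv_sym by (auto; blast)

lemma ho_class_simps [simp]:
  "ho_dom (ho_class A \<Sigma> f g S) = f" "ho_cod (ho_class A \<Sigma> f g S) = g"
  by (simp_all add: ho_class_def)

lemma ho_seqs_singleton:
  "ho_seqs (ho_class A \<Sigma> f g {Hs}) = {Ls. homotopy_seq A \<Sigma> f g Ls \<and> seq_equiv A \<Sigma> Hs Ls}"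
  by (simp add: ho_class_def)

lemma Ho_simps [simp]:
  "Obj (Ho A \<Sigma>) = Obj A" "Arr (Ho A \<Sigma>) = Arr A" "Src (Ho A \<Sigma>) = Src A" "Trg (Ho A \<Sigma>) = Trg A"
  "Ident (Ho A \<Sigma>) = Ident A" "Comp (Ho A \<Sigma>) = Comp A" "Dom (Ho A \<Sigma>) = ho_dom" "Cod (Ho A \<Sigma>) = ho_cod"
  "hom (Ho A \<Sigma>) X Y = hom A X Y"
  by (simp_all add: Ho_def hom_def)

lemma VComp_Ho [simp]: "VComp (Ho A \<Sigma>) = ho_vcomp A \<Sigma>"
  by (simp add: Ho_def)

lemma CId_Ho [simp]: "CId (Ho A \<Sigma>) f = ho_class A \<Sigma> f f {[trivial_homotopy A f]}"
  by (simp add: Ho_def)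

lemma HComp_Ho [simp]:
  "\<beta> \<star>\<^bsub>Ho A \<Sigma>\<^esub> \<alpha> = ho_vcomp A \<Sigma> (ho_rwhisk A \<Sigma> \<beta> (ho_cod \<alpha>)) (ho_lwhisk A \<Sigma> (ho_dom \<beta>) \<alpha>)"
  by (simp add: Ho_def)

lemma Cell_HoI: "homotopy_seq A \<Sigma> f g Hs \<Longrightarrow> ho_class A \<Sigma> f g {Hs} \<in> Cell (Ho A \<Sigma>)"
  by (auto simp: Ho_def)

lemma Cell_HoE:
  assumes "\<alpha> \<in> Cell (Ho A \<Sigma>)"
  obtains Hs where "homotopy_seq A \<Sigma> (ho_dom \<alpha>) (ho_cod \<alpha>) Hs" "\<alpha> = ho_class A \<Sigma> (ho_dom \<alpha>) (ho_cod \<alpha>) {Hs}"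
  using assms by (auto simp: Ho_def)

text \<open>The chosen representative is immaterial when \<open>F\<close> inverts \<Sigma>, by
  \<open>cell_hat_class\<close>.\<close>

definition cell_hat :: "('p, 'b, 'd) twocat \<Rightarrow> ('o, 'a, 'a, 'p, 'b, 'd) tfun \<Rightarrow> ('o, 'a) ho_cell \<Rightarrow> 'd" where
  "cell_hat D F \<alpha> = seq_hat D F (SOME Hs. Hs \<in> ho_seqs \<alpha>)"

lemma homotopy_seq_append:
  assumes "homotopy_seq A \<Sigma> g h Ks" "homotopy_seq A \<Sigma> f g Hs"
  shows "homotopy_seq A \<Sigma> f h (Ks @ Hs)"
  using assms by (induction) (auto intro: homotopy_seq.cons)

lemma homotopy_seq_nonempty: "homotopy_seq A \<Sigma> f g Hs \<Longrightarrow> Hs \<noteq> []"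
  by (cases rule: homotopy_seq.cases) auto

text \<open>An empty list carries no arrow whose identity 2-cell could be its value, so
  \<open>seq_hat\<close> is \<open>undefined\<close> there and the singleton is a separate
  case.\<close>

lemma seq_hat_Cons: "Hs \<noteq> [] \<Longrightarrow> seq_hat D F (H # Hs) = homotopy_hat D F H \<bullet>\<^bsub>D\<^esub> seq_hat D F Hs"
  by (cases Hs) auto

section \<open>Homotopies, their whiskerings and the trivial homotopy\<close>

locale weak_equivalences = category A for A :: "('o, 'a) cat" +
  fixes \<Sigma> :: "'a set"
  assumes \<Sigma>_Arr: "\<Sigma> \<subseteq> Arr A" and Ident_\<Sigma>: "X \<in> Obj A \<Longrightarrow> Ident A X \<in> \<Sigma>"
begin

lemma is_homotopyD:
  assumes "is_homotopy A \<Sigma> f g H"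
  shows "f \<in> Arr A" "g \<in> Arr A" "Src A g = Src A f" "Trg A g = Trg A f"
  using assms by (cases H; simp add: hom_def)+

lemma homotopy_seqD:
  assumes "homotopy_seq A \<Sigma> f g Hs"
  shows "f \<in> Arr A" "g \<in> Arr A" "Src A g = Src A f" "Trg A g = Trg A f"
proof -
  have "f \<in> Arr A \<and> g \<in> Arr A \<and> Src A g = Src A f \<and> Trg A g = Trg A f"
    using assms
  proof induction
    case (single f g H)
    then show ?case using is_homotopyD[OF single] by simp
  next
    case (cons f g Hs k H)
    then show ?case using is_homotopyD[OF cons(2)] by simp
  qed
  then show "f \<in> Arr A" "g \<in> Arr A" "Src A g = Src A f" "Trg A g = Trg A f" by auto
qed

lemma is_homotopy_post:
  assumes "is_homotopy A \<Sigma> f g H" "r \<in> Arr A" "Src A r = Trg A f"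
  shows "is_homotopy A \<Sigma> (r \<cdot>\<^bsub>A\<^esub> f) (r \<cdot>\<^bsub>A\<^esub> g) (homotopy_post A r H)"
proof -
  obtain C h where H: "H = (C, h)" by (cases H)
  have C: "cyl0 C \<in> hom A (Src A f) (cylW C)" "cyl1 C \<in> hom A (Src A f) (cylW C)"
    "h \<in> hom A (cylW C) (Trg A f)" "r \<in> hom A (Trg A f) (Trg A r)" "f \<in> hom A (Src A f) (Trg A f)"
    "g \<in> hom A (Src A f) (Trg A f)"
    using assms by (auto simp: H is_cylinder_def hom_def)
  have "r \<cdot>\<^bsub>A\<^esub> f \<in> hom A (Src A f) (Trg A r)" "r \<cdot>\<^bsub>A\<^esub> g \<in> hom A (Src A f) (Trg A r)"
    "r \<cdot>\<^bsub>A\<^esub> h \<in> hom A (cylW C) (Trg A r)"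
    using Comp_in C by blast+
  then show ?thesis
    using assms(1) Comp_assoc[OF C(1,3,4)] Comp_assoc[OF C(2,3,4)] by (auto simp: H hom_def)
qed

lemma is_cylinder_pre:
  assumes "is_cylinder A \<Sigma> X C" "l \<in> hom A V X"
  shows "is_cylinder A \<Sigma> V (C\<lparr>cyl0 := cyl0 C \<cdot>\<^bsub>A\<^esub> l, cyl1 := cyl1 C \<cdot>\<^bsub>A\<^esub> l, cylX := cylX C \<cdot>\<^bsub>A\<^esub> l\<rparr>)"
  using assms Comp_assoc[of l V X "cyl0 C" "cylW C" "cylS C" "cylZ C"]
    Comp_assoc[of l V X "cyl1 C" "cylW C" "cylS C" "cylZ C"] Src_in[of l]
  by (auto simp: is_cylinder_def intro: Comp_in) (auto simp: hom_def)

lemma is_homotopy_pre: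
  assumes "is_homotopy A \<Sigma> f g H" "l \<in> Arr A" "Trg A l = Src A f"
  shows "is_homotopy A \<Sigma> (f \<cdot>\<^bsub>A\<^esub> l) (g \<cdot>\<^bsub>A\<^esub> l) (homotopy_pre A H l)"
proof -
  obtain C h where H: "H = (C, h)" by (cases H)
  have C: "cyl0 C \<in> hom A (Src A f) (cylW C)" "cyl1 C \<in> hom A (Src A f) (cylW C)"
    "h \<in> hom A (cylW C) (Trg A f)" "l \<in> hom A (Src A l) (Src A f)" "f \<in> hom A (Src A f) (Trg A f)"
    "g \<in> hom A (Src A f) (Trg A f)" "is_cylinder A \<Sigma> (Src A f) C"
    using assms by (auto simp: H is_cylinder_def hom_def)
  have "f \<cdot>\<^bsub>A\<^esub> l \<in> hom A (Src A l) (Trg A f)" "g \<cdot>\<^bsub>A\<^esub> l \<in> hom A (Src A l) (Trg A f)"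
    using Comp_in C by blast+
  then show ?thesis
    using assms(1) Comp_assoc[OF C(4,1,3)] Comp_assoc[OF C(4,2,3)] is_cylinder_pre[OF C(7,4)]
    by (auto simp: H hom_def)
qed

lemma homotopy_seq_post:
  assumes "homotopy_seq A \<Sigma> f g Hs" "r \<in> Arr A" "Src A r = Trg A f"
  shows "homotopy_seq A \<Sigma> (r \<cdot>\<^bsub>A\<^esub> f) (r \<cdot>\<^bsub>A\<^esub> g) (map (homotopy_post A r) Hs)"
  using assms
  by induction (auto simp: homotopy_seqD(4) intro!: homotopy_seq.intros is_homotopy_post)

lemma homotopy_seq_pre:
  assumes "homotopy_seq A \<Sigma> f g Hs" "l \<in> Arr A" "Trg A l = Src A f"
  shows "homotopy_seq A \<Sigma> (f \<cdot>\<^bsub>A\<^esub> l) (g \<cdot>\<^bsub>A\<^esub> l) (map (\<lambda>H. homotopy_pre A H l) Hs)"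
  using assms
  by induction (auto simp: homotopy_seqD(3) intro!: homotopy_seq.intros is_homotopy_pre)

text \<open>Here the identities in \<Sigma> matter: the \<open>s\<close> of this cylinder is an
  identity.\<close>

lemma trivial_cylinder:
  assumes "X \<in> Obj A"
  shows "is_cylinder A \<Sigma> X \<lparr>cylW = X, cylZ = X, cyl0 = Ident A X, cyl1 = Ident A X, cylS = Ident A X, cylX = Ident A X\<rparr>"
  using assms Ident_in[OF assms] Ident_\<Sigma>[OF assms] Comp_Ident_left[OF Ident_in[OF assms]]
  by (simp add: is_cylinder_def)

lemma is_homotopy_trivial:
  assumes "f \<in> Arr A"
  shows "is_homotopy A \<Sigma> f f (trivial_homotopy A f)"
  using assms trivial_cylinder[OF Src_in[OF assms]] Comp_Ident_right[of f "Src A f" "Trg A f"]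
  by (simp add: trivial_homotopy_def Let_def hom_def)

end

section \<open>Images of homotopies and of their classes under a 2-functor inverting
  \<Sigma>\<close>

locale inverting_functor = weak_equivalences A \<Sigma> + F: two_functor "disc A" D F
  for A :: "('o, 'a) cat" and \<Sigma> and D :: "('p, 'b, 'd) twocat" and F +
  assumes inverts: "inverts D \<Sigma> F"
begin

lemmas F_A = F.F_typing(1,2,4,5)[simplified] F.F_preserves(1,2)[simplified]

lemma F_cell: "f \<in> Arr A \<Longrightarrow> FCell F f = CId D (FArr F f)"
  using F.F_CId by simp

lemma cyl_hat:
  assumes "is_cylinder A \<Sigma> X C"
  shows "cyl_hat D F C \<in> hom2 D (FArr F (cyl0 C)) (FArr F (cyl1 C))"
    "lwhisk D (FArr F (cylS C)) (cyl_hat D F C) = CId D (FArr F (cylX C))"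
  using theI'[OF cyl_hat_ex1[OF F.two_functor_axioms inverts assms]] by (simp_all add: cyl_hat_def)

text \<open>The means of computing \<open>cyl_hat\<close>: it suffices to exhibit a 2-cell between
  the right arrows that the image of \<open>s\<close> whiskers to an identity.\<close>

lemma cyl_hat_unique:
  assumes "is_cylinder A \<Sigma> X C" "\<alpha> \<in> hom2 D (FArr F (cyl0 C)) (FArr F (cyl1 C))"
    "lwhisk D (FArr F (cylS C)) \<alpha> = CId D (FArr F (cylX C))"
  shows "cyl_hat D F C = \<alpha>"
  unfolding cyl_hat_def
  by (rule the1_equality[OF cyl_hat_ex1[OF F.two_functor_axioms inverts assms(1)]]) (use assms in simp)

lemma cylinder_typing:
  assumes "is_cylinder A \<Sigma> X C"
  shows "cyl0 C \<in> Arr A" "cyl1 C \<in> Arr A" "cylS C \<in> Arr A" "cylX C \<in> Arr A"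
    "Src A (cyl0 C) = X" "Src A (cyl1 C) = X" "Src A (cylX C) = X" "Src A (cylS C) = cylW C"
    "Trg A (cyl0 C) = cylW C" "Trg A (cyl1 C) = cylW C" "Trg A (cylS C) = cylZ C" "Trg A (cylX C) = cylZ C"
    "cylS C \<cdot>\<^bsub>A\<^esub> cyl0 C = cylX C" "cylS C \<cdot>\<^bsub>A\<^esub> cyl1 C = cylX C"
    "cyl_hat D F C \<in> Cell D" "Dom D (cyl_hat D F C) = FArr F (cyl0 C)" "Cod D (cyl_hat D F C) = FArr F (cyl1 C)"
  using assms cyl_hat[OF assms] by (auto simp: is_cylinder_def hom_def hom2_def)

lemma homotopyE:
  assumes "is_homotopy A \<Sigma> f g H"
  obtains C h where "H = (C, h)" "is_cylinder A \<Sigma> (Src A f) C" "h \<in> Arr A" "Src A h = cylW C" "Trg A h = Trg A f"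
    "h \<cdot>\<^bsub>A\<^esub> cyl0 C = f" "h \<cdot>\<^bsub>A\<^esub> cyl1 C = g"
  using assms by (cases H) (auto simp: hom_def)

lemma homotopy_hat:
  assumes "is_homotopy A \<Sigma> f g H"
  shows "homotopy_hat D F H \<in> Cell D" "Dom D (homotopy_hat D F H) = FArr F f" "Cod D (homotopy_hat D F H) = FArr F g"
proof -
  obtain C h where H: "H = (C, h)" and C: "is_cylinder A \<Sigma> (Src A f) C" and h: "h \<in> Arr A" "Src A h = cylW C" "Trg A h = Trg A f"
    "h \<cdot>\<^bsub>A\<^esub> cyl0 C = f" "h \<cdot>\<^bsub>A\<^esub> cyl1 C = g"
    using assms by (rule homotopyE)
  note t = cylinder_typing[OF C]
  show "homotopy_hat D F H \<in> Cell D" "Dom D (homotopy_hat D F H) = FArr F f" "Cod D (homotopy_hat D F H) = FArr F g"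
    using h(1-3) F.F_preserves(2)[of "cyl0 C" h] F.F_preserves(2)[of "cyl1 C" h] h(4,5) t
    by (simp_all add: H F_A F.D.typing)
qed

lemma seq_hat:
  assumes "homotopy_seq A \<Sigma> f g Hs"
  shows "seq_hat D F Hs \<in> Cell D" "Dom D (seq_hat D F Hs) = FArr F f" "Cod D (seq_hat D F Hs) = FArr F g"
proof -
  have "seq_hat D F Hs \<in> Cell D \<and> Dom D (seq_hat D F Hs) = FArr F f \<and> Cod D (seq_hat D F Hs) = FArr F g"
    using assms
    by induction (auto simp: homotopy_hat seq_hat_Cons homotopy_seq_nonempty F.D.typing)
  then show "seq_hat D F Hs \<in> Cell D" "Dom D (seq_hat D F Hs) = FArr F f" "Cod D (seq_hat D F Hs) = FArr F g"
    by auto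
qed

lemma seq_hat_append:
  assumes "homotopy_seq A \<Sigma> g h Ks" "homotopy_seq A \<Sigma> f g Hs"
  shows "seq_hat D F (Ks @ Hs) = seq_hat D F Ks \<bullet>\<^bsub>D\<^esub> seq_hat D F Hs"
  using assms
proof induction
  case (single g h H)
  then show ?case by (simp add: seq_hat_Cons homotopy_seq_nonempty)
next
  case (cons g h Ks k H)
  note t = seq_hat[OF cons(1)] seq_hat[OF cons(4)] homotopy_hat[OF cons(2)]
  show ?case using cons by (simp add: seq_hat_Cons homotopy_seq_nonempty t F.D.normalize)
qed

lemma homotopy_hat_post:
  assumes "is_homotopy A \<Sigma> f g H" "r \<in> Arr A" "Src A r = Trg A f"
  shows "homotopy_hat D F (homotopy_post A r H) = lwhisk D (FArr F r) (homotopy_hat D F H)"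
proof -
  obtain C h where H: "H = (C, h)" and C: "is_cylinder A \<Sigma> (Src A f) C" and h: "h \<in> Arr A" "Src A h = cylW C" "Trg A h = Trg A f"
    "h \<cdot>\<^bsub>A\<^esub> cyl0 C = f" "h \<cdot>\<^bsub>A\<^esub> cyl1 C = g"
    using assms(1) by (rule homotopyE)
  show ?thesis using h assms(2,3) by (simp add: H F_A cylinder_typing[OF C] F.D.normalize)
qed

text \<open>Left whiskering with the image of \<open>s\<close> commutes with right whiskering with
  that of \<open>l\<close>. Hence the whiskered 2-cell satisfies the equation that characterizes the
  2-cell of the precomposed cylinder.\<close>

lemma cyl_hat_pre:
  assumes C: "is_cylinder A \<Sigma> X C" and l: "l \<in> hom A V X"
  shows "cyl_hat D F (C\<lparr>cyl0 := cyl0 C \<cdot>\<^bsub>A\<^esub> l, cyl1 := cyl1 C \<cdot>\<^bsub>A\<^esub> l, cylX := cylX C \<cdot>\<^bsub>A\<^esub> l\<rparr>)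
    = rwhisk D (cyl_hat D F C) (FArr F l)"
proof (rule cyl_hat_unique[OF is_cylinder_pre[OF C l]])
  note t = cylinder_typing[OF C]
  have l: "l \<in> Arr A" "Trg A l = X" using l by (auto simp: hom_def)
  show "rwhisk D (cyl_hat D F C) (FArr F l) \<in> hom2 D (FArr F (cyl0 (C\<lparr>cyl0 := cyl0 C \<cdot>\<^bsub>A\<^esub> l, cyl1 := cyl1 C \<cdot>\<^bsub>A\<^esub> l, cylX := cylX C \<cdot>\<^bsub>A\<^esub> l\<rparr>)))
     (FArr F (cyl1 (C\<lparr>cyl0 := cyl0 C \<cdot>\<^bsub>A\<^esub> l, cyl1 := cyl1 C \<cdot>\<^bsub>A\<^esub> l, cylX := cylX C \<cdot>\<^bsub>A\<^esub> l\<rparr>)))"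
    by (simp add: hom2_def l t F_A F.D.typing)
  have "lwhisk D (FArr F (cylS C)) (rwhisk D (cyl_hat D F C) (FArr F l)) =
      rwhisk D (lwhisk D (FArr F (cylS C)) (cyl_hat D F C)) (FArr F l)"
    by (rule F.D.normalize(7)[symmetric]) (simp_all add: l t F_A F.D.typing)
  also have "\<dots> = CId D (FArr F (cylX C \<cdot>\<^bsub>A\<^esub> l))"
    unfolding cyl_hat(2)[OF C] by (simp add: l t F_A F.D.normalize)
  finally show "lwhisk D (FArr F (cylS (C\<lparr>cyl0 := cyl0 C \<cdot>\<^bsub>A\<^esub> l, cyl1 := cyl1 C \<cdot>\<^bsub>A\<^esub> l, cylX := cylX C \<cdot>\<^bsub>A\<^esub> l\<rparr>)))
      (rwhisk D (cyl_hat D F C) (FArr F l)) =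
    CId D (FArr F (cylX (C\<lparr>cyl0 := cyl0 C \<cdot>\<^bsub>A\<^esub> l, cyl1 := cyl1 C \<cdot>\<^bsub>A\<^esub> l, cylX := cylX C \<cdot>\<^bsub>A\<^esub> l\<rparr>)))"
    by simp
qed

lemma homotopy_hat_pre:
  assumes "is_homotopy A \<Sigma> f g H" "l \<in> Arr A" "Trg A l = Src A f"
  shows "homotopy_hat D F (homotopy_pre A H l) = rwhisk D (homotopy_hat D F H) (FArr F l)"
proof -
  obtain C h where H: "H = (C, h)" and C: "is_cylinder A \<Sigma> (Src A f) C" and h: "h \<in> Arr A" "Src A h = cylW C" "Trg A h = Trg A f"
    "h \<cdot>\<^bsub>A\<^esub> cyl0 C = f" "h \<cdot>\<^bsub>A\<^esub> cyl1 C = g"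
    using assms(1) by (rule homotopyE)
  show ?thesis using h assms(2,3) cyl_hat_pre[OF C, of l "Src A l"]
    by (simp add: H F_A cylinder_typing[OF C] F.D.normalize F.D.typing hom_def)
qed

lemma seq_hat_post:
  assumes "homotopy_seq A \<Sigma> f g Hs" "r \<in> Arr A" "Src A r = Trg A f"
  shows "seq_hat D F (map (homotopy_post A r) Hs) = lwhisk D (FArr F r) (seq_hat D F Hs)"
  using assms
proof induction
  case (single f g H)
  then show ?case by (simp add: homotopy_hat_post)
next
  case (cons f g Hs k H)
  then show ?case
    using homotopy_hat[OF cons(2)] seq_hat[OF cons(1)] homotopy_seqD[OF cons(1)]
    by (simp add: homotopy_hat_post seq_hat_Cons homotopy_seq_nonempty F.D.normalize F_A)
qed

lemma seq_hat_pre: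
  assumes "homotopy_seq A \<Sigma> f g Hs" "l \<in> Arr A" "Trg A l = Src A f"
  shows "seq_hat D F (map (\<lambda>H. homotopy_pre A H l) Hs) = rwhisk D (seq_hat D F Hs) (FArr F l)"
  using assms
proof induction
  case (single f g H)
  then show ?case by (simp add: homotopy_hat_pre)
next
  case (cons f g Hs k H)
  then show ?case
    using homotopy_hat[OF cons(2)] seq_hat[OF cons(1)] homotopy_seqD[OF cons(1)]
    by (simp add: homotopy_hat_pre seq_hat_Cons homotopy_seq_nonempty F.D.normalize F_A)
qed

text \<open>All arrows of the trivial cylinder are identities, so an identity 2-cell satisfies its
  characterizing equation.\<close>

lemma homotopy_hat_trivial:
  assumes "f \<in> Arr A"
  shows "homotopy_hat D F (trivial_homotopy A f) = CId D (FArr F f)"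
proof -
  let ?X = "Src A f"
  let ?C = "\<lparr>cylW = ?X, cylZ = ?X, cyl0 = Ident A ?X, cyl1 = Ident A ?X, cylS = Ident A ?X, cylX = Ident A ?X\<rparr>"
  have X: "?X \<in> Obj A" using assms Src_in by simp
  have "cyl_hat D F ?C = CId D (FArr F (Ident A ?X))"
    by (rule cyl_hat_unique[OF trivial_cylinder[OF X]])
      (simp_all add: hom2_def F_A X F.D.typing F.D.normalize)
  then show ?thesis
    using assms X by (simp add: trivial_homotopy_def Let_def F_A F.D.typing F.D.normalize)
qed

text \<open>The passage from the test 2-categories to arbitrary \<open>D\<close>: membership in a
  class means equivalence in the tests, and \<open>seq_equiv_all\<close> turns this into equality of
  images in \<open>D\<close>.\<close>

lemma cell_hat_class:
  assumes "homotopy_seq A \<Sigma> f g Hs"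
  shows "cell_hat D F (ho_class A \<Sigma> f g {Hs}) = seq_hat D F Hs"
proof -
  define Ls where "Ls = (SOME Ls. Ls \<in> ho_seqs (ho_class A \<Sigma> f g {Hs}))"
  have "Hs \<in> ho_seqs (ho_class A \<Sigma> f g {Hs})" using assms by (simp add: ho_seqs_singleton seq_equiv_refl)
  then have "Ls \<in> ho_seqs (ho_class A \<Sigma> f g {Hs})" unfolding Ls_def by (rule someI)
  then show ?thesis
    using seq_equiv_all[OF F.two_functor_axioms inverts \<Sigma>_Arr assms, of Ls]
    by (simp add: ho_seqs_singleton cell_hat_def Ls_def)
qed

lemma cell_hat_typing:
  assumes "\<alpha> \<in> Cell (Ho A \<Sigma>)"
  shows "cell_hat D F \<alpha> \<in> Cell D" "Dom D (cell_hat D F \<alpha>) = FArr F (ho_dom \<alpha>)"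
    "Cod D (cell_hat D F \<alpha>) = FArr F (ho_cod \<alpha>)"
proof -
  obtain Hs where "homotopy_seq A \<Sigma> (ho_dom \<alpha>) (ho_cod \<alpha>) Hs" "\<alpha> = ho_class A \<Sigma> (ho_dom \<alpha>) (ho_cod \<alpha>) {Hs}"
    using assms by (rule Cell_HoE)
  then show "cell_hat D F \<alpha> \<in> Cell D" "Dom D (cell_hat D F \<alpha>) = FArr F (ho_dom \<alpha>)"
    "Cod D (cell_hat D F \<alpha>) = FArr F (ho_cod \<alpha>)"
    using cell_hat_class seq_hat by metis+
qed

end

section \<open>Operations on classes do not depend on representatives\<close>

context weak_equivalences
begin

lemma seq_equivI:
  assumes "\<And>(D :: (('o, 'a) code, ('o, 'a) code, ('o, 'a) code) twocat) F.
    inverting_functor A \<Sigma> D F \<Longrightarrow> seq_hat D F Hs = seq_hat D F Ks"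
  shows "seq_equiv A \<Sigma> Hs Ks"
  unfolding seq_equiv_def
  using assms weak_equivalences_axioms by (auto simp: inverting_functor_def inverting_functor_axioms_def)

lemma seq_equivD:
  fixes D :: "(('o, 'a) code, ('o, 'a) code, ('o, 'a) code) twocat"
  assumes "seq_equiv A \<Sigma> Hs Ks" "inverting_functor A \<Sigma> D F"
  shows "seq_hat D F Hs = seq_hat D F Ks"
  using assms by (auto simp: seq_equiv_def inverting_functor_def inverting_functor_axioms_def)

text \<open>The image of a concatenation is the vertical composite of the images, so replacing
  either factor by an equivalent sequence changes nothing. The two whiskerings below are treated in
  the same way.\<close>

lemma vcomp_class:
  assumes Ks: "homotopy_seq A \<Sigma> g h Ks" and Hs: "homotopy_seq A \<Sigma> f g Hs"
  shows "ho_vcomp A \<Sigma> (ho_class A \<Sigma> g h {Ks}) (ho_class A \<Sigma> f g {Hs}) = ho_class A \<Sigma> f h {Ks @ Hs}"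
  unfolding ho_vcomp_def ho_class_simps
proof (rule ho_class_eq)
  show "Ks @ Hs \<in> {Ks' @ Hs' | Ks' Hs'. Ks' \<in> ho_seqs (ho_class A \<Sigma> g h {Ks}) \<and> Hs' \<in> ho_seqs (ho_class A \<Sigma> f g {Hs})}"
    using assms seq_equiv_refl unfolding ho_seqs_singleton by blast
next
  fix Ls assume "Ls \<in> {Ks' @ Hs' | Ks' Hs'. Ks' \<in> ho_seqs (ho_class A \<Sigma> g h {Ks}) \<and> Hs' \<in> ho_seqs (ho_class A \<Sigma> f g {Hs})}"
  then obtain Ks' Hs' where Ls: "Ls = Ks' @ Hs'" "homotopy_seq A \<Sigma> g h Ks'" "homotopy_seq A \<Sigma> f g Hs'"
    "seq_equiv A \<Sigma> Ks Ks'" "seq_equiv A \<Sigma> Hs Hs'"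
    by (auto simp: ho_seqs_singleton)
  show "seq_equiv A \<Sigma> (Ks @ Hs) Ls"
  proof (rule seq_equivI)
    fix D :: "(('o, 'a) code, ('o, 'a) code, ('o, 'a) code) twocat" and F
    assume i: "inverting_functor A \<Sigma> D F"
    interpret inverting_functor A \<Sigma> D F by (rule i)
    show "seq_hat D F (Ks @ Hs) = seq_hat D F Ls"
      using Ls seq_hat_append assms seq_equivD[OF Ls(4) i] seq_equivD[OF Ls(5) i] by metis
  qed
qed

lemma lwhisk_class:
  assumes Hs: "homotopy_seq A \<Sigma> f g Hs" and r: "r \<in> Arr A" "Src A r = Trg A f"
  shows "ho_lwhisk A \<Sigma> r (ho_class A \<Sigma> f g {Hs}) =
    ho_class A \<Sigma> (r \<cdot>\<^bsub>A\<^esub> f) (r \<cdot>\<^bsub>A\<^esub> g) {map (homotopy_post A r) Hs}"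
  unfolding ho_lwhisk_def ho_class_simps
proof (rule ho_class_eq)
  show "map (homotopy_post A r) Hs \<in> map (homotopy_post A r) ` ho_seqs (ho_class A \<Sigma> f g {Hs})"
    using assms seq_equiv_refl by (auto simp: ho_seqs_singleton)
next
  fix Ls assume "Ls \<in> map (homotopy_post A r) ` ho_seqs (ho_class A \<Sigma> f g {Hs})"
  then obtain Hs' where Ls: "Ls = map (homotopy_post A r) Hs'" "homotopy_seq A \<Sigma> f g Hs'" "seq_equiv A \<Sigma> Hs Hs'"
    by (auto simp: ho_seqs_singleton)
  show "seq_equiv A \<Sigma> (map (homotopy_post A r) Hs) Ls"
  proof (rule seq_equivI)
    fix D :: "(('o, 'a) code, ('o, 'a) code, ('o, 'a) code) twocat" and F
    assume i: "inverting_functor A \<Sigma> D F"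
    interpret inverting_functor A \<Sigma> D F by (rule i)
    show "seq_hat D F (map (homotopy_post A r) Hs) = seq_hat D F Ls"
      using seq_hat_post[OF Hs r] seq_hat_post[OF Ls(2) r] seq_equivD[OF Ls(3) i] Ls(1) by simp
  qed
qed

lemma rwhisk_class:
  assumes Hs: "homotopy_seq A \<Sigma> f g Hs" and l: "l \<in> Arr A" "Trg A l = Src A f"
  shows "ho_rwhisk A \<Sigma> (ho_class A \<Sigma> f g {Hs}) l =
    ho_class A \<Sigma> (f \<cdot>\<^bsub>A\<^esub> l) (g \<cdot>\<^bsub>A\<^esub> l) {map (\<lambda>H. homotopy_pre A H l) Hs}"
  unfolding ho_rwhisk_def ho_class_simps
proof (rule ho_class_eq)
  show "map (\<lambda>H. homotopy_pre A H l) Hs \<in> map (\<lambda>H. homotopy_pre A H l) ` ho_seqs (ho_class A \<Sigma> f g {Hs})"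
    using assms seq_equiv_refl by (auto simp: ho_seqs_singleton)
next
  fix Ls assume "Ls \<in> map (\<lambda>H. homotopy_pre A H l) ` ho_seqs (ho_class A \<Sigma> f g {Hs})"
  then obtain Hs' where Ls: "Ls = map (\<lambda>H. homotopy_pre A H l) Hs'" "homotopy_seq A \<Sigma> f g Hs'" "seq_equiv A \<Sigma> Hs Hs'"
    by (auto simp: ho_seqs_singleton)
  show "seq_equiv A \<Sigma> (map (\<lambda>H. homotopy_pre A H l) Hs) Ls"
  proof (rule seq_equivI)
    fix D :: "(('o, 'a) code, ('o, 'a) code, ('o, 'a) code) twocat" and F
    assume i: "inverting_functor A \<Sigma> D F"
    interpret inverting_functor A \<Sigma> D F by (rule i)
    show "seq_hat D F (map (\<lambda>H. homotopy_pre A H l) Hs) = seq_hat D F Ls"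
      using seq_hat_pre[OF Hs l] seq_hat_pre[OF Ls(2) l] seq_equivD[OF Ls(3) i] Ls(1) by simp
  qed
qed

lemma Ho_typing:
  "\<alpha> \<in> Cell (Ho A \<Sigma>) \<Longrightarrow> ho_dom \<alpha> \<in> Arr A" "\<alpha> \<in> Cell (Ho A \<Sigma>) \<Longrightarrow> ho_cod \<alpha> \<in> Arr A"
  "\<alpha> \<in> Cell (Ho A \<Sigma>) \<Longrightarrow> Src A (ho_cod \<alpha>) = Src A (ho_dom \<alpha>)"
  "\<alpha> \<in> Cell (Ho A \<Sigma>) \<Longrightarrow> Trg A (ho_cod \<alpha>) = Trg A (ho_dom \<alpha>)"
  using homotopy_seqD by (auto elim: Cell_HoE)

lemma Ho_ops_in:
  "f \<in> Arr A \<Longrightarrow> ho_class A \<Sigma> f f {[trivial_homotopy A f]} \<in> Cell (Ho A \<Sigma>)"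
  "\<alpha> \<in> Cell (Ho A \<Sigma>) \<Longrightarrow> \<beta> \<in> Cell (Ho A \<Sigma>) \<Longrightarrow> ho_cod \<alpha> = ho_dom \<beta> \<Longrightarrow> ho_vcomp A \<Sigma> \<beta> \<alpha> \<in> Cell (Ho A \<Sigma>)"
  "\<alpha> \<in> Cell (Ho A \<Sigma>) \<Longrightarrow> r \<in> Arr A \<Longrightarrow> Src A r = Trg A (ho_dom \<alpha>) \<Longrightarrow> ho_lwhisk A \<Sigma> r \<alpha> \<in> Cell (Ho A \<Sigma>)"
  "\<alpha> \<in> Cell (Ho A \<Sigma>) \<Longrightarrow> l \<in> Arr A \<Longrightarrow> Trg A l = Src A (ho_dom \<alpha>) \<Longrightarrow> ho_rwhisk A \<Sigma> \<alpha> l \<in> Cell (Ho A \<Sigma>)"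
proof -
  show "ho_class A \<Sigma> f f {[trivial_homotopy A f]} \<in> Cell (Ho A \<Sigma>)" if "f \<in> Arr A"
    using that by (intro Cell_HoI homotopy_seq.single is_homotopy_trivial)
  show "ho_vcomp A \<Sigma> \<beta> \<alpha> \<in> Cell (Ho A \<Sigma>)"
    if a: "\<alpha> \<in> Cell (Ho A \<Sigma>)" and b: "\<beta> \<in> Cell (Ho A \<Sigma>)" and eq: "ho_cod \<alpha> = ho_dom \<beta>"
  proof -
    obtain Hs where Hs: "homotopy_seq A \<Sigma> (ho_dom \<alpha>) (ho_cod \<alpha>) Hs" "\<alpha> = ho_class A \<Sigma> (ho_dom \<alpha>) (ho_cod \<alpha>) {Hs}"
      using a by (rule Cell_HoE)
    obtain Ks where Ks: "homotopy_seq A \<Sigma> (ho_cod \<alpha>) (ho_cod \<beta>) Ks" "\<beta> = ho_class A \<Sigma> (ho_cod \<alpha>) (ho_cod \<beta>) {Ks}"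
      using b unfolding eq by (rule Cell_HoE)
    show ?thesis
      using vcomp_class[OF Ks(1) Hs(1)] Cell_HoI[OF homotopy_seq_append[OF Ks(1) Hs(1)]] Hs(2) Ks(2) by simp
  qed
  show "ho_lwhisk A \<Sigma> r \<alpha> \<in> Cell (Ho A \<Sigma>)" if a: "\<alpha> \<in> Cell (Ho A \<Sigma>)" and r: "r \<in> Arr A" "Src A r = Trg A (ho_dom \<alpha>)"
  proof -
    obtain Hs where Hs: "homotopy_seq A \<Sigma> (ho_dom \<alpha>) (ho_cod \<alpha>) Hs" "\<alpha> = ho_class A \<Sigma> (ho_dom \<alpha>) (ho_cod \<alpha>) {Hs}"
      using a by (rule Cell_HoE)
    show ?thesis using lwhisk_class[OF Hs(1) r] Cell_HoI[OF homotopy_seq_post[OF Hs(1) r]] Hs(2) by simp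
  qed
  show "ho_rwhisk A \<Sigma> \<alpha> l \<in> Cell (Ho A \<Sigma>)" if a: "\<alpha> \<in> Cell (Ho A \<Sigma>)" and l: "l \<in> Arr A" "Trg A l = Src A (ho_dom \<alpha>)"
  proof -
    obtain Hs where Hs: "homotopy_seq A \<Sigma> (ho_dom \<alpha>) (ho_cod \<alpha>) Hs" "\<alpha> = ho_class A \<Sigma> (ho_dom \<alpha>) (ho_cod \<alpha>) {Hs}"
      using a by (rule Cell_HoE)
    show ?thesis using rwhisk_class[OF Hs(1) l] Cell_HoI[OF homotopy_seq_pre[OF Hs(1) l]] Hs(2) by simp
  qed
qed

lemma Ho_ops_dom_cod [simp]:
  "ho_dom (ho_vcomp A \<Sigma> \<beta> \<alpha>) = ho_dom \<alpha>" "ho_cod (ho_vcomp A \<Sigma> \<beta> \<alpha>) = ho_cod \<beta>"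
  "ho_dom (ho_lwhisk A \<Sigma> r \<alpha>) = r \<cdot>\<^bsub>A\<^esub> ho_dom \<alpha>" "ho_cod (ho_lwhisk A \<Sigma> r \<alpha>) = r \<cdot>\<^bsub>A\<^esub> ho_cod \<alpha>"
  "ho_dom (ho_rwhisk A \<Sigma> \<alpha> l) = ho_dom \<alpha> \<cdot>\<^bsub>A\<^esub> l" "ho_cod (ho_rwhisk A \<Sigma> \<alpha> l) = ho_cod \<alpha> \<cdot>\<^bsub>A\<^esub> l"
  by (simp_all add: ho_vcomp_def ho_lwhisk_def ho_rwhisk_def)

text \<open>This lemma and the next keep \<open>CId\<close> and \<open>HComp\<close> folded, for
  proofs that remove \<open>CId_Ho\<close> and \<open>HComp_Ho\<close> from the simpset and argue
  without looking at sequences.\<close>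

lemma CId_Ho_in:
  "f \<in> Arr A \<Longrightarrow> CId (Ho A \<Sigma>) f \<in> Cell (Ho A \<Sigma>)" "ho_dom (CId (Ho A \<Sigma>) f) = f" "ho_cod (CId (Ho A \<Sigma>) f) = f"
  by (simp_all add: Ho_ops_in)

lemma HComp_Ho_in:
  assumes "\<alpha> \<in> Cell (Ho A \<Sigma>)" "\<beta> \<in> Cell (Ho A \<Sigma>)" "Trg A (ho_dom \<alpha>) = Src A (ho_dom \<beta>)"
  shows "\<beta> \<star>\<^bsub>Ho A \<Sigma>\<^esub> \<alpha> \<in> Cell (Ho A \<Sigma>)" "ho_dom (\<beta> \<star>\<^bsub>Ho A \<Sigma>\<^esub> \<alpha>) = ho_dom \<beta> \<cdot>\<^bsub>A\<^esub> ho_dom \<alpha>"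
    "ho_cod (\<beta> \<star>\<^bsub>Ho A \<Sigma>\<^esub> \<alpha>) = ho_cod \<beta> \<cdot>\<^bsub>A\<^esub> ho_cod \<alpha>"
  using assms by (simp_all add: Ho_ops_in Ho_typing)

end

context inverting_functor
begin

lemma cell_hat_CId: "f \<in> Arr A \<Longrightarrow> cell_hat D F (CId (Ho A \<Sigma>) f) = CId D (FArr F f)"
  using cell_hat_class[OF homotopy_seq.single[OF is_homotopy_trivial]] homotopy_hat_trivial by simp

lemma cell_hat_VComp:
  assumes "\<alpha> \<in> Cell (Ho A \<Sigma>)" "\<beta> \<in> Cell (Ho A \<Sigma>)" "ho_cod \<alpha> = ho_dom \<beta>"
  shows "cell_hat D F (ho_vcomp A \<Sigma> \<beta> \<alpha>) = cell_hat D F \<beta> \<bullet>\<^bsub>D\<^esub> cell_hat D F \<alpha>"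
proof -
  obtain Hs where Hs: "homotopy_seq A \<Sigma> (ho_dom \<alpha>) (ho_cod \<alpha>) Hs" "\<alpha> = ho_class A \<Sigma> (ho_dom \<alpha>) (ho_cod \<alpha>) {Hs}"
    using assms(1) by (rule Cell_HoE)
  obtain Ks where Ks: "homotopy_seq A \<Sigma> (ho_dom \<beta>) (ho_cod \<beta>) Ks" "\<beta> = ho_class A \<Sigma> (ho_dom \<beta>) (ho_cod \<beta>) {Ks}"
    using assms(2) by (rule Cell_HoE)
  have Ks': "homotopy_seq A \<Sigma> (ho_cod \<alpha>) (ho_cod \<beta>) Ks" using Ks(1) assms(3) by simp
  show ?thesis
    using cell_hat_class[OF Hs(1)] cell_hat_class[OF Ks(1)] cell_hat_class[OF homotopy_seq_append[OF Ks' Hs(1)]]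
      vcomp_class[OF Ks' Hs(1)] seq_hat_append[OF Ks' Hs(1)] assms(3) Hs(2) Ks(2) by simp
qed

lemma cell_hat_lwhisk:
  assumes "\<alpha> \<in> Cell (Ho A \<Sigma>)" "r \<in> Arr A" "Src A r = Trg A (ho_dom \<alpha>)"
  shows "cell_hat D F (ho_lwhisk A \<Sigma> r \<alpha>) = lwhisk D (FArr F r) (cell_hat D F \<alpha>)"
proof -
  obtain Hs where Hs: "homotopy_seq A \<Sigma> (ho_dom \<alpha>) (ho_cod \<alpha>) Hs" "\<alpha> = ho_class A \<Sigma> (ho_dom \<alpha>) (ho_cod \<alpha>) {Hs}"
    using assms(1) by (rule Cell_HoE)
  show ?thesis
    using cell_hat_class[OF Hs(1)] cell_hat_class[OF homotopy_seq_post[OF Hs(1) assms(2,3)]]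
      lwhisk_class[OF Hs(1) assms(2,3)] seq_hat_post[OF Hs(1) assms(2,3)] Hs(2) by simp
qed

lemma cell_hat_rwhisk:
  assumes "\<alpha> \<in> Cell (Ho A \<Sigma>)" "l \<in> Arr A" "Trg A l = Src A (ho_dom \<alpha>)"
  shows "cell_hat D F (ho_rwhisk A \<Sigma> \<alpha> l) = rwhisk D (cell_hat D F \<alpha>) (FArr F l)"
proof -
  obtain Hs where Hs: "homotopy_seq A \<Sigma> (ho_dom \<alpha>) (ho_cod \<alpha>) Hs" "\<alpha> = ho_class A \<Sigma> (ho_dom \<alpha>) (ho_cod \<alpha>) {Hs}"
    using assms(1) by (rule Cell_HoE)
  show ?thesis
    using cell_hat_class[OF Hs(1)] cell_hat_class[OF homotopy_seq_pre[OF Hs(1) assms(2,3)]]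
      rwhisk_class[OF Hs(1) assms(2,3)] seq_hat_pre[OF Hs(1) assms(2,3)] Hs(2) by simp
qed

text \<open>The composite in \<open>Ho A \<Sigma>\<close> is by definition a right whiskering after
  a left one, and the same decomposition of a horizontal composite holds in
  \<open>D\<close>.\<close>

lemma cell_hat_HComp:
  assumes "\<alpha> \<in> Cell (Ho A \<Sigma>)" "\<beta> \<in> Cell (Ho A \<Sigma>)" "Trg A (ho_dom \<alpha>) = Src A (ho_dom \<beta>)"
  shows "cell_hat D F (\<beta> \<star>\<^bsub>Ho A \<Sigma>\<^esub> \<alpha>) = cell_hat D F \<beta> \<star>\<^bsub>D\<^esub> cell_hat D F \<alpha>"
  using assms F.D.HComp_left_right[of "cell_hat D F \<alpha>" "cell_hat D F \<beta>"]
  by (simp add: cell_hat_VComp cell_hat_lwhisk cell_hat_rwhisk cell_hat_typing Ho_ops_in Ho_typing F_A)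

end

section \<open>The 2-category axioms for homotopy classes\<close>

context weak_equivalences
begin

text \<open>Joint faithfulness of the maps \<open>cell_hat D F\<close>. Only test 2-categories occur
  in the premise, since the definition of \<open>seq_equiv\<close> refers to nothing else.\<close>

lemma Ho_cell_eqI:
  assumes "\<alpha> \<in> Cell (Ho A \<Sigma>)" "\<beta> \<in> Cell (Ho A \<Sigma>)" "ho_dom \<alpha> = ho_dom \<beta>" "ho_cod \<alpha> = ho_cod \<beta>"
    and "\<And>(D :: (('o, 'a) code, ('o, 'a) code, ('o, 'a) code) twocat) F.
      inverting_functor A \<Sigma> D F \<Longrightarrow> cell_hat D F \<alpha> = cell_hat D F \<beta>"
  shows "\<alpha> = \<beta>"
proof -
  obtain Hs where Hs: "homotopy_seq A \<Sigma> (ho_dom \<alpha>) (ho_cod \<alpha>) Hs" "\<alpha> = ho_class A \<Sigma> (ho_dom \<alpha>) (ho_cod \<alpha>) {Hs}"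
    using assms(1) by (rule Cell_HoE)
  obtain Ks where Ks: "homotopy_seq A \<Sigma> (ho_dom \<beta>) (ho_cod \<beta>) Ks" "\<beta> = ho_class A \<Sigma> (ho_dom \<beta>) (ho_cod \<beta>) {Ks}"
    using assms(2) by (rule Cell_HoE)
  have "seq_equiv A \<Sigma> Hs Ks"
  proof (rule seq_equivI)
    fix D :: "(('o, 'a) code, ('o, 'a) code, ('o, 'a) code) twocat" and F
    assume i: "inverting_functor A \<Sigma> D F"
    show "seq_hat D F Hs = seq_hat D F Ks"
      using inverting_functor.cell_hat_class[OF i Hs(1)] inverting_functor.cell_hat_class[OF i Ks(1)]
        assms(5)[OF i] Hs(2) Ks(2) by simp
  qed
  then have "seq_equiv A \<Sigma> Hs Ls \<longleftrightarrow> seq_equiv A \<Sigma> Ks Ls" for Ls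
    using seq_equiv_trans seq_equiv_sym by blast
  then have "ho_class A \<Sigma> (ho_dom \<alpha>) (ho_cod \<alpha>) {Hs} = ho_class A \<Sigma> (ho_dom \<alpha>) (ho_cod \<alpha>) {Ks}"
    by (simp add: ho_class_def)
  then show ?thesis using Hs(2) Ks(2) assms(3,4) by simp
qed

text \<open>For each equation between 2-cells the endpoints agree by computation in
  \<open>A\<close>, and the images agree by the corresponding axiom of the test 2-category. The
  other goals are typing conditions or laws of the category \<open>A\<close>.\<close>

sublocale Ho: two_category "Ho A \<Sigma>"
proof (unfold_locales, goal_cases)
  case (14 \<alpha> f g)
  then have t: "\<alpha> \<in> Cell (Ho A \<Sigma>)" "ho_dom \<alpha> = f" "ho_cod \<alpha> = g" by (auto simp: hom2_def)
  show ?case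
  proof (rule Ho_cell_eqI, goal_cases)
    case (5 D F)
    then interpret inverting_functor A \<Sigma> D F .
    show ?case using t Ho_typing[OF t(1)] cell_hat_CId[of g]
      by (simp add: cell_hat_VComp Ho_ops_in cell_hat_typing F.D.normalize)
  qed (use t Ho_typing[OF t(1)] in \<open>auto simp: Ho_ops_in\<close>)
next
  case (15 \<alpha> f g)
  then have t: "\<alpha> \<in> Cell (Ho A \<Sigma>)" "ho_dom \<alpha> = f" "ho_cod \<alpha> = g" by (auto simp: hom2_def)
  show ?case
  proof (rule Ho_cell_eqI, goal_cases)
    case (5 D F)
    then interpret inverting_functor A \<Sigma> D F .
    show ?case using t Ho_typing[OF t(1)] cell_hat_CId[of f]
      by (simp add: cell_hat_VComp Ho_ops_in cell_hat_typing F.D.normalize)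
  qed (use t Ho_typing[OF t(1)] in \<open>auto simp: Ho_ops_in\<close>)
next
  case (16 \<alpha> f g \<beta> h \<gamma> k)
  then have t: "\<alpha> \<in> Cell (Ho A \<Sigma>)" "\<beta> \<in> Cell (Ho A \<Sigma>)" "\<gamma> \<in> Cell (Ho A \<Sigma>)" "ho_cod \<alpha> = ho_dom \<beta>" "ho_cod \<beta> = ho_dom \<gamma>"
    by (auto simp: hom2_def)
  show ?case
  proof (rule Ho_cell_eqI, goal_cases)
    case (5 D F)
    then interpret inverting_functor A \<Sigma> D F .
    show ?case using t by (simp add: cell_hat_VComp Ho_ops_in cell_hat_typing F.D.normalize)
  qed (use t in \<open>auto simp: Ho_ops_in\<close>)
next
  case (18 \<alpha> f f')
  then have t: "\<alpha> \<in> Cell (Ho A \<Sigma>)" "ho_dom \<alpha> = f" "ho_cod \<alpha> = f'" by (auto simp: hom2_def)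
  note d = Ho_typing[OF t(1)] Trg_in[OF Ho_typing(1)[OF t(1)]] Ident_in
    Comp_Ident_left[of "ho_dom \<alpha>" "Src A f" "Trg A f"] Comp_Ident_left[of "ho_cod \<alpha>" "Src A f" "Trg A f"]
  have I: "CId (Ho A \<Sigma>) (Ident A (Trg A f)) \<in> Cell (Ho A \<Sigma>)"
    "Trg A f = Src A (Ident A (Trg A f))"
    using d t by (auto simp: Ho_ops_in hom_def)
  show ?case
  proof (rule Ho_cell_eqI, goal_cases)
    case (5 D F)
    then interpret inverting_functor A \<Sigma> D F .
    show ?case using t d I cell_hat_CId[of "Ident A (Trg A f)"] cell_hat_HComp[of \<alpha> "CId (Ho A \<Sigma>) (Ident A (Trg A f))"]
      by (simp add: cell_hat_typing F.D.normalize F_A hom_def CId_Ho_in del: CId_Ho HComp_Ho)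
  qed (use t d I HComp_Ho_in[of \<alpha> "CId (Ho A \<Sigma>) (Ident A (Trg A f))"] in
      \<open>auto simp: hom_def CId_Ho_in simp del: CId_Ho HComp_Ho\<close>)
next
  case (19 \<alpha> f f')
  then have t: "\<alpha> \<in> Cell (Ho A \<Sigma>)" "ho_dom \<alpha> = f" "ho_cod \<alpha> = f'" by (auto simp: hom2_def)
  note d = Ho_typing[OF t(1)] Src_in[OF Ho_typing(1)[OF t(1)]] Ident_in
    Comp_Ident_right[of "ho_dom \<alpha>" "Src A f" "Trg A f"] Comp_Ident_right[of "ho_cod \<alpha>" "Src A f" "Trg A f"]
  have I: "CId (Ho A \<Sigma>) (Ident A (Src A f)) \<in> Cell (Ho A \<Sigma>)"
    "Trg A (Ident A (Src A f)) = Src A f"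
    using d t by (auto simp: Ho_ops_in hom_def)
  show ?case
  proof (rule Ho_cell_eqI, goal_cases)
    case (5 D F)
    then interpret inverting_functor A \<Sigma> D F .
    show ?case using t d I cell_hat_CId[of "Ident A (Src A f)"] cell_hat_HComp[of "CId (Ho A \<Sigma>) (Ident A (Src A f))" \<alpha>]
      by (simp add: cell_hat_typing F.D.normalize F_A hom_def CId_Ho_in del: CId_Ho HComp_Ho)
  qed (use t d I HComp_Ho_in[of "CId (Ho A \<Sigma>) (Ident A (Src A f))" \<alpha>] in
      \<open>auto simp: hom_def CId_Ho_in simp del: CId_Ho HComp_Ho\<close>)
next
  case (20 \<alpha> f f' \<beta> g g' \<gamma> h h')
  then have t: "\<alpha> \<in> Cell (Ho A \<Sigma>)" "\<beta> \<in> Cell (Ho A \<Sigma>)" "\<gamma> \<in> Cell (Ho A \<Sigma>)"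
    "Trg A (ho_dom \<alpha>) = Src A (ho_dom \<beta>)" "Trg A (ho_dom \<beta>) = Src A (ho_dom \<gamma>)"
    by (auto simp: hom2_def)
  note d = Ho_typing[OF t(1)] Ho_typing[OF t(2)] Ho_typing[OF t(3)]
  have c: "(r \<cdot>\<^bsub>A\<^esub> q) \<cdot>\<^bsub>A\<^esub> p = r \<cdot>\<^bsub>A\<^esub> (q \<cdot>\<^bsub>A\<^esub> p)" "q \<cdot>\<^bsub>A\<^esub> p \<in> Arr A" "Src A (q \<cdot>\<^bsub>A\<^esub> p) = Src A p" "Trg A (q \<cdot>\<^bsub>A\<^esub> p) = Trg A q"
    if "p \<in> Arr A" "q \<in> Arr A" "r \<in> Arr A" "Trg A p = Src A q" "Trg A q = Src A r" for p q r
    using that Comp_assoc[of p "Src A p" "Trg A p" q "Trg A q" r "Trg A r"] Comp_in[of p "Src A p" "Trg A p" q "Trg A q"]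
    by (auto simp: hom_def)
  have c': "Src A (q \<cdot>\<^bsub>A\<^esub> p) = Src A p" "Trg A (q \<cdot>\<^bsub>A\<^esub> p) = Trg A q"
    if "p \<in> Arr A" "q \<in> Arr A" "Trg A p = Src A q" for p q
    using that Comp_in[of p "Src A p" "Trg A p" q "Trg A q"] by (auto simp: hom_def)
  note s = t d c c' HComp_Ho_in
  show ?case
  proof (rule Ho_cell_eqI, goal_cases)
    case (5 D F)
    then interpret inverting_functor A \<Sigma> D F .
    show ?case by (simp add: s cell_hat_HComp cell_hat_typing F.D.normalize F_A del: CId_Ho HComp_Ho)
  qed (simp_all add: s del: CId_Ho HComp_Ho)
next
  case (21 f X Y g Z)
  then have t: "f \<in> Arr A" "g \<in> Arr A" "Trg A f = Src A g" "g \<cdot>\<^bsub>A\<^esub> f \<in> Arr A"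
    using Comp_in[of f X Y g Z] by (auto simp: hom_def)
  show ?case
  proof (rule Ho_cell_eqI, goal_cases)
    case (5 D F)
    then interpret inverting_functor A \<Sigma> D F .
    show ?case by (simp add: t CId_Ho_in cell_hat_CId cell_hat_HComp F.D.normalize F_A del: CId_Ho HComp_Ho)
  qed (simp_all add: t CId_Ho_in HComp_Ho_in del: CId_Ho HComp_Ho)
next
  case (22 \<alpha> f f' \<alpha>' f'' \<beta> g g' \<beta>' g'')
  then have t: "\<alpha> \<in> Cell (Ho A \<Sigma>)" "\<beta> \<in> Cell (Ho A \<Sigma>)" "\<alpha>' \<in> Cell (Ho A \<Sigma>)" "\<beta>' \<in> Cell (Ho A \<Sigma>)"
    "ho_cod \<alpha> = ho_dom \<alpha>'" "ho_cod \<beta> = ho_dom \<beta>'" "Trg A (ho_dom \<alpha>) = Src A (ho_dom \<beta>)"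
    by (auto simp: hom2_def)
  have d: "Trg A (ho_dom \<alpha>') = Src A (ho_dom \<beta>')"
    using Ho_typing[OF t(1)] Ho_typing[OF t(2)] t by simp
  show ?case
  proof (rule Ho_cell_eqI, goal_cases)
    case (5 D F)
    then interpret inverting_functor A \<Sigma> D F .
    have "(cell_hat D F \<beta>' \<bullet>\<^bsub>D\<^esub> cell_hat D F \<beta>) \<star>\<^bsub>D\<^esub> (cell_hat D F \<alpha>' \<bullet>\<^bsub>D\<^esub> cell_hat D F \<alpha>) =
        (cell_hat D F \<beta>' \<star>\<^bsub>D\<^esub> cell_hat D F \<alpha>') \<bullet>\<^bsub>D\<^esub> (cell_hat D F \<beta> \<star>\<^bsub>D\<^esub> cell_hat D F \<alpha>)"
      by (rule F.D.interchange[where f = "FArr F (ho_dom \<alpha>)" and g = "FArr F (ho_dom \<beta>)"])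
        (use t Ho_typing(1)[OF t(1)] Ho_typing(1)[OF t(2)] in \<open>simp_all add: hom2_def cell_hat_typing F_A\<close>)
    then show ?case by (simp add: t d HComp_Ho_in Ho_ops_in cell_hat_HComp cell_hat_VComp del: CId_Ho HComp_Ho)
  qed (simp_all add: t d HComp_Ho_in Ho_ops_in del: CId_Ho HComp_Ho)
next
  case (17 \<alpha> f f' \<beta> g g')
  then show ?case using HComp_Ho_in[of \<alpha> \<beta>] by (auto simp: hom2_def)
qed (auto simp: hom2_def Src_in Trg_in Ident_in Comp_Ident_left Comp_Ident_right Ho_typing Ho_ops_in
    intro: Comp_in Comp_assoc)

end

section \<open>The universal property\<close>

text \<open>The uniqueness half of \<open>equivalence_fully_faithful\<close>, with endpoints given
  by \<open>Dom\<close> and \<open>Cod\<close>.\<close>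

lemma (in two_category) equivalence_faithful:
  assumes "is_equivalence C s" "\<alpha> \<in> Cell C" "\<beta> \<in> Cell C" "Dom C \<alpha> = Dom C \<beta>" "Cod C \<alpha> = Cod C \<beta>"
    "Trg C (Dom C \<beta>) = Src C s" "lwhisk C s \<alpha> = lwhisk C s \<beta>"
  shows "\<alpha> = \<beta>"
proof -
  let ?X = "Src C (Dom C \<beta>)"
  have s: "s \<in> Arr C" using assms(1) by (simp add: is_equivalence_def)
  have "Dom C \<beta> \<in> hom C ?X (Src C s)" "Cod C \<beta> \<in> hom C ?X (Src C s)"
    using assms by (simp_all add: hom_def typing)
  moreover have "lwhisk C s \<beta> \<in> hom2 C (s \<cdot> Dom C \<beta>) (s \<cdot> Cod C \<beta>)"
    using assms s by (simp add: hom2_def typing)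
  ultimately have "\<exists>!\<gamma>. \<gamma> \<in> hom2 C (Dom C \<beta>) (Cod C \<beta>) \<and> lwhisk C s \<gamma> = lwhisk C s \<beta>"
    by (rule equivalence_fully_faithful[OF assms(1)])
  moreover have "\<alpha> \<in> hom2 C (Dom C \<beta>) (Cod C \<beta>)" "\<beta> \<in> hom2 C (Dom C \<beta>) (Cod C \<beta>)"
    using assms by (simp_all add: hom2_def)
  ultimately show ?thesis using assms(7) by blast
qed

lemma two_category_disc:
  assumes "category A"
  shows "two_category (disc A)"
proof -
  interpret category A by fact
  have c: "f \<in> Arr A \<Longrightarrow> Ident A (Trg A f) \<cdot>\<^bsub>A\<^esub> f = f" "f \<in> Arr A \<Longrightarrow> f \<cdot>\<^bsub>A\<^esub> Ident A (Src A f) = f" for f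
    using Comp_Ident_left[of f "Src A f" "Trg A f"] Comp_Ident_right[of f "Src A f" "Trg A f"]
    by (simp_all add: hom_def)
  have a: "(h \<cdot>\<^bsub>A\<^esub> g) \<cdot>\<^bsub>A\<^esub> f = h \<cdot>\<^bsub>A\<^esub> (g \<cdot>\<^bsub>A\<^esub> f)" "g \<cdot>\<^bsub>A\<^esub> f \<in> Arr A"
    if "f \<in> Arr A" "g \<in> Arr A" "h \<in> Arr A" "Trg A f = Src A g" "Trg A g = Src A h" for f g h
    using that Comp_assoc[of f "Src A f" "Trg A f" g "Trg A g" h "Trg A h"]
      Comp_in[of f "Src A f" "Trg A f" g "Trg A g"] by (auto simp: hom_def)
  have a': "g \<cdot>\<^bsub>A\<^esub> f \<in> Arr A" if "f \<in> Arr A" "g \<in> Arr A" "Trg A f = Src A g" for f g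
    using that Comp_in[of f "Src A f" "Trg A f" g "Trg A g"] by (auto simp: hom_def)
  show ?thesis
    by unfold_locales
      (auto simp: hom2_def Src_in Trg_in Ident_in Comp_Ident_left Comp_Ident_right c a a'
        intro: Comp_in Comp_assoc)
qed

section \<open>The inclusion and its effect on weak equivalences\<close>

context weak_equivalences
begin

lemma ho_incl_simps [simp]:
  "X \<in> Obj A \<Longrightarrow> FObj (ho_incl A \<Sigma>) X = X" "f \<in> Arr A \<Longrightarrow> FArr (ho_incl A \<Sigma>) f = f"
  "f \<in> Arr A \<Longrightarrow> FCell (ho_incl A \<Sigma>) f = CId (Ho A \<Sigma>) f"
  by (simp_all add: ho_incl_def)

lemma two_functor_ho_incl: "two_functor (disc A) (Ho A \<Sigma>) (ho_incl A \<Sigma>)"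
proof -
  have c: "CId (Ho A \<Sigma>) g \<star>\<^bsub>Ho A \<Sigma>\<^esub> CId (Ho A \<Sigma>) f = CId (Ho A \<Sigma>) (g \<cdot>\<^bsub>A\<^esub> f)" "g \<cdot>\<^bsub>A\<^esub> f \<in> Arr A"
    if "f \<in> Arr A" "g \<in> Arr A" "Trg A f = Src A g" for f g
    using that Ho.unit_assoc(10)[of f g] Ho.typing(6)[of f g] by (simp_all del: CId_Ho HComp_Ho)
  \<comment> \<open>In \<open>disc A\<close> only equal arrows are vertically composable, with
    composite that same arrow, so preservation of vertical composition amounts to this
    idempotence.\<close>
  have v: "CId (Ho A \<Sigma>) f \<bullet>\<^bsub>Ho A \<Sigma>\<^esub> CId (Ho A \<Sigma>) f = CId (Ho A \<Sigma>) f" if "f \<in> Arr A" for f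
    using that Ho.unit_assoc(4)[of "CId (Ho A \<Sigma>) f" f] CId_Ho_in by (simp del: VComp_Ho CId_Ho HComp_Ho)
  have I: "Ident A X \<in> Arr A" if "X \<in> Obj A" for X using Ident_in[OF that] by (simp add: hom_def)
  show ?thesis
  proof (rule two_functorI)
    show "FObj (ho_incl A \<Sigma>) \<in> Obj (disc A) \<rightarrow>\<^sub>E Obj (Ho A \<Sigma>)"
      "FArr (ho_incl A \<Sigma>) \<in> Arr (disc A) \<rightarrow>\<^sub>E Arr (Ho A \<Sigma>)"
      "FCell (ho_incl A \<Sigma>) \<in> Cell (disc A) \<rightarrow>\<^sub>E Cell (Ho A \<Sigma>)"
      using CId_Ho_in by (auto simp: ho_incl_def simp del: CId_Ho)
  qed (simp_all add: two_category_disc category_axioms Ho.two_category_axioms Src_in Trg_in c v I CId_Ho_in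
      del: VComp_Ho CId_Ho HComp_Ho)
qed

lemma homotopy_iso:
  assumes H: "is_homotopy A \<Sigma> f g H"
  shows "ho_class A \<Sigma> f g {[H]} \<in> iso_hom2 (Ho A \<Sigma>) f g"
proof -
  obtain C h where eq: "H = (C, h)" by (cases H)
  define H' where "H' = (C\<lparr>cyl0 := cyl1 C, cyl1 := cyl0 C\<rparr>, h)"
  have H': "is_homotopy A \<Sigma> g f H'"
    using H by (auto simp: eq H'_def is_cylinder_def hom_def)
  define \<alpha> \<beta> where "\<alpha> = ho_class A \<Sigma> f g {[H]}" and "\<beta> = ho_class A \<Sigma> g f {[H']}"
  have \<alpha>\<beta>: "\<alpha> \<in> Cell (Ho A \<Sigma>)" "\<beta> \<in> Cell (Ho A \<Sigma>)" "ho_dom \<alpha> = f" "ho_cod \<alpha> = g" "ho_dom \<beta> = g" "ho_cod \<beta> = f"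
    using H H' by (auto simp: \<alpha>_def \<beta>_def intro!: Cell_HoI homotopy_seq.single)
  \<comment> \<open>Stated for an arbitrary homotopy so that it also applies to the reversed one:
    exchanging the two ends twice restores \<open>C\<close>, which yields the other inverse
    law.\<close>
  have *: "homotopy_hat D F (C\<lparr>cyl0 := cyl1 C, cyl1 := cyl0 C\<rparr>, h) \<bullet>\<^bsub>D\<^esub> homotopy_hat D F (C, h) = CId D (FArr F f)"
    if "is_homotopy A \<Sigma> f g (C, h)" "inverting_functor A \<Sigma> D F"
    for f g C h and D :: "(('o, 'a) code, ('o, 'a) code, ('o, 'a) code) twocat" and F
  proof -
    let ?C = "C\<lparr>cyl0 := cyl1 C, cyl1 := cyl0 C\<rparr>"
    interpret inverting_functor A \<Sigma> D F by fact
    have C: "is_cylinder A \<Sigma> (Src A f) C" and h: "h \<in> Arr A" "Src A h = cylW C" "Trg A h = Trg A f"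
      "h \<cdot>\<^bsub>A\<^esub> cyl0 C = f" "h \<cdot>\<^bsub>A\<^esub> cyl1 C = g"
      using that(1) by (auto simp: hom_def)
    have C': "is_cylinder A \<Sigma> (Src A f) ?C" using C by (simp add: is_cylinder_def)
    note t = cylinder_typing[OF C] cylinder_typing(15-17)[OF C', simplified] F_A
    have s: "is_equivalence D (FArr F (cylS C))" using C inverts by (simp add: is_cylinder_def inverts_def)
    have e: "lwhisk D (FArr F (cylS C)) (cyl_hat D F ?C) = CId D (FArr F (cylX C))"
      "lwhisk D (FArr F (cylS C)) (cyl_hat D F C) = CId D (FArr F (cylX C))"
      using cyl_hat(2)[OF C] cyl_hat(2)[OF C'] by simp_all
    have c: "FArr F (cylX C) = FArr F (cylS C) \<cdot>\<^bsub>D\<^esub> FArr F (cyl0 C)"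
      using F_A(6)[of "cyl0 C" "cylS C"] t by simp
    \<comment> \<open>Whiskering with the image of \<open>s\<close> turns both 2-cells of the
      cylinders, and hence their composite, into the identity on the image of \<open>x\<close>; this
      whiskering is faithful.\<close>
    have "cyl_hat D F ?C \<bullet>\<^bsub>D\<^esub> cyl_hat D F C = CId D (FArr F (cyl0 C))"
    proof (rule F.D.equivalence_faithful[OF s])
      have "lwhisk D (FArr F (cylS C)) (cyl_hat D F ?C \<bullet>\<^bsub>D\<^esub> cyl_hat D F C) = CId D (FArr F (cylX C))"
        using e by (simp add: t F.D.lwhisk_VComp F.D.typing F.D.unit_assoc)
      also have "\<dots> = lwhisk D (FArr F (cylS C)) (CId D (FArr F (cyl0 C)))"
        by (simp add: t c F.D.unit_assoc)
      finally show "lwhisk D (FArr F (cylS C)) (cyl_hat D F ?C \<bullet>\<^bsub>D\<^esub> cyl_hat D F C) =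
        lwhisk D (FArr F (cylS C)) (CId D (FArr F (cyl0 C)))" .
    qed (simp_all add: t F.D.typing)
    then have "lwhisk D (FArr F h) (cyl_hat D F ?C) \<bullet>\<^bsub>D\<^esub> lwhisk D (FArr F h) (cyl_hat D F C) =
        lwhisk D (FArr F h) (CId D (FArr F (cyl0 C)))"
      using h(1-3) by (simp add: t flip: F.D.lwhisk_VComp)
    also have "\<dots> = CId D (FArr F f)"
      using h F_A(6)[of "cyl0 C" h] t by (simp add: F.D.unit_assoc)
    finally show ?thesis by simp
  qed
  have **: "ho_vcomp A \<Sigma> (ho_class A \<Sigma> g f {[(C\<lparr>cyl0 := cyl1 C, cyl1 := cyl0 C\<rparr>, h)]}) (ho_class A \<Sigma> f g {[(C, h)]})
      = CId (Ho A \<Sigma>) f"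
    if H: "is_homotopy A \<Sigma> f g (C, h)" and H': "is_homotopy A \<Sigma> g f (C\<lparr>cyl0 := cyl1 C, cyl1 := cyl0 C\<rparr>, h)" for f g C h
  proof (rule Ho_cell_eqI)
    fix D :: "(('o, 'a) code, ('o, 'a) code, ('o, 'a) code) twocat" and F
    assume i: "inverting_functor A \<Sigma> D F"
    then interpret inverting_functor A \<Sigma> D F .
    show "cell_hat D F (ho_vcomp A \<Sigma> (ho_class A \<Sigma> g f {[(C\<lparr>cyl0 := cyl1 C, cyl1 := cyl0 C\<rparr>, h)]}) (ho_class A \<Sigma> f g {[(C, h)]}))
      = cell_hat D F (CId (Ho A \<Sigma>) f)"
      using *[OF H i] cell_hat_class[OF homotopy_seq.single[OF H]] cell_hat_class[OF homotopy_seq.single[OF H']]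
        cell_hat_VComp[OF Cell_HoI[OF homotopy_seq.single[OF H]] Cell_HoI[OF homotopy_seq.single[OF H']]]
        cell_hat_CId[OF is_homotopyD(1)[OF H]] by simp
  qed (use Cell_HoI[OF homotopy_seq.single[OF H]] Cell_HoI[OF homotopy_seq.single[OF H']] is_homotopyD(1)[OF H]
      in \<open>auto simp: Ho_ops_in\<close>)
  have "inverse_cells (Ho A \<Sigma>) f g \<alpha> \<beta>"
    using \<alpha>\<beta> **[of f g C h] **[of g f "C\<lparr>cyl0 := cyl1 C, cyl1 := cyl0 C\<rparr>" h] H H'
    by (simp add: inverse_cells_def hom2_def \<alpha>_def \<beta>_def eq H'_def)
  then show ?thesis by (auto simp: iso_hom2_def \<alpha>_def)
qed

text \<open>If \<open>g \<cdot> f = id\<close> with \<open>g \<in> \<Sigma>\<close>, then \<open>g\<close> makes \<open>f \<cdot> g\<close> and \<open>id\<close> the two ends of a cylinder.\<close>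

lemma split_equivalence:
  assumes f: "f \<in> hom A X Y" and g: "g \<in> hom A Y X" and gf: "g \<cdot>\<^bsub>A\<^esub> f = Ident A X" and \<Sigma>: "g \<in> \<Sigma>"
  shows "is_equivalence (Ho A \<Sigma>) f" "is_equivalence (Ho A \<Sigma>) g"
proof -
  have XY: "X \<in> Obj A" "Y \<in> Obj A" using f Src_in Trg_in by (auto simp: hom_def)
  note i = Ident_in[OF XY(1)] Ident_in[OF XY(2)] Comp_in[OF g f]
  have gfg: "g \<cdot>\<^bsub>A\<^esub> (f \<cdot>\<^bsub>A\<^esub> g) = g"
    using Comp_assoc[OF g f g] gf Comp_Ident_left[OF g] by simp
  define H where "H = (\<lparr>cylW = Y, cylZ = X, cyl0 = f \<cdot>\<^bsub>A\<^esub> g, cyl1 = Ident A Y, cylS = g, cylX = g\<rparr>, Ident A Y)"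
  have "is_homotopy A \<Sigma> (f \<cdot>\<^bsub>A\<^esub> g) (Ident A Y) H"
    using i XY g \<Sigma> gfg Comp_Ident_left[OF i(3)] Comp_Ident_left[OF i(2)] Comp_Ident_right[OF g]
    by (auto simp: H_def is_cylinder_def hom_def)
  note h = homotopy_iso[OF this]
  \<comment> \<open>For \<open>f\<close> the homotopy is a counit. For \<open>g\<close> it must
    serve as a unit, which points the other way, so its inverse is extracted.\<close>
  then obtain \<epsilon>' where "inverse_cells (Ho A \<Sigma>) (f \<cdot>\<^bsub>A\<^esub> g) (Ident A Y) (ho_class A \<Sigma> (f \<cdot>\<^bsub>A\<^esub> g) (Ident A Y) {[H]}) \<epsilon>'"
    by (auto simp: iso_hom2_def)
  then have h': "\<epsilon>' \<in> iso_hom2 (Ho A \<Sigma>) (Ident A Y) (f \<cdot>\<^bsub>A\<^esub> g)"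
    by (auto simp: iso_hom2_def inverse_cells_def)
  have I: "CId (Ho A \<Sigma>) (Ident A X) \<in> iso_hom2 (Ho A \<Sigma>) (Ident A X) (Ident A X)"
    using Ho.iso_CId[of "Ident A X"] i by (simp add: hom_def del: CId_Ho)
  show "is_equivalence (Ho A \<Sigma>) f"
    by (rule Ho.equivalenceI[where X = X and Y = Y and g = g]) (use f g gf h I in \<open>auto simp: hom_def simp del: CId_Ho\<close>)
  show "is_equivalence (Ho A \<Sigma>) g"
    by (rule Ho.equivalenceI[where X = Y and Y = X and g = f]) (use f g gf h' I in \<open>auto simp: hom_def simp del: CId_Ho\<close>)
qed

text \<open>Equivalences are closed under composition, so it is enough to treat the split
  factors.\<close>

lemma inverts_ho_incl:
  assumes "two_for_one A \<Sigma>" "\<Sigma> \<subseteq> composites A {f \<in> \<Sigma>. is_split A f}"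
  shows "inverts (Ho A \<Sigma>) \<Sigma> (ho_incl A \<Sigma>)"
proof -
  have s: "is_equivalence (Ho A \<Sigma>) f" if f: "f \<in> \<Sigma>" "is_split A f" for f
  proof -
    have fA: "f \<in> hom A (Src A f) (Trg A f)" using f \<Sigma>_Arr by (auto simp: hom_def)
    from f(2) consider (sec) g where "g \<in> hom A (Trg A f) (Src A f)" "g \<cdot>\<^bsub>A\<^esub> f = Ident A (Src A f)"
      | (ret) g where "g \<in> hom A (Trg A f) (Src A f)" "f \<cdot>\<^bsub>A\<^esub> g = Ident A (Trg A f)"
      by (auto simp: is_split_def is_section_def is_retraction_def)
    then show ?thesis
    proof cases
      case sec
      \<comment> \<open>The cylinder in \<open>split_equivalence\<close> has the retraction as its
        \<open>s\<close>. For a section \<open>f\<close> that is the left inverse \<open>g\<close>,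
        which "2 for 1" puts into \<Sigma>; in the other case it is \<open>f\<close> itself.\<close>
      then have "g \<in> \<Sigma>" using assms(1) f fA by (auto simp: two_for_one_def)
      then show ?thesis using split_equivalence(1)[OF fA sec] by simp
    next
      case ret
      then show ?thesis using split_equivalence(2)[OF ret(1) fA ret(2) f(1)] by simp
    qed
  qed
  have "is_equivalence (Ho A \<Sigma>) f" if "f \<in> composites A {f \<in> \<Sigma>. is_split A f}" for f
    using that
  proof induction
    case (single f)
    then show ?case using s by simp
  next
    case (step f g)
    then show ?case using s[of g] Ho.equivalence_Comp[of f g] by simp
  qed
  then show ?thesis
    unfolding inverts_def using assms(2) \<Sigma>_Arr by (metis ho_incl_simps(2) subsetD)
qed

end

section \<open>Extension and restriction of 2-functors along the inclusion\<close>

locale localizing = weak_equivalences A \<Sigma> + D: two_category D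
  for A :: "('o, 'a) cat" and \<Sigma> and D :: "('p, 'b, 'd) twocat" +
  assumes inverts_incl: "inverts (Ho A \<Sigma>) \<Sigma> (ho_incl A \<Sigma>)"
begin

definition restr :: "('o, 'a, ('o, 'a) ho_cell, 'p, 'b, 'd) tfun \<Rightarrow> ('o, 'a, 'a, 'p, 'b, 'd) tfun" where
  "restr K = comp_tfun (disc A) K (ho_incl A \<Sigma>)"

text \<open>Objects and arrows are those of \<open>A\<close>, so only 2-cells need new values;
  \<open>restrict\<close> provides the extensionality demanded of a 2-functor.\<close>

definition ext :: "('o, 'a, 'a, 'p, 'b, 'd) tfun \<Rightarrow> ('o, 'a, ('o, 'a) ho_cell, 'p, 'b, 'd) tfun" where
  "ext F = \<lparr>FObj = FObj F, FArr = FArr F, FCell = restrict (cell_hat D F) (Cell (Ho A \<Sigma>))\<rparr>"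

lemma restr_simps [simp]:
  "X \<in> Obj A \<Longrightarrow> FObj (restr K) X = FObj K X" "f \<in> Arr A \<Longrightarrow> FArr (restr K) f = FArr K f"
  by (simp_all add: restr_def)

lemma inverting_functorI:
  "two_functor (disc A) D F \<Longrightarrow> inverts D \<Sigma> F \<Longrightarrow> inverting_functor A \<Sigma> D F"
  using weak_equivalences_axioms by (simp add: inverting_functor_def inverting_functor_axioms_def)

text \<open>The inclusion sends \<Sigma> to equivalences, and \<open>K\<close> preserves
  equivalences.\<close>

lemma inverting_restr:
  assumes "two_functor (Ho A \<Sigma>) D K"
  shows "inverting_functor A \<Sigma> D (restr K)"
proof (rule inverting_functorI)
  interpret i: two_functor "disc A" "Ho A \<Sigma>" "ho_incl A \<Sigma>" by (rule two_functor_ho_incl)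
  interpret K: two_functor "Ho A \<Sigma>" D K by fact
  show "two_functor (disc A) D (restr K)" unfolding restr_def by (rule i.two_functor_comp[OF assms])
  show "inverts D \<Sigma> (restr K)"
    using inverts_incl K.equivalence_image \<Sigma>_Arr unfolding inverts_def
    by (metis restr_simps(2) ho_incl_simps(2) subsetD)
qed

text \<open>A homotopy \<open>(C, h)\<close> factors in \<open>Ho A \<Sigma>\<close> as
  \<open>h\<close> whiskered with one 2-cell \<open>a\<close> that depends only on \<open>C\<close>,
  and \<open>s\<close> whiskers \<open>a\<close> to an identity. Applying \<open>K\<close> gives the
  equation characterizing \<open>cyl_hat\<close>; sequences follow by induction.\<close>

lemma FCell_class:
  assumes K: "two_functor (Ho A \<Sigma>) D K" and Hs: "homotopy_seq A \<Sigma> f g Hs"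
  shows "FCell K (ho_class A \<Sigma> f g {Hs}) = seq_hat D (restr K) Hs"
proof -
  interpret K: two_functor "Ho A \<Sigma>" D K by fact
  interpret R: inverting_functor A \<Sigma> D "restr K" by (rule inverting_restr[OF K])
  have hom: "FCell K (ho_class A \<Sigma> f g {[H]}) = homotopy_hat D (restr K) H"
    if H: "is_homotopy A \<Sigma> f g H" for f g H
  proof -
    obtain C h where eq: "H = (C, h)" and C: "is_cylinder A \<Sigma> (Src A f) C" and h: "h \<in> Arr A" "Src A h = cylW C"
      "Trg A h = Trg A f" "h \<cdot>\<^bsub>A\<^esub> cyl0 C = f" "h \<cdot>\<^bsub>A\<^esub> cyl1 C = g"
      using H by (rule R.homotopyE)
    note t = R.cylinder_typing(1-14)[OF C]
    have W: "cylW C \<in> Obj A" using C by (simp add: is_cylinder_def)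
    have IW: "Ident A (cylW C) \<in> Arr A" "Src A (Ident A (cylW C)) = cylW C" "Trg A (Ident A (cylW C)) = cylW C"
      using Ident_in[OF W] by (auto simp: hom_def)
    have IC: "Ident A (cylW C) \<cdot>\<^bsub>A\<^esub> cyl0 C = cyl0 C" "Ident A (cylW C) \<cdot>\<^bsub>A\<^esub> cyl1 C = cyl1 C"
      using Comp_Ident_left[of "cyl0 C" "Src A f" "cylW C"] Comp_Ident_left[of "cyl1 C" "Src A f" "cylW C"] t
      by (simp_all add: hom_def)
    have hC: "is_homotopy A \<Sigma> (cyl0 C) (cyl1 C) (C, Ident A (cylW C))"
      using C IW IC t by (simp add: hom_def)
    \<comment> \<open>The generic 2-cell of the cylinder: taking the identity of \<open>W\<close> as
      \<open>h\<close> gives a homotopy between the two ends themselves.\<close>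
    define a where "a = ho_class A \<Sigma> (cyl0 C) (cyl1 C) {[(C, Ident A (cylW C))]}"
    have a: "a \<in> Cell (Ho A \<Sigma>)" "ho_dom a = cyl0 C" "ho_cod a = cyl1 C"
      using Cell_HoI[OF homotopy_seq.single[OF hC]] by (simp_all add: a_def)
    have hat_a: "cell_hat E F a = cyl_hat E F C" if "inverting_functor A \<Sigma> E F"
      for E :: "(('o, 'a) code, ('o, 'a) code, ('o, 'a) code) twocat" and F
    proof -
      interpret inverting_functor A \<Sigma> E F by fact
      show ?thesis using cell_hat_class[OF homotopy_seq.single[OF hC]] cylinder_typing[OF C] W
        by (simp add: a_def F_A F.D.unit_assoc)
    qed
    have c: "CId (Ho A \<Sigma>) r \<in> Cell (Ho A \<Sigma>)" "CId (Ho A \<Sigma>) r \<star>\<^bsub>Ho A \<Sigma>\<^esub> a \<in> Cell (Ho A \<Sigma>)"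
      "ho_dom (CId (Ho A \<Sigma>) r \<star>\<^bsub>Ho A \<Sigma>\<^esub> a) = r \<cdot>\<^bsub>A\<^esub> cyl0 C" "ho_cod (CId (Ho A \<Sigma>) r \<star>\<^bsub>Ho A \<Sigma>\<^esub> a) = r \<cdot>\<^bsub>A\<^esub> cyl1 C"
      if "r \<in> Arr A" "Src A r = cylW C" for r
      using HComp_Ho_in[of a "CId (Ho A \<Sigma>) r"] CId_Ho_in that a t by (simp_all del: CId_Ho HComp_Ho)
    have hat_ra: "cell_hat E F (CId (Ho A \<Sigma>) r \<star>\<^bsub>Ho A \<Sigma>\<^esub> a) = lwhisk E (FArr F r) (cyl_hat E F C)"
      if i: "inverting_functor A \<Sigma> E F" and r: "r \<in> Arr A" "Src A r = cylW C"
      for E :: "(('o, 'a) code, ('o, 'a) code, ('o, 'a) code) twocat" and F r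
    proof -
      interpret inverting_functor A \<Sigma> E F by fact
      show ?thesis using cell_hat_HComp[of a "CId (Ho A \<Sigma>) r"] cell_hat_CId[of r] c(1)[OF r] r a t hat_a[OF i]
        by (simp add: CId_Ho_in del: CId_Ho HComp_Ho)
    qed
    \<comment> \<open>The defining equation of \<open>cyl_hat\<close> already holds inside
      \<open>Ho A \<Sigma>\<close>, because it holds after every test functor.\<close>
    have sa: "CId (Ho A \<Sigma>) (cylS C) \<star>\<^bsub>Ho A \<Sigma>\<^esub> a = CId (Ho A \<Sigma>) (cylX C)"
    proof (rule Ho_cell_eqI)
      fix E :: "(('o, 'a) code, ('o, 'a) code, ('o, 'a) code) twocat" and F
      assume i: "inverting_functor A \<Sigma> E F"
      then interpret inverting_functor A \<Sigma> E F .
      show "cell_hat E F (CId (Ho A \<Sigma>) (cylS C) \<star>\<^bsub>Ho A \<Sigma>\<^esub> a) = cell_hat E F (CId (Ho A \<Sigma>) (cylX C))"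
        using hat_ra[OF i, of "cylS C"] cyl_hat(2)[OF C] cell_hat_CId[of "cylX C"] t by simp
    qed (use c[of "cylS C"] t CId_Ho_in in \<open>simp_all del: CId_Ho HComp_Ho\<close>)
    have ha: "ho_class A \<Sigma> f g {[H]} = CId (Ho A \<Sigma>) h \<star>\<^bsub>Ho A \<Sigma>\<^esub> a"
    proof (rule Ho_cell_eqI)
      fix E :: "(('o, 'a) code, ('o, 'a) code, ('o, 'a) code) twocat" and F
      assume i: "inverting_functor A \<Sigma> E F"
      then interpret inverting_functor A \<Sigma> E F .
      show "cell_hat E F (ho_class A \<Sigma> f g {[H]}) = cell_hat E F (CId (Ho A \<Sigma>) h \<star>\<^bsub>Ho A \<Sigma>\<^esub> a)"
        using hat_ra[OF i, of h] cell_hat_class[OF homotopy_seq.single[OF H]] h by (simp add: eq)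
    qed (use c[of h] h Cell_HoI[OF homotopy_seq.single[OF H]] in \<open>simp_all del: CId_Ho HComp_Ho\<close>)
    have K_ra: "FCell K (CId (Ho A \<Sigma>) r \<star>\<^bsub>Ho A \<Sigma>\<^esub> a) = lwhisk D (FArr K r) (FCell K a)"
      if "r \<in> Arr A" "Src A r = cylW C" for r
      using K.F_preserves(5)[of a "CId (Ho A \<Sigma>) r"] K.F_preserves(3)[of r] c(1)[OF that] that a t
      by (simp add: CId_Ho_in del: CId_Ho HComp_Ho)
    have "cyl_hat D (restr K) C = FCell K a"
    proof (rule R.cyl_hat_unique[OF C])
      show "FCell K a \<in> hom2 D (FArr (restr K) (cyl0 C)) (FArr (restr K) (cyl1 C))"
        using a t K.F_typing(3,6,7)[of a] by (simp add: hom2_def)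
      show "lwhisk D (FArr (restr K) (cylS C)) (FCell K a) = CId D (FArr (restr K) (cylX C))"
        using K_ra[of "cylS C"] sa K.F_preserves(3)[of "cylX C"] t by (simp del: CId_Ho HComp_Ho)
    qed
    then show ?thesis
      unfolding ha using K_ra[of h] h by (simp add: eq del: CId_Ho HComp_Ho)
  qed
  show ?thesis
    using Hs
  proof induction
    case (single f g H)
    then show ?case using hom by simp
  next
    case (cons f g Hs k H)
    have H: "homotopy_seq A \<Sigma> g k [H]" by (rule homotopy_seq.single[OF cons(2)])
    show ?case
      using vcomp_class[OF H cons(1)] hom[OF cons(2)] cons(3) homotopy_seq_nonempty[OF cons(1)]
        K.F_preserves(4)[of "ho_class A \<Sigma> f g {Hs}" "ho_class A \<Sigma> g k {[H]}"] Cell_HoI[OF H] Cell_HoI[OF cons(1)]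
      by (simp add: seq_hat_Cons)
  qed
qed

lemma FCell_eq:
  assumes "two_functor (Ho A \<Sigma>) D K" "\<alpha> \<in> Cell (Ho A \<Sigma>)"
  shows "FCell K \<alpha> = cell_hat D (restr K) \<alpha>"
proof -
  obtain Hs where Hs: "homotopy_seq A \<Sigma> (ho_dom \<alpha>) (ho_cod \<alpha>) Hs" "\<alpha> = ho_class A \<Sigma> (ho_dom \<alpha>) (ho_cod \<alpha>) {Hs}"
    using assms(2) by (rule Cell_HoE)
  show ?thesis
    using FCell_class[OF assms(1) Hs(1)] inverting_functor.cell_hat_class[OF inverting_restr[OF assms(1)] Hs(1)] Hs(2)
    by simp
qed

lemma two_functor_ext:
  assumes "inverting_functor A \<Sigma> D F"
  shows "two_functor (Ho A \<Sigma>) D (ext F)"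
proof -
  interpret inverting_functor A \<Sigma> D F by fact
  show ?thesis
  proof (rule two_functorI)
    show "FObj (ext F) \<in> Obj (Ho A \<Sigma>) \<rightarrow>\<^sub>E Obj D" "FArr (ext F) \<in> Arr (Ho A \<Sigma>) \<rightarrow>\<^sub>E Arr D"
      "FCell (ext F) \<in> Cell (Ho A \<Sigma>) \<rightarrow>\<^sub>E Cell D"
      using F.FObj_in F.FArr_in cell_hat_typing by (auto simp: ext_def)
  qed (use cell_hat_CId Ho_ops_in in \<open>simp_all add: ext_def F_A Ho.two_category_axioms D.two_category_axioms CId_Ho_in
      cell_hat_typing cell_hat_CId cell_hat_VComp cell_hat_HComp HComp_Ho_in del: CId_Ho HComp_Ho\<close>)
qed

lemma ext_restr: "two_functor (Ho A \<Sigma>) D K \<Longrightarrow> ext (restr K) = K"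
  by (rule tfun_eqI[OF two_functor_ext[OF inverting_restr]])
    (auto simp: FCell_eq, auto simp: ext_def)

text \<open>On 2-cells there is nothing to compare: those of \<open>disc A\<close> are identities,
  and their images are fixed by the images of arrows.\<close>

lemma restr_ext:
  assumes "inverting_functor A \<Sigma> D F"
  shows "restr (ext F) = F"
proof -
  interpret inverting_functor A \<Sigma> D F by fact
  interpret E: inverting_functor A \<Sigma> D "restr (ext F)"
    by (rule inverting_restr[OF two_functor_ext[OF assms]])
  show ?thesis
    by (rule tfun_eqI[OF E.F.two_functor_axioms F.two_functor_axioms])
      (simp_all add: F_cell E.F_cell, simp_all add: ext_def)
qed

end

section \<open>Naturality for homotopies; extension of transformations and modifications\<close>

context localizing
begin

text \<open>These are the arrows of \<open>Hom_p_plus \<Sigma> (disc A) D\<close>.\<close>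

definition inverting_pnt :: "('o, 'a, 'a, 'p, 'b, 'd) pnt \<Rightarrow> bool" where
  "inverting_pnt \<eta> \<longleftrightarrow> pseudonatural (disc A) D \<eta> \<and> inverts D \<Sigma> (PSrc \<eta>) \<and> inverts D \<Sigma> (PTrg \<eta>)"

lemma inverting_pntD:
  assumes "inverting_pnt \<eta>"
  shows "pseudonatural (disc A) D \<eta>" "inverting_functor A \<Sigma> D (PSrc \<eta>)" "inverting_functor A \<Sigma> D (PTrg \<eta>)"
  using assms by (auto simp: inverting_pnt_def pseudonatural_def intro: inverting_functorI)

text \<open>The 2-cells of a cylinder are determined by their composites with \<open>s\<close>, which are identities;
  after composing with \<open>s\<close>, the naturality square reads \<open>\<eta> x = \<eta> x\<close>.\<close>

lemma cylinder_natural: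
  assumes "inverting_pnt \<eta>"
    and C: "is_cylinder A \<Sigma> X C"
  shows "PArr \<eta> (cyl1 C) \<bullet>\<^bsub>D\<^esub> rwhisk D (cyl_hat D (PTrg \<eta>) C) (PObj \<eta> X) =
    lwhisk D (PObj \<eta> (cylW C)) (cyl_hat D (PSrc \<eta>) C) \<bullet>\<^bsub>D\<^esub> PArr \<eta> (cyl0 C)"
proof -
  interpret \<eta>: pseudonatural "disc A" D \<eta> by (rule inverting_pntD[OF assms(1)])
  interpret F: inverting_functor A \<Sigma> D "PSrc \<eta>" by (rule inverting_pntD[OF assms(1)])
  interpret G: inverting_functor A \<Sigma> D "PTrg \<eta>" by (rule inverting_pntD[OF assms(1)])
  note p = \<eta>.P_typing[simplified]
  let ?F = "FArr (PSrc \<eta>)" and ?G = "FArr (PTrg \<eta>)"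
  let ?\<phi> = "cyl_hat D (PSrc \<eta>) C" and ?\<gamma> = "cyl_hat D (PTrg \<eta>) C"
  let ?s = "cylS C" and ?x = "cylX C" and ?W = "cylW C" and ?Z = "cylZ C"
  have O: "X \<in> Obj A" "?W \<in> Obj A" "?Z \<in> Obj A" using C by (auto simp: is_cylinder_def)
  note t = O F.F_A(1-5) G.F_A(1-5) p F.cylinder_typing[OF C] G.cylinder_typing(15-17)[OF C] D.typing
  have Fx: "?F ?s \<cdot>\<^bsub>D\<^esub> ?F (cyl0 C) = ?F ?x" "?F ?s \<cdot>\<^bsub>D\<^esub> ?F (cyl1 C) = ?F ?x"
    and Gx: "?G ?s \<cdot>\<^bsub>D\<^esub> ?G (cyl0 C) = ?G ?x" "?G ?s \<cdot>\<^bsub>D\<^esub> ?G (cyl1 C) = ?G ?x"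
    using F.F_A(6)[of "cyl0 C" ?s] F.F_A(6)[of "cyl1 C" ?s] G.F_A(6)[of "cyl0 C" ?s] G.F_A(6)[of "cyl1 C" ?s]
    by (simp_all add: t)
  have \<eta>x: "PArr \<eta> ?x = rwhisk D (PArr \<eta> ?s) (?F (cyl0 C)) \<bullet>\<^bsub>D\<^esub> lwhisk D (?G ?s) (PArr \<eta> (cyl0 C))"
    "PArr \<eta> ?x = rwhisk D (PArr \<eta> ?s) (?F (cyl1 C)) \<bullet>\<^bsub>D\<^esub> lwhisk D (?G ?s) (PArr \<eta> (cyl1 C))"
    using \<eta>.P_Comp[of "cyl0 C" ?s] \<eta>.P_Comp[of "cyl1 C" ?s] F.cylinder_typing[OF C] by (simp_all add: t)
  define L R where "L = PArr \<eta> (cyl1 C) \<bullet>\<^bsub>D\<^esub> rwhisk D ?\<gamma> (PObj \<eta> X)"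
    and "R = lwhisk D (PObj \<eta> ?W) ?\<phi> \<bullet>\<^bsub>D\<^esub> PArr \<eta> (cyl0 C)"
  have LR: "L \<in> Cell D" "R \<in> Cell D" "Dom D L = ?G (cyl0 C) \<cdot>\<^bsub>D\<^esub> PObj \<eta> X" "Dom D R = ?G (cyl0 C) \<cdot>\<^bsub>D\<^esub> PObj \<eta> X"
    "Cod D L = PObj \<eta> ?W \<cdot>\<^bsub>D\<^esub> ?F (cyl1 C)" "Cod D R = PObj \<eta> ?W \<cdot>\<^bsub>D\<^esub> ?F (cyl1 C)"
    by (simp_all add: L_def R_def t)
  \<comment> \<open>Each side of the square is whiskered with the image of \<open>s\<close> and then
    pasted with the structure 2-cell of \<eta> at \<open>s\<close>. Since \<open>s\<close> composed
    with either end is \<open>x\<close>, both results can be compared with the structure 2-cell at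
    \<open>x\<close>.\<close>
  have "rwhisk D (PArr \<eta> ?s) (?F (cyl1 C)) \<bullet>\<^bsub>D\<^esub> lwhisk D (?G ?s) L =
      (rwhisk D (PArr \<eta> ?s) (?F (cyl1 C)) \<bullet>\<^bsub>D\<^esub> lwhisk D (?G ?s) (PArr \<eta> (cyl1 C))) \<bullet>\<^bsub>D\<^esub>
      rwhisk D (lwhisk D (?G ?s) ?\<gamma>) (PObj \<eta> X)"
    by (simp add: L_def t D.normalize)
  also have "\<dots> = PArr \<eta> ?x"
    unfolding \<eta>x(2)[symmetric] G.cyl_hat(2)[OF C] by (simp add: t D.unit_assoc)
  finally have L: "rwhisk D (PArr \<eta> ?s) (?F (cyl1 C)) \<bullet>\<^bsub>D\<^esub> lwhisk D (?G ?s) L = PArr \<eta> ?x" .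
  have "rwhisk D (PArr \<eta> ?s) (?F (cyl1 C)) \<bullet>\<^bsub>D\<^esub> lwhisk D (?G ?s) R =
      rwhisk D (PArr \<eta> ?s) (?F (cyl1 C)) \<bullet>\<^bsub>D\<^esub>
        (lwhisk D (?G ?s \<cdot>\<^bsub>D\<^esub> PObj \<eta> ?W) ?\<phi> \<bullet>\<^bsub>D\<^esub> lwhisk D (?G ?s) (PArr \<eta> (cyl0 C)))"
    by (simp add: R_def t D.normalize)
  \<comment> \<open>Sliding past the structure 2-cell at \<open>s\<close> leaves the cylinder 2-cell
    whiskered by the image of \<open>s\<close> under the source functor, where it becomes an
    identity.\<close>
  also have "\<dots> = lwhisk D (PObj \<eta> ?Z \<cdot>\<^bsub>D\<^esub> ?F ?s) ?\<phi> \<bullet>\<^bsub>D\<^esub>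
      (rwhisk D (PArr \<eta> ?s) (?F (cyl0 C)) \<bullet>\<^bsub>D\<^esub> lwhisk D (?G ?s) (PArr \<eta> (cyl0 C)))"
    by (rule D.slide_comp) (simp_all add: t D.unit_assoc)
  also have "\<dots> = lwhisk D (PObj \<eta> ?Z) (lwhisk D (?F ?s) ?\<phi>) \<bullet>\<^bsub>D\<^esub> PArr \<eta> ?x"
    unfolding \<eta>x(1)[symmetric] by (simp add: t D.unit_assoc)
  also have "\<dots> = PArr \<eta> ?x"
    unfolding F.cyl_hat(2)[OF C] by (simp add: t D.unit_assoc)
  finally have R: "rwhisk D (PArr \<eta> ?s) (?F (cyl1 C)) \<bullet>\<^bsub>D\<^esub> lwhisk D (?G ?s) R = PArr \<eta> ?x" .
  \<comment> \<open>Invertibility of the structure 2-cells is used here, to cancel the one at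
    \<open>s\<close>; faithfulness of whiskering with the image of \<open>s\<close> then removes the
    remaining whiskering.\<close>
  obtain \<beta> where \<beta>: "inverse_cells D (?G ?s \<cdot>\<^bsub>D\<^esub> PObj \<eta> ?W) (PObj \<eta> ?Z \<cdot>\<^bsub>D\<^esub> ?F ?s) (PArr \<eta> ?s) \<beta>"
    using \<eta>.PArr_in[of ?s ?W ?Z] by (auto simp: iso_hom2_def hom_def F.cylinder_typing[OF C])
  have "lwhisk D (?G ?s) L = lwhisk D (?G ?s) R"
    by (rule D.VComp_cancel_left[OF D.inverse_rwhisk[OF \<beta>, of "?F (cyl1 C)"]])
      (simp_all add: L R LR hom2_def t D.unit_assoc)
  moreover have "is_equivalence D (?G ?s)" using G.inverts C by (simp add: inverts_def is_cylinder_def)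
  ultimately have "L = R" by (rule D.equivalence_faithful[rotated -1]) (simp_all add: LR t)
  then show ?thesis by (simp add: L_def R_def)
qed

text \<open>Since \<open>f\<close> and \<open>g\<close> are \<open>h\<close> composed with the two
  ends, the structure 2-cells at \<open>f\<close> and \<open>g\<close> split into one at
  \<open>h\<close> and one at an end. The square for the ends is \<open>cylinder_natural\<close>,
  and the cylinder 2-cell then slides past the structure 2-cell at \<open>h\<close>.\<close>

lemma homotopy_natural:
  assumes "inverting_pnt \<eta>"
    and H: "is_homotopy A \<Sigma> f g H"
  shows "PArr \<eta> g \<bullet>\<^bsub>D\<^esub> rwhisk D (homotopy_hat D (PTrg \<eta>) H) (PObj \<eta> (Src A f)) =
    lwhisk D (PObj \<eta> (Trg A f)) (homotopy_hat D (PSrc \<eta>) H) \<bullet>\<^bsub>D\<^esub> PArr \<eta> f"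
proof -
  interpret \<eta>: pseudonatural "disc A" D \<eta> by (rule inverting_pntD[OF assms(1)])
  interpret F: inverting_functor A \<Sigma> D "PSrc \<eta>" by (rule inverting_pntD[OF assms(1)])
  interpret G: inverting_functor A \<Sigma> D "PTrg \<eta>" by (rule inverting_pntD[OF assms(1)])
  note p = \<eta>.P_typing[simplified]
  obtain C h where eq: "H = (C, h)" and C: "is_cylinder A \<Sigma> (Src A f) C" and h: "h \<in> Arr A" "Src A h = cylW C"
    "Trg A h = Trg A f" "h \<cdot>\<^bsub>A\<^esub> cyl0 C = f" "h \<cdot>\<^bsub>A\<^esub> cyl1 C = g"
    using H by (rule F.homotopyE)
  let ?F = "FArr (PSrc \<eta>)" and ?G = "FArr (PTrg \<eta>)" and ?X = "Src A f" and ?Y = "Trg A f" and ?W = "cylW C"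
  let ?\<phi> = "cyl_hat D (PSrc \<eta>) C" and ?\<gamma> = "cyl_hat D (PTrg \<eta>) C"
  have O: "?X \<in> Obj A" "?W \<in> Obj A" "?Y \<in> Obj A" using C Trg_in[OF h(1)] h(3) by (auto simp: is_cylinder_def)
  note t = O h(1-3) F.F_A(1-5) G.F_A(1-5) p F.cylinder_typing[OF C] G.cylinder_typing(15-17)[OF C] D.typing
  have \<eta>fg: "PArr \<eta> f = rwhisk D (PArr \<eta> h) (?F (cyl0 C)) \<bullet>\<^bsub>D\<^esub> lwhisk D (?G h) (PArr \<eta> (cyl0 C))"
    "PArr \<eta> g = rwhisk D (PArr \<eta> h) (?F (cyl1 C)) \<bullet>\<^bsub>D\<^esub> lwhisk D (?G h) (PArr \<eta> (cyl1 C))"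
    using \<eta>.P_Comp[of "cyl0 C" h] \<eta>.P_Comp[of "cyl1 C" h] h by (simp_all add: t)
  have "PArr \<eta> g \<bullet>\<^bsub>D\<^esub> rwhisk D (homotopy_hat D (PTrg \<eta>) H) (PObj \<eta> ?X) =
      rwhisk D (PArr \<eta> h) (?F (cyl1 C)) \<bullet>\<^bsub>D\<^esub> lwhisk D (?G h) (PArr \<eta> (cyl1 C) \<bullet>\<^bsub>D\<^esub> rwhisk D ?\<gamma> (PObj \<eta> ?X))"
    unfolding \<eta>fg by (simp add: eq t D.normalize)
  also have "\<dots> = rwhisk D (PArr \<eta> h) (?F (cyl1 C)) \<bullet>\<^bsub>D\<^esub>
      (lwhisk D (?G h \<cdot>\<^bsub>D\<^esub> PObj \<eta> ?W) ?\<phi> \<bullet>\<^bsub>D\<^esub> lwhisk D (?G h) (PArr \<eta> (cyl0 C)))"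
    unfolding cylinder_natural[OF assms(1) C] by (simp add: t D.normalize)
  also have "\<dots> = lwhisk D (PObj \<eta> ?Y \<cdot>\<^bsub>D\<^esub> ?F h) ?\<phi> \<bullet>\<^bsub>D\<^esub>
      (rwhisk D (PArr \<eta> h) (?F (cyl0 C)) \<bullet>\<^bsub>D\<^esub> lwhisk D (?G h) (PArr \<eta> (cyl0 C)))"
    by (rule D.slide_comp) (simp_all add: t D.unit_assoc)
  also have "\<dots> = lwhisk D (PObj \<eta> ?Y) (homotopy_hat D (PSrc \<eta>) H) \<bullet>\<^bsub>D\<^esub> PArr \<eta> f"
    unfolding \<eta>fg(1)[symmetric] by (simp add: eq t D.unit_assoc)
  finally show ?thesis .
qed

lemma seq_natural:
  assumes "inverting_pnt \<eta>"
    and "homotopy_seq A \<Sigma> f g Hs"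
  shows "PArr \<eta> g \<bullet>\<^bsub>D\<^esub> rwhisk D (seq_hat D (PTrg \<eta>) Hs) (PObj \<eta> (Src A f)) =
    lwhisk D (PObj \<eta> (Trg A f)) (seq_hat D (PSrc \<eta>) Hs) \<bullet>\<^bsub>D\<^esub> PArr \<eta> f"
proof -
  interpret \<eta>: pseudonatural "disc A" D \<eta> by (rule inverting_pntD[OF assms(1)])
  interpret F: inverting_functor A \<Sigma> D "PSrc \<eta>" by (rule inverting_pntD[OF assms(1)])
  interpret G: inverting_functor A \<Sigma> D "PTrg \<eta>" by (rule inverting_pntD[OF assms(1)])
  note p = \<eta>.P_typing[simplified]
  show ?thesis
    using assms(2)
  proof induction
    case (single f g H)
    then show ?case using homotopy_natural[OF assms(1)] by simp
  next
    case (cons f g Hs k H)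
    note fg = homotopy_seqD[OF cons(1)] and gk = is_homotopyD[OF cons(2)]
    note t = fg gk Src_in[OF fg(1)] Trg_in[OF fg(1)] F.F_A(1-5) G.F_A(1-5) p D.typing
      F.seq_hat[OF cons(1)] G.seq_hat[OF cons(1)] F.homotopy_hat[OF cons(2)] G.homotopy_hat[OF cons(2)]
      seq_hat_Cons[OF homotopy_seq_nonempty[OF cons(1)]]
    have H: "PArr \<eta> k \<bullet>\<^bsub>D\<^esub> rwhisk D (homotopy_hat D (PTrg \<eta>) H) (PObj \<eta> (Src A f)) =
        lwhisk D (PObj \<eta> (Trg A f)) (homotopy_hat D (PSrc \<eta>) H) \<bullet>\<^bsub>D\<^esub> PArr \<eta> g"
      using homotopy_natural[OF assms(1) cons(2)] fg by simp
    \<comment> \<open>The square of the last homotopy is pasted onto that of the preceding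
      sequence.\<close>
    have "PArr \<eta> k \<bullet>\<^bsub>D\<^esub> (rwhisk D (homotopy_hat D (PTrg \<eta>) H) (PObj \<eta> (Src A f)) \<bullet>\<^bsub>D\<^esub>
          rwhisk D (seq_hat D (PTrg \<eta>) Hs) (PObj \<eta> (Src A f))) =
        lwhisk D (PObj \<eta> (Trg A f)) (homotopy_hat D (PSrc \<eta>) H) \<bullet>\<^bsub>D\<^esub>
          (PArr \<eta> g \<bullet>\<^bsub>D\<^esub> rwhisk D (seq_hat D (PTrg \<eta>) Hs) (PObj \<eta> (Src A f)))"
      by (rule D.VComp_eq_comp[OF H]) (simp_all add: t)
    then show ?case unfolding cons(3) by (simp add: t D.normalize)
  qed
qed

lemma cell_natural:
  assumes "inverting_pnt \<eta>"
    and "\<alpha> \<in> Cell (Ho A \<Sigma>)"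
  shows "PArr \<eta> (ho_cod \<alpha>) \<bullet>\<^bsub>D\<^esub> rwhisk D (cell_hat D (PTrg \<eta>) \<alpha>) (PObj \<eta> (Src A (ho_dom \<alpha>))) =
    lwhisk D (PObj \<eta> (Trg A (ho_dom \<alpha>))) (cell_hat D (PSrc \<eta>) \<alpha>) \<bullet>\<^bsub>D\<^esub> PArr \<eta> (ho_dom \<alpha>)"
proof -
  interpret \<eta>: pseudonatural "disc A" D \<eta> by (rule inverting_pntD[OF assms(1)])
  interpret F: inverting_functor A \<Sigma> D "PSrc \<eta>" by (rule inverting_pntD[OF assms(1)])
  interpret G: inverting_functor A \<Sigma> D "PTrg \<eta>" by (rule inverting_pntD[OF assms(1)])
  obtain Hs where Hs: "homotopy_seq A \<Sigma> (ho_dom \<alpha>) (ho_cod \<alpha>) Hs" "\<alpha> = ho_class A \<Sigma> (ho_dom \<alpha>) (ho_cod \<alpha>) {Hs}"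
    using assms(2) by (rule Cell_HoE)
  show ?thesis
    using seq_natural[OF assms(1) Hs(1)] F.cell_hat_class[OF Hs(1)] G.cell_hat_class[OF Hs(1)] Hs(2) by simp
qed

abbreviation restr_pnt :: "('o, 'a, ('o, 'a) ho_cell, 'p, 'b, 'd) pnt \<Rightarrow> ('o, 'a, 'a, 'p, 'b, 'd) pnt" where
  "restr_pnt \<theta> \<equiv> whisker_pnt (disc A) \<theta> (ho_incl A \<Sigma>)"

definition ext_pnt :: "('o, 'a, 'a, 'p, 'b, 'd) pnt \<Rightarrow> ('o, 'a, ('o, 'a) ho_cell, 'p, 'b, 'd) pnt" where
  "ext_pnt \<eta> = \<lparr>PSrc = ext (PSrc \<eta>), PTrg = ext (PTrg \<eta>), PObj = PObj \<eta>, PArr = PArr \<eta>\<rparr>"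

lemma ext_pnt_simps [simp]:
  "PSrc (ext_pnt \<eta>) = ext (PSrc \<eta>)" "PTrg (ext_pnt \<eta>) = ext (PTrg \<eta>)" "PObj (ext_pnt \<eta>) = PObj \<eta>" "PArr (ext_pnt \<eta>) = PArr \<eta>"
  by (simp_all add: ext_pnt_def)

lemma inverting_restr_pnt:
  assumes "pseudonatural (Ho A \<Sigma>) D \<theta>"
  shows "inverting_pnt (restr_pnt \<theta>)"
proof -
  interpret i: two_functor "disc A" "Ho A \<Sigma>" "ho_incl A \<Sigma>" by (rule two_functor_ho_incl)
  show ?thesis
    using i.pseudonatural_whisker[OF assms] inverting_restr[OF pseudonaturalD(1)[OF assms]]
      inverting_restr[OF pseudonaturalD(2)[OF assms]]
    by (simp add: inverting_pnt_def restr_def inverting_functor_def inverting_functor_axioms_def)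
qed

text \<open>All axioms but naturality on 2-cells mention only objects and arrows, and hence carry
  over from \<eta>. The remaining one is \<open>cell_natural\<close>.\<close>

lemma pseudonatural_ext:
  assumes "inverting_pnt \<eta>"
  shows "pseudonatural (Ho A \<Sigma>) D (ext_pnt \<eta>)"
proof -
  interpret \<eta>: pseudonatural "disc A" D \<eta> by (rule inverting_pntD[OF assms])
  interpret F: inverting_functor A \<Sigma> D "PSrc \<eta>" by (rule inverting_pntD[OF assms])
  interpret G: inverting_functor A \<Sigma> D "PTrg \<eta>" by (rule inverting_pntD[OF assms])
  have "pseudonatural_axioms (Ho A \<Sigma>) D (ext_pnt \<eta>)"
  proof (unfold_locales, goal_cases)
    case 1 show ?case using \<eta>.PObj_ext by simp
  next
    case 2 show ?case using \<eta>.PArr_ext by simp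
  next
    case (3 X) then show ?case using \<eta>.PObj_in by (simp add: ext_def)
  next
    case (4 f X Y) then show ?case using \<eta>.PArr_in[of f X Y] by (simp add: ext_def)
  next
    case (5 X) then show ?case using \<eta>.PArr_Ident by simp
  next
    case (6 f X Y g Z) then show ?case using \<eta>.PArr_Comp[of f X Y g Z] by (simp add: ext_def)
  next
    case (7 f X Y \<alpha> g)
    then have "\<alpha> \<in> Cell (Ho A \<Sigma>)" "ho_dom \<alpha> = f" "ho_cod \<alpha> = g" "Src A f = X" "Trg A f = Y"
      by (auto simp: hom2_def hom_def)
    then show ?case
      using cell_natural[OF assms, of \<alpha>] by (simp add: ext_def)
  qed
  then show ?thesis
    using two_functor_ext F.inverting_functor_axioms G.inverting_functor_axioms
    by (simp add: pseudonatural_def)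
qed

lemma ext_restr_pnt:
  assumes "pseudonatural (Ho A \<Sigma>) D \<theta>"
  shows "ext_pnt (restr_pnt \<theta>) = \<theta>"
proof (rule pnt_eqI[OF pseudonatural_ext[OF inverting_restr_pnt] assms])
qed (use assms ext_restr pseudonaturalD[OF assms] in \<open>simp_all flip: restr_def\<close>)

lemma restr_ext_pnt:
  assumes "inverting_pnt \<eta>"
  shows "restr_pnt (ext_pnt \<eta>) = \<eta>"
proof (rule pnt_eqI)
  show "pseudonatural (disc A) D (restr_pnt (ext_pnt \<eta>))"
    by (rule inverting_pntD(1)[OF inverting_restr_pnt[OF pseudonatural_ext[OF assms]]])
qed (use inverting_pntD[OF assms] restr_ext in \<open>simp_all flip: restr_def\<close>)

abbreviation restr_modif :: "('o, 'a, ('o, 'a) ho_cell, 'p, 'b, 'd) modif \<Rightarrow> ('o, 'a, 'a, 'p, 'b, 'd) modif" where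
  "restr_modif \<rho> \<equiv> whisker_modif (disc A) \<rho> (ho_incl A \<Sigma>)"

definition ext_modif :: "('o, 'a, 'a, 'p, 'b, 'd) modif \<Rightarrow> ('o, 'a, ('o, 'a) ho_cell, 'p, 'b, 'd) modif" where
  "ext_modif \<rho> = \<lparr>MSrc = ext_pnt (MSrc \<rho>), MTrg = ext_pnt (MTrg \<rho>), MObj = MObj \<rho>\<rparr>"

lemma ext_modif_simps [simp]:
  "MSrc (ext_modif \<rho>) = ext_pnt (MSrc \<rho>)" "MTrg (ext_modif \<rho>) = ext_pnt (MTrg \<rho>)" "MObj (ext_modif \<rho>) = MObj \<rho>"
  by (simp_all add: ext_modif_def)

lemma modification_restr: "modification (Ho A \<Sigma>) D \<rho> \<Longrightarrow> modification (disc A) D (restr_modif \<rho>)"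
  by (rule two_functor.modification_whisker[OF two_functor_ho_incl])

text \<open>The axioms of a modification involve no 2-cells of the source 2-category, so the same
  components work. Its two transformations have the same source and target 2-functors, hence both
  invert \<Sigma> as soon as one does.\<close>

lemma modification_ext:
  assumes "modification (disc A) D \<rho>" "inverting_pnt (MSrc \<rho>)"
  shows "modification (Ho A \<Sigma>) D (ext_modif \<rho>)" "inverting_pnt (MTrg \<rho>)"
proof -
  interpret \<rho>: modification "disc A" D \<rho> by fact
  show t: "inverting_pnt (MTrg \<rho>)"
    using assms(2) \<rho>.same_PSrc \<rho>.same_PTrg \<rho>.T.pseudonatural_axioms by (simp add: inverting_pnt_def)
  show "modification (Ho A \<Sigma>) D (ext_modif \<rho>)"
  proof (rule modificationI)
    show "rwhisk D (MObj (ext_modif \<rho>) (Trg (Ho A \<Sigma>) f)) (FArr (PSrc (MSrc (ext_modif \<rho>))) f) \<bullet>\<^bsub>D\<^esub> PArr (MSrc (ext_modif \<rho>)) f =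
      PArr (MTrg (ext_modif \<rho>)) f \<bullet>\<^bsub>D\<^esub> lwhisk D (FArr (PTrg (MSrc (ext_modif \<rho>))) f) (MObj (ext_modif \<rho>) (Src (Ho A \<Sigma>) f))"
      if "f \<in> Arr (Ho A \<Sigma>)" for f
      using that \<rho>.M_natural[of f] by (simp add: ext_def)
  qed (use t assms(2) pseudonatural_ext \<rho>.same_PSrc \<rho>.same_PTrg \<rho>.MObj_ext \<rho>.MObj_in in simp_all)
qed

lemma ext_restr_modif:
  assumes "modification (Ho A \<Sigma>) D \<rho>"
  shows "ext_modif (restr_modif \<rho>) = \<rho>"
proof (rule modif_eqI[OF _ assms])
  show "modification (Ho A \<Sigma>) D (ext_modif (restr_modif \<rho>))"
    using modification_ext(1)[OF modification_restr[OF assms]] inverting_restr_pnt modificationD(1)[OF assms] by simp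
qed (use modificationD[OF assms] ext_restr_pnt in simp_all)

lemma restr_ext_modif:
  assumes "modification (disc A) D \<rho>" "inverting_pnt (MSrc \<rho>)"
  shows "restr_modif (ext_modif \<rho>) = \<rho>"
proof (rule modif_eqI[OF _ assms(1)])
  show "modification (disc A) D (restr_modif (ext_modif \<rho>))"
    by (rule modification_restr[OF modification_ext(1)[OF assms]])
qed (use modification_ext(2)[OF assms] assms(2) restr_ext_pnt in simp_all)

text \<open>The three target sets are the carriers of \<open>Hom_p_plus \<Sigma> (disc A) D\<close>;
  as in \<open>full_sub2\<close>, a modification is tested on its source transformation.\<close>

lemma bij_restr:
  "bij_betw restr {K. two_functor (Ho A \<Sigma>) D K} {F. two_functor (disc A) D F \<and> inverts D \<Sigma> F}"
  "bij_betw restr_pnt {\<theta>. pseudonatural (Ho A \<Sigma>) D \<theta>} {\<eta>. inverting_pnt \<eta>}"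
  "bij_betw restr_modif {\<rho>. modification (Ho A \<Sigma>) D \<rho>} {\<rho>. modification (disc A) D \<rho> \<and> inverting_pnt (MSrc \<rho>)}"
proof -
  show "bij_betw restr {K. two_functor (Ho A \<Sigma>) D K} {F. two_functor (disc A) D F \<and> inverts D \<Sigma> F}"
  proof (rule bij_betwI[where g = ext])
    show "restr \<in> {K. two_functor (Ho A \<Sigma>) D K} \<rightarrow> {F. two_functor (disc A) D F \<and> inverts D \<Sigma> F}"
      using inverting_restr by (auto simp: inverting_functor_def inverting_functor_axioms_def)
  qed (auto simp: inverting_functorI two_functor_ext ext_restr restr_ext)
  show "bij_betw restr_pnt {\<theta>. pseudonatural (Ho A \<Sigma>) D \<theta>} {\<eta>. inverting_pnt \<eta>}"
    by (rule bij_betwI[where g = ext_pnt])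
      (auto simp: inverting_restr_pnt pseudonatural_ext ext_restr_pnt restr_ext_pnt)
  show "bij_betw restr_modif {\<rho>. modification (Ho A \<Sigma>) D \<rho>} {\<rho>. modification (disc A) D \<rho> \<and> inverting_pnt (MSrc \<rho>)}"
    by (rule bij_betwI[where g = ext_modif])
      (auto simp: modification_restr inverting_restr_pnt modificationD modification_ext ext_restr_modif restr_ext_modif)
qed

end

section \<open>2-natural transformations and the isomorphism theorems\<close>

context two_category_pair
begin

lemma sub_Hom_s: "sub_two_category (Hom_p B D) (Hom_s B D)"
  unfolding Hom_s_def
proof (rule sub_locally_full_sub2[OF Hom_p.two_category_axioms])
  show "strict_pnt B D (Ident (Hom_p B D) F)" if "F \<in> Obj (Hom_p B D)" for F
  proof -
    interpret F: two_functor B D F using that by simp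
    show ?thesis by (simp add: strict_pnt_def F.F_typing B.typing D.unit_assoc)
  qed
next
  fix \<theta> \<eta> assume a: "\<theta> \<in> Arr (Hom_p B D)" "\<eta> \<in> Arr (Hom_p B D)" "Trg (Hom_p B D) \<theta> = Src (Hom_p B D) \<eta>"
    and s: "strict_pnt B D \<theta>" "strict_pnt B D \<eta>"
  interpret \<theta>: pseudonatural B D \<theta> using a by simp
  interpret \<eta>: pseudonatural B D \<eta> using a by simp
  note t = \<theta>.F.F_typing \<theta>.G.F_typing \<eta>.F.F_typing \<eta>.G.F_typing \<theta>.P_typing(1-3) \<eta>.P_typing(1-3) B.typing D.typing
  show "strict_pnt B D (\<eta> \<cdot>\<^bsub>Hom_p B D\<^esub> \<theta>)"
    unfolding strict_pnt_def
  proof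
    fix f assume f: "f \<in> Arr B"
    have G: "PTrg \<theta> = PSrc \<eta>" using a by simp
    have e: "PArr \<theta> f = CId D (PObj \<theta> (Trg B f) \<cdot>\<^bsub>D\<^esub> FArr (PSrc \<theta>) f)"
      "PArr \<eta> f = CId D (PObj \<eta> (Trg B f) \<cdot>\<^bsub>D\<^esub> FArr (PSrc \<eta>) f)"
      using s f by (simp_all add: strict_pnt_def)
    \<comment> \<open>Strictness only says that the structure 2-cell is the identity of its
      codomain. Comparing with its domain gives the commuting square, which is needed for the two
      factors to be identities of the same arrow.\<close>
    have "FArr (PSrc \<eta>) f \<cdot>\<^bsub>D\<^esub> PObj \<theta> (Src B f) = PObj \<theta> (Trg B f) \<cdot>\<^bsub>D\<^esub> FArr (PSrc \<theta>) f"
      using \<theta>.P_typing(5)[OF f] f by (simp add: e t flip: G)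
    then show "PArr (\<eta> \<cdot>\<^bsub>Hom_p B D\<^esub> \<theta>) f =
        CId D (PObj (\<eta> \<cdot>\<^bsub>Hom_p B D\<^esub> \<theta>) (Trg B f) \<cdot>\<^bsub>D\<^esub> FArr (PSrc (\<eta> \<cdot>\<^bsub>Hom_p B D\<^esub> \<theta>)) f)"
      using f G by (simp add: e t D.unit_assoc)
  qed
qed

end

lemma sub_two_category_refl: "two_category C \<Longrightarrow> sub_two_category C C"
  by (simp add: sub_two_category_def sub_two_category_axioms_def two_category.typing)

text \<open>Needed because \<open>Hom_s_plus\<close> is a full sub-2-category of
  \<open>Hom_s\<close>, itself locally full in \<open>Hom_p\<close>.\<close>

lemma sub_two_category_trans:
  assumes "sub_two_category C S" "sub_two_category S T"
  shows "sub_two_category C T"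
proof -
  interpret S: sub_two_category C S by fact
  interpret T: sub_two_category S T by fact
  show ?thesis
    by unfold_locales (use S.sub T.sub S.same T.same T.closed in auto)
qed

lemma bij_betw_Collect:
  assumes "bij_betw f A B" "\<And>x. x \<in> A \<Longrightarrow> P x \<longleftrightarrow> Q (f x)"
  shows "bij_betw f {x \<in> A. P x} {y \<in> B. Q y}"
  using assms by (auto simp: bij_betw_def inj_on_def)

context localizing
begin

text \<open>Serves the strict and the pseudo case alike: any two sub-2-categories matched by the
  three restriction bijections are isomorphic, with functoriality inherited from all of
  \<open>Hom_p\<close>.\<close>

lemma isomorphism_precomp:
  assumes H: "sub_two_category (Hom_p (Ho A \<Sigma>) D) H" and H': "sub_two_category (Hom_p (disc A) D) H'"
    and bij: "bij_betw restr (Obj H) (Obj H')" "bij_betw restr_pnt (Arr H) (Arr H')" "bij_betw restr_modif (Cell H) (Cell H')"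
  shows "twocat_isomorphism H H' (precomp (disc A) (ho_incl A \<Sigma>) H)"
proof (rule twocat_isomorphismI)
  interpret H: sub_two_category "Hom_p (Ho A \<Sigma>) D" H by fact
  let ?P = "precomp (disc A) (ho_incl A \<Sigma>) (Hom_p (Ho A \<Sigma>) D)"
  have P: "FObj ?P F = restr F" if "F \<in> Obj H" for F
    using H.subD(1)[OF that] by (simp add: precomp_def restr_def)
  have P': "FArr ?P \<theta> = restr_pnt \<theta>" if "\<theta> \<in> Arr H" for \<theta>
    using H.subD(2)[OF that] by (simp add: precomp_def)
  have P'': "FCell ?P \<rho> = restr_modif \<rho>" if "\<rho> \<in> Cell H" for \<rho>
    using H.subD(3)[OF that] by (simp add: precomp_def)
  \<comment> \<open>\<open>precomp\<close> is built separately for each source 2-category; this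
    identifies the version for \<open>H\<close> with the cut-down version for \<open>Hom_p\<close>,
    so that \<open>two_functor_sub\<close> applies.\<close>
  have eq: "precomp (disc A) (ho_incl A \<Sigma>) H = \<lparr>FObj = restrict (FObj ?P) (Obj H), FArr = restrict (FArr ?P) (Arr H),
      FCell = restrict (FCell ?P) (Cell H)\<rparr>"
  proof -
    have "restrict (FObj ?P) (Obj H) = restrict restr (Obj H)" "restrict (FArr ?P) (Arr H) = restrict restr_pnt (Arr H)"
      "restrict (FCell ?P) (Cell H) = restrict restr_modif (Cell H)"
      using P P' P'' by (auto intro: restrict_ext)
    then show ?thesis by (simp only: precomp_def restr_def[abs_def])
  qed
  show "two_functor H H' (precomp (disc A) (ho_incl A \<Sigma>) H)"
    unfolding eq
    by (rule two_functor_sub[OF two_functor.two_functor_precomp[OF two_functor_ho_incl D.two_category_axioms] H H'])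
      (use bij P P' P'' in \<open>auto simp: bij_betw_def\<close>)
  show "bij_betw (FObj (precomp (disc A) (ho_incl A \<Sigma>) H)) (Obj H) (Obj H')"
    "bij_betw (FArr (precomp (disc A) (ho_incl A \<Sigma>) H)) (Arr H) (Arr H')"
    "bij_betw (FCell (precomp (disc A) (ho_incl A \<Sigma>) H)) (Cell H) (Cell H')"
    using bij by (simp_all add: precomp_def restr_def cong: bij_betw_cong)
qed

interpretation disc: two_category_pair "disc A" D
  using two_category_disc category_axioms D.two_category_axioms by (simp add: two_category_pair_def)

interpretation Ho_D: two_category_pair "Ho A \<Sigma>" D
  using Ho.two_category_axioms D.two_category_axioms by (simp add: two_category_pair_def)

lemma Hom_p_isomorphism:
  "twocat_isomorphism (Hom_p (Ho A \<Sigma>) D) (Hom_p_plus \<Sigma> (disc A) D)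
    (precomp (disc A) (ho_incl A \<Sigma>) (Hom_p (Ho A \<Sigma>) D))"
proof (rule isomorphism_precomp)
  show "sub_two_category (Hom_p (disc A) D) (Hom_p_plus \<Sigma> (disc A) D)"
    unfolding Hom_p_plus_def by (rule sub_full_sub2[OF disc.Hom_p.two_category_axioms])
  have "{\<rho>. modification (disc A) D \<rho> \<and> inverting_pnt (MSrc \<rho>)} = Cell (Hom_p_plus \<Sigma> (disc A) D)"
    by (auto simp: Hom_p_plus_def inverting_pnt_def modificationD)
  then show "bij_betw restr_modif (Cell (Hom_p (Ho A \<Sigma>) D)) (Cell (Hom_p_plus \<Sigma> (disc A) D))"
    using bij_restr(3) by simp
  have "{\<eta>. inverting_pnt \<eta>} = Arr (Hom_p_plus \<Sigma> (disc A) D)"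
    by (auto simp: Hom_p_plus_def inverting_pnt_def)
  then show "bij_betw restr_pnt (Arr (Hom_p (Ho A \<Sigma>) D)) (Arr (Hom_p_plus \<Sigma> (disc A) D))"
    using bij_restr(2) by simp
  show "bij_betw restr (Obj (Hom_p (Ho A \<Sigma>) D)) (Obj (Hom_p_plus \<Sigma> (disc A) D))"
    using bij_restr(1) by (simp add: Hom_p_plus_def)
qed (rule sub_two_category_refl[OF Ho_D.Hom_p.two_category_axioms])

text \<open>Strictness is a condition on arrows only, and these are common to \<open>A\<close> and
  \<open>Ho A \<Sigma>\<close>; so the bijections restrict to strict transformations.\<close>

lemma strict_restr_pnt: "strict_pnt (disc A) D (restr_pnt \<theta>) \<longleftrightarrow> strict_pnt (Ho A \<Sigma>) D \<theta>"
  using Trg_in by (auto simp: strict_pnt_def)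

lemma Hom_s_isomorphism:
  "twocat_isomorphism (Hom_s (Ho A \<Sigma>) D) (Hom_s_plus \<Sigma> (disc A) D)
    (precomp (disc A) (ho_incl A \<Sigma>) (Hom_s (Ho A \<Sigma>) D))"
proof (rule isomorphism_precomp[OF Ho_D.sub_Hom_s])
  interpret s: sub_two_category "Hom_p (disc A) D" "Hom_s (disc A) D" by (rule disc.sub_Hom_s)
  show "sub_two_category (Hom_p (disc A) D) (Hom_s_plus \<Sigma> (disc A) D)"
    unfolding Hom_s_plus_def
    by (rule sub_two_category_trans[OF s.sub_two_category_axioms sub_full_sub2[OF s.S.two_category_axioms]])
  have "{\<rho> \<in> {\<rho>. modification (disc A) D \<rho> \<and> inverting_pnt (MSrc \<rho>)}.
      strict_pnt (disc A) D (MSrc \<rho>) \<and> strict_pnt (disc A) D (MTrg \<rho>)} = Cell (Hom_s_plus \<Sigma> (disc A) D)"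
    by (auto simp: Hom_s_plus_def s.same inverting_pnt_def) (auto simp: Hom_s_def modificationD)
  then show "bij_betw restr_modif (Cell (Hom_s (Ho A \<Sigma>) D)) (Cell (Hom_s_plus \<Sigma> (disc A) D))"
    using bij_betw_Collect[OF bij_restr(3), of "\<lambda>\<rho>. strict_pnt (Ho A \<Sigma>) D (MSrc \<rho>) \<and> strict_pnt (Ho A \<Sigma>) D (MTrg \<rho>)"
        "\<lambda>\<rho>. strict_pnt (disc A) D (MSrc \<rho>) \<and> strict_pnt (disc A) D (MTrg \<rho>)"]
    by (simp add: Hom_s_def strict_restr_pnt)
  have "{\<eta> \<in> {\<eta>. inverting_pnt \<eta>}. strict_pnt (disc A) D \<eta>} = Arr (Hom_s_plus \<Sigma> (disc A) D)"
    by (auto simp: Hom_s_plus_def s.same inverting_pnt_def) (auto simp: Hom_s_def)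
  then show "bij_betw restr_pnt (Arr (Hom_s (Ho A \<Sigma>) D)) (Arr (Hom_s_plus \<Sigma> (disc A) D))"
    using bij_betw_Collect[OF bij_restr(2), of "strict_pnt (Ho A \<Sigma>) D" "strict_pnt (disc A) D"]
    by (simp add: Hom_s_def strict_restr_pnt)
  show "bij_betw restr (Obj (Hom_s (Ho A \<Sigma>) D)) (Obj (Hom_s_plus \<Sigma> (disc A) D))"
    using bij_restr(1) by (simp add: Hom_s_plus_def Hom_s_def)
qed

end

theorem theorem2p15:
  fixes A :: "('o, 'a) cat"
    and \<Sigma> :: "'a set"
  assumes "category A"
    and "\<Sigma> \<subseteq> Arr A"
    and "\<forall>X \<in> Obj A. Ident A X \<in> \<Sigma>"
    and "two_for_one A \<Sigma>"
    and "\<Sigma> \<subseteq> composites A {f \<in> \<Sigma>. is_split A f}"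
  shows "two_localization TYPE(('p, 'b, 'd) twocat) A \<Sigma> (Ho A \<Sigma>) (ho_incl A \<Sigma>) \<and>
    (\<forall>D :: ('p, 'b, 'd) twocat. two_category D \<longrightarrow>
       twocat_isomorphism (Hom_s (Ho A \<Sigma>) D) (Hom_s_plus \<Sigma> (disc A) D)
         (precomp (disc A) (ho_incl A \<Sigma>) (Hom_s (Ho A \<Sigma>) D)) \<and>
       twocat_isomorphism (Hom_p (Ho A \<Sigma>) D) (Hom_p_plus \<Sigma> (disc A) D)
         (precomp (disc A) (ho_incl A \<Sigma>) (Hom_p (Ho A \<Sigma>) D)))"
proof -
  interpret weak_equivalences A \<Sigma>
    using assms by (simp add: weak_equivalences_def weak_equivalences_axioms_def)
  note i = inverts_ho_incl[OF assms(4,5)]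
  have "localizing A \<Sigma> D" if "two_category D" for D :: "('p, 'b, 'd) twocat"
    using that i weak_equivalences_axioms by (simp add: localizing_def localizing_axioms_def)
  note iso = localizing.Hom_s_isomorphism[OF this] localizing.Hom_p_isomorphism[OF this]
  show ?thesis
    \<comment> \<open>The universal property asks only for a pseudoequivalence, which the
      isomorphism for \<open>Hom_p\<close> provides.\<close>
    using iso isomorphism_imp_pseudoequivalence[OF iso(2)] two_functor_ho_incl i by (auto simp: two_localization_def)
qed

end
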